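(* Let $\Gamma$ be the class $\mathsf{SSP}$ of stationary set preserving forcing notions or the class $\infty\text{-}\mathsf{SC}$ of $\infty$-subcomplete forcing notions. Then $\Gamma$-$\mathsf{DSRP}$ implies $\Gamma$-$\mathsf{SRP}$.
   Context: $[Y]^\omega$ denotes the set of countable subsets of $Y$. $\mathsf{ZFC}^-$ is $\mathsf{ZFC}$ without the power set axiom. $L_\tau^A$ denotes $\langle L_\tau[A],\in,A\cap L_\tau[A]\rangle$. $\mathsf{SSP}$ is the class of forcing notions preserving stationary subsets of $\omega_1$. Fullness: a transitive model $N$ of $\mathsf{ZFC}^-$ is full if there is an ordinal $\gamma>0$ such that $L_\gamma(N)\models\mathsf{ZFC}^-$ and $N$ is regular in $L_\gamma(N)$, meaning that if $a\in N$, $f:a\to N$ and $f\in L_\gamma(N)$, then $\mathrm{ran}(f)\in N$. $\infty$-subcompleteness: a forcing notion $\mathbb{P}$ is $\infty$-subcomplete if there is a cardinal $\theta$ with $\mathbb{P}\in H_\theta$ such that for any $\mathsf{ZFC}^-$ model $N=L_\tau^A$ with $\theta<\tau$ and $H_\theta\subseteq N$, any $\sigma:\bar N\prec N$ such that $\bar N$ is countable, transitive and full and $\mathbb{P},\theta\in\mathrm{ran}(\sigma)$, any $\bar G\subseteq\bar{\mathbb{P}}$ that is $\bar{\mathbb{P}}$-generic over $\bar N$, and any $\bar s\in\bar N$, where $\sigma(\langle\bar\theta,\bar{\mathbb{P}}\rangle)=\langle\theta,\mathbb{P}\rangle$ and $\bar S=\langle\bar s,\bar\theta,\bar{\mathbb{P}}\rangle$,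 there is a condition $p\in\mathbb{P}$ such that whenever $G\subseteq\mathbb{P}$ is $\mathbb{P}$-generic over $V$ with $p\in G$, there is in $V[G]$ a $\sigma'$ with $\sigma':\bar N\prec N$, $\sigma'(\bar S)=\sigma(\bar S)$ and $(\sigma')``\bar G\subseteq G$. $\Gamma$-$\mathsf{SRP}$: for regular $\kappa\ge\omega_2$ and $S\subseteq[H_\kappa]^\omega$ stationary, a continuous $\in$-chain through $S$ of length $\lambda$ is a sequence $\langle X_i\mid i<\lambda\rangle$ of members of $S$, increasing with respect to $\in$, with $X_j=\bigcup_{i<j}X_i$ for limit $j<\lambda$. $\mathbb{P}_S$ is the forcing notion of continuous $\in$-chains through $S$ of countable successor length, ordered by end-extension. $S$ is $\Gamma$-projective stationary if $\mathbb{P}_S\in\Gamma$. $\Gamma$-$\mathsf{SRP}$ says that for every regular $\kappa\ge\omega_2$, every $\Gamma$-projective stationary $S\subseteq[H_\kappa]^\omega$ contains a continuous $\in$-chain of length $\omega_1$. $\Gamma$-$\mathsf{DSRP}$: let $\kappa>\omega_1$ be regular, $\mathcal{S}$ a nonempty collection of stationary subsets of $[H_\kappa]^\omega$, and $\vec{T}=\langle T_i\mid i<\omega_1\rangle$ a sequence of pairwise disjoint stationary subsets of $\omega_1$. The poset $\mathbb{P}^{\mathsf{DSRP}}_{\mathcal{S},\vec{T}}$ consists of all pairs $p=\langle\vec{Q}^p,\vec{S}^p\rangle$ such that for some $\delta^p,\lambda^p<\omega_1$: (1) $\vec{Q}^p=\langle Q^p_\alpha\mid\alpha\le\delta^p\rangle$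 is a continuous $\in$-chain of elements of $[H_\kappa]^\omega$ ($Q^p_\alpha\in Q^p_{\alpha+1}$, with unions at limits); (2) $\vec{S}^p=\langle S^p_i\mid i<\lambda^p\rangle$ with each $S^p_i\in\mathcal{S}$; (3) whenever $\alpha\le\delta^p$ and $i<\omega_1$ are such that $\alpha\in T_i$, then $i<\lambda^p$ and $Q^p_\alpha\in S^p_i$. The ordering is by extension of functions in both coordinates. $\langle\mathcal{S},\vec{T}\rangle$ is $\Gamma$-projective stationary if $\mathbb{P}^{\mathsf{DSRP}}_{\mathcal{S},\vec{T}}\in\Gamma$. For a set $X$, $\langle\vec{Q},\vec{S}\rangle$ is a diagonal chain through $\mathcal{S}$ up to $X$ with respect to $\vec{T}$ if: (1) $\vec{Q}=\langle Q_i\mid i<\omega_1\rangle$ is a continuous $\in$-chain of countable subsets of $H_\kappa$ ($Q_i\in Q_{i+1}$, unions at limits); (2) $\vec{S}=\langle S_i\mid i<\omega_1\rangle$ is a sequence of members of $\mathcal{S}$ such that whenever $i\in T_j$, then $Q_i\in S_j$; (3) $H_\kappa\cap X=\bigcup_{\alpha<\omega_1}Q_\alpha$ and $\langle Q_i\mid i<\alpha\rangle\in H_\kappa\cap X$ for all $\alpha<\omega_1$; (4) $\mathcal{S}\cap X=\{S_i\mid i<\omega_1\}$. $\mathsf{DSRP}(\mathcal{S},\vec{T})$ says that for a sufficiently large regular $\theta$ (so that $\mathcal{S}\subseteq H_\theta$, i.e. $\theta>2^{<\kappa}$), the set of $X\in[H_\theta]^{\omega_1}$ such that $\omega_1\subseteq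 X$ and there is a diagonal chain through $\mathcal{S}$ up to $X$ with respect to $\vec{T}$ is stationary in $H_\theta$. $\Gamma$-$\mathsf{DSRP}$ says that for every regular $\kappa>\omega_1$ and all such $\mathcal{S},\vec{T}$ with $\langle\mathcal{S},\vec{T}\rangle$ $\Gamma$-projective stationary, $\mathsf{DSRP}(\mathcal{S},\vec{T})$ holds. *)

theory Defs
  imports "HOL-Library.Equipollence" "HOL-Library.Countable_Set"
begin

section \<open>The universe of sets\<close>

text \<open>
  The set-theoretic universe \<open>V\<close> is a type of class \<open>zfc\<close>; \<open>elts x\<close> is the HOL set of the
  members of \<open>x\<close>. Separation and replacement are stated for arbitrary HOL predicates and functions.
  The axiom of choice is not listed: it follows from replacement and the choice operator of HOL.
  For the same reason every HOL function between two members of \<open>V\<close> is (coded by) a member of \<open>V\<close>,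
  and the natural numbers of \<open>V\<close> are standard, so that the HOL notions of countability and
  equipollence, applied to \<open>elts x\<close>, are those of \<open>V\<close>.
\<close>

class zfc =
  fixes elts :: "'a \<Rightarrow> 'a set"
  assumes zfc_extensionality: "elts x = elts y \<Longrightarrow> x = y"
    and zfc_foundation: "wf {(x, y). x \<in> elts y}"
    and zfc_pairing: "\<exists>z. elts z = {x, y}"
    and zfc_union: "\<exists>y. elts y = \<Union> (elts ` elts x)"
    and zfc_power: "\<exists>y. elts y = {z. elts z \<subseteq> elts x}"
    and zfc_infinity: "\<exists>x. (\<exists>e\<in>elts x. elts e = {}) \<and>
                          (\<forall>y\<in>elts x. \<exists>z\<in>elts x. elts z = insert y (elts y))"
    and zfc_separation: "\<exists>y. elts y = {z \<in> elts x. P z}"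
    and zfc_replacement: "\<exists>y. elts y = f ` elts x"

text \<open>The member of \<open>V\<close> with the given elements; meaningful only if \<open>A\<close> is not a proper class.\<close>

definition mkset :: "'v::zfc set \<Rightarrow> 'v" where
  "mkset A = (THE x. elts x = A)"

definition upair :: "'v::zfc \<Rightarrow> 'v \<Rightarrow> 'v" where
  "upair x y = mkset {x, y}"

definition kpair :: "'v::zfc \<Rightarrow> 'v \<Rightarrow> 'v" where
  "kpair x y = upair (upair x x) (upair x y)"

definition Transset :: "'v::zfc \<Rightarrow> bool" where
  "Transset x \<longleftrightarrow> (\<forall>y\<in>elts x. elts y \<subseteq> elts x)"

definition Ord :: "'v::zfc \<Rightarrow> bool" where
  "Ord x \<longleftrightarrow> Transset x \<and> (\<forall>y\<in>elts x. Transset y)"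

definition succ :: "'v::zfc \<Rightarrow> 'v" where
  "succ x = mkset (insert x (elts x))"

definition Limit :: "'v::zfc \<Rightarrow> bool" where
  "Limit x \<longleftrightarrow> Ord x \<and> elts x \<noteq> {} \<and> (\<forall>y\<in>elts x. succ y \<in> elts x)"

definition least_Ord :: "('v::zfc \<Rightarrow> bool) \<Rightarrow> 'v" where
  "least_Ord P = (THE x. Ord x \<and> P x \<and> (\<forall>y\<in>elts x. \<not> P y))"

definition omega :: "'v::zfc" where
  "omega = least_Ord (\<lambda>x. infinite (elts x))"

definition omega1 :: "'v::zfc" where
  "omega1 = least_Ord (\<lambda>x. uncountable (elts x))"

definition omega2 :: "'v::zfc" where
  "omega2 = least_Ord (\<lambda>x. \<not> elts x \<lesssim> elts (omega1 :: 'v))"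

definition Card :: "'v::zfc \<Rightarrow> bool" where
  "Card x \<longleftrightarrow> Ord x \<and> (\<forall>y\<in>elts x. \<not> elts y \<approx> elts x)"

definition regular :: "'v::zfc \<Rightarrow> bool" where
  "regular k \<longleftrightarrow> Card k \<and> infinite (elts k) \<and>
     (\<forall>a\<in>elts k. \<forall>f. f ` elts a \<subseteq> elts k \<longrightarrow> (\<exists>b\<in>elts k. f ` elts a \<subseteq> elts b))"

text \<open>\<open>two_less k\<close> is the cardinal \<open>2\<^bsup><k\<^esup>\<close>, the supremum of the cardinals \<open>2\<^bsup>|a|\<^esup>\<close>, \<open>a < k\<close>.\<close>

definition two_less :: "'v::zfc \<Rightarrow> 'v" where
  "two_less k = least_Ord (\<lambda>m. \<forall>a\<in>elts k. Pow (elts a) \<lesssim> elts m)"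

definition tc :: "'v::zfc \<Rightarrow> 'v" where
  "tc x = mkset (\<Inter> {elts y | y. Transset y \<and> elts x \<subseteq> elts y})"

definition Hset :: "'v::zfc \<Rightarrow> 'v" where
  "Hset k = mkset {x. elts (tc x) \<prec> elts k}"

text \<open>The sequence \<open>\<langle>f i | i < l\<rangle>\<close> as a member of \<open>V\<close>.\<close>

definition vseq :: "'v::zfc \<Rightarrow> ('v \<Rightarrow> 'v) \<Rightarrow> 'v" where
  "vseq l f = mkset ((\<lambda>i. kpair i (f i)) ` elts l)"


section \<open>Formulas, truth and forcing\<close>

text \<open>
  Statements about sets. Members of the type \<open>'v\<close> serve as parameters; quantification is
  represented by HOL functions. A statement is evaluated in \<open>V\<close> (\<open>holds\<close>), where parameters denote
  themselves, or in generic extensions (\<open>forces\<close>), where parameters are names. \<open>AllFm\<close> is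
  quantification over all formulas of the first-order language of structures \<open>\<langle>M, \<in>, A\<rangle>\<close>; these are
  the same in \<open>V\<close> and in its generic extensions. Variables in \<open>fm\<close> are de Bruijn indices.
\<close>

datatype fm = FMem nat nat | FEq nat nat | FPred nat | FNeg fm | FConj fm fm | FAll fm

datatype 'v stmt =
    Mem 'v 'v
  | Eq 'v 'v
  | Neg "'v stmt"
  | Conj "'v stmt" "'v stmt"
  | Forall "'v \<Rightarrow> 'v stmt"
  | AllFm "fm \<Rightarrow> 'v stmt"

primrec holds :: "'v::zfc stmt \<Rightarrow> bool" where
  "holds (Mem x y) \<longleftrightarrow> x \<in> elts y"
| "holds (Eq x y) \<longleftrightarrow> x = y"
| "holds (Neg \<phi>) \<longleftrightarrow> \<not> holds \<phi>"
| "holds (Conj \<phi> \<psi>) \<longleftrightarrow> holds \<phi> \<and> holds \<psi>"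
| "holds (Forall F) \<longleftrightarrow> (\<forall>x. holds (F x))"
| "holds (AllFm F) \<longleftrightarrow> (\<forall>\<phi>. holds (F \<phi>))"

definition Imp :: "'v stmt \<Rightarrow> 'v stmt \<Rightarrow> 'v stmt" where
  "Imp \<phi> \<psi> = Neg (Conj \<phi> (Neg \<psi>))"

definition Disj :: "'v stmt \<Rightarrow> 'v stmt \<Rightarrow> 'v stmt" where
  "Disj \<phi> \<psi> = Neg (Conj (Neg \<phi>) (Neg \<psi>))"

definition Iff :: "'v stmt \<Rightarrow> 'v stmt \<Rightarrow> 'v stmt" where
  "Iff \<phi> \<psi> = Conj (Imp \<phi> \<psi>) (Imp \<psi> \<phi>)"

definition Exists :: "('v \<Rightarrow> 'v stmt) \<Rightarrow> 'v stmt" where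
  "Exists F = Neg (Forall (\<lambda>x. Neg (F x)))"

definition AllIn :: "'v \<Rightarrow> ('v \<Rightarrow> 'v stmt) \<Rightarrow> 'v stmt" where
  "AllIn a F = Forall (\<lambda>x. Imp (Mem x a) (F x))"

definition ExIn :: "'v \<Rightarrow> ('v \<Rightarrow> 'v stmt) \<Rightarrow> 'v stmt" where
  "ExIn a F = Exists (\<lambda>x. Conj (Mem x a) (F x))"


subsection \<open>Forcing notions\<close>

text \<open>
  A forcing notion is a set \<open>\<langle>P, \<le>\<rangle>\<close> with \<open>P\<close> nonempty and \<open>\<le>\<close> a preorder of \<open>P\<close>; a largest
  condition is not required. Smaller conditions are stronger.
\<close>

definition carrier :: "'v::zfc \<Rightarrow> 'v" where
  "carrier PP = (THE P. \<exists>R. PP = kpair P R)"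

definition order_rel :: "'v::zfc \<Rightarrow> 'v" where
  "order_rel PP = (THE R. \<exists>P. PP = kpair P R)"

definition le :: "'v::zfc \<Rightarrow> 'v \<Rightarrow> 'v \<Rightarrow> bool" where
  "le PP q p \<longleftrightarrow> kpair q p \<in> elts (order_rel PP)"

definition forcing_notion :: "'v::zfc \<Rightarrow> bool" where
  "forcing_notion PP \<longleftrightarrow>
     (\<exists>P R. PP = kpair P R \<and> elts P \<noteq> {} \<and>
        elts R \<subseteq> {kpair q p | q p. q \<in> elts P \<and> p \<in> elts P} \<and>
        (\<forall>p\<in>elts P. kpair p p \<in> elts R) \<and>
        (\<forall>p\<in>elts P. \<forall>q\<in>elts P. \<forall>r\<in>elts P.
           kpair r q \<in> elts R \<longrightarrow> kpair q p \<in> elts R \<longrightarrow> kpair r p \<in> elts R))"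

definition mkforcing :: "'v::zfc set \<Rightarrow> ('v \<Rightarrow> 'v \<Rightarrow> bool) \<Rightarrow> 'v" where
  "mkforcing P lq =
     kpair (mkset P) (mkset {kpair q p | q p. q \<in> P \<and> p \<in> P \<and> lq q p})"

text \<open>\<open>G\<close> is a filter in the forcing notion \<open>PP\<close> meeting all dense sets that belong to \<open>M\<close>.\<close>

definition generic_over :: "'v::zfc \<Rightarrow> 'v \<Rightarrow> 'v \<Rightarrow> bool" where
  "generic_over M PP G \<longleftrightarrow>
     elts G \<subseteq> elts (carrier PP) \<and> elts G \<noteq> {} \<and>
     (\<forall>p\<in>elts G. \<forall>q\<in>elts (carrier PP). le PP p q \<longrightarrow> q \<in> elts G) \<and>
     (\<forall>p\<in>elts G. \<forall>q\<in>elts G. \<exists>r\<in>elts G. le PP r p \<and> le PP r q) \<and>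
     (\<forall>D\<in>elts M. elts D \<subseteq> elts (carrier PP) \<and>
        (\<forall>p\<in>elts (carrier PP). \<exists>d\<in>elts D. le PP d p) \<longrightarrow> elts G \<inter> elts D \<noteq> {})"


subsection \<open>Names and the forcing relation\<close>

inductive is_name :: "'v::zfc \<Rightarrow> 'v \<Rightarrow> bool" for PP where
  "(\<And>z. z \<in> elts x \<Longrightarrow> \<exists>y p. z = kpair y p \<and> p \<in> elts (carrier PP) \<and> is_name PP y)
   \<Longrightarrow> is_name PP x"

text \<open>The potential elements of a name, with the conditions attached to them.\<close>

definition pairs :: "'v::zfc \<Rightarrow> ('v \<times> 'v) set" where
  "pairs a = {(c, s). kpair c s \<in> elts a}"

text \<open>
  The forcing relation for equality: every potential element of \<open>a\<close> is forced to be equal to some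
  element of \<open>b\<close>, and vice versa. This is the usual recursion on names; by foundation the closure
  condition below has exactly one solution.
\<close>

inductive forces_eq :: "'v::zfc \<Rightarrow> 'v \<Rightarrow> 'v \<Rightarrow> 'v \<Rightarrow> bool" for PP where
  "\<lbrakk>\<forall>x\<in>pairs a. \<forall>q. le PP q p \<and> le PP q (snd x) \<longrightarrow>
      (\<exists>y\<in>pairs b. \<exists>r. le PP r q \<and> le PP r (snd y) \<and> forces_eq PP (fst x) (fst y) r);
    \<forall>y\<in>pairs b. \<forall>q. le PP q p \<and> le PP q (snd y) \<longrightarrow>
      (\<exists>x\<in>pairs a. \<exists>r. le PP r q \<and> le PP r (snd x) \<and> forces_eq PP (fst x) (fst y) r)\<rbrakk>
   \<Longrightarrow> forces_eq PP a b p"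

definition forces_mem :: "'v::zfc \<Rightarrow> 'v \<Rightarrow> 'v \<Rightarrow> 'v \<Rightarrow> bool" where
  "forces_mem PP a b p \<longleftrightarrow>
     (\<forall>q. le PP q p \<longrightarrow>
        (\<exists>y\<in>pairs b. \<exists>r. le PP r q \<and> le PP r (snd y) \<and> forces_eq PP a (fst y) r))"

text \<open>
  \<open>p \<tturnstile>\<^bsub>PP\<^esub> \<phi>\<close> renders ``\<open>\<phi>\<close> holds in \<open>V[G]\<close> whenever \<open>G\<close> is \<open>PP\<close>-generic over \<open>V\<close> with \<open>p \<in> G\<close>''.
\<close>

primrec forces_stmt :: "'v::zfc \<Rightarrow> 'v stmt \<Rightarrow> 'v \<Rightarrow> bool" where
  "forces_stmt PP (Mem a b) = forces_mem PP a b"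
| "forces_stmt PP (Eq a b) = forces_eq PP a b"
| "forces_stmt PP (Neg \<phi>) = (\<lambda>p. \<forall>q. le PP q p \<longrightarrow> \<not> forces_stmt PP \<phi> q)"
| "forces_stmt PP (Conj \<phi> \<psi>) = (\<lambda>p. forces_stmt PP \<phi> p \<and> forces_stmt PP \<psi> p)"
| "forces_stmt PP (Forall F) = (\<lambda>p. \<forall>x. is_name PP x \<longrightarrow> forces_stmt PP (F x) p)"
| "forces_stmt PP (AllFm F) = (\<lambda>p. \<forall>\<phi>. forces_stmt PP (F \<phi>) p)"

abbreviation forces :: "'v::zfc \<Rightarrow> 'v \<Rightarrow> 'v stmt \<Rightarrow> bool" ("(_ \<tturnstile>\<^bsub>_\<^esub> _)" [51, 0, 51] 50) where
  "p \<tturnstile>\<^bsub>PP\<^esub> \<phi> \<equiv> forces_stmt PP \<phi> p"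

text \<open>The canonical names for members of \<open>V\<close> and for the generic filter.\<close>

function check :: "'v::zfc \<Rightarrow> 'v \<Rightarrow> 'v" where
  "check PP x = mkset (\<Union>y\<in>elts x. (\<lambda>p. kpair (check PP y) p) ` elts (carrier PP))"
  by pat_completeness auto
termination
  by (relation "inv_image {(x, y). x \<in> elts y} snd") (simp_all add: zfc_foundation)

definition generic_name :: "'v::zfc \<Rightarrow> 'v" where
  "generic_name PP = mkset ((\<lambda>p. kpair (check PP p) p) ` elts (carrier PP))"

declare check.simps [simp del]


section \<open>Stationary sets\<close>

text \<open>\<open>C\<close> is closed unbounded in the ordinal \<open>a\<close>; \<open>T \<subseteq> a\<close> is stationary in \<open>a\<close>.\<close>

definition club_stmt :: "'v \<Rightarrow> 'v \<Rightarrow> 'v stmt" where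
  "club_stmt a C =
     Conj (AllIn C (\<lambda>x. Mem x a))
    (Conj (AllIn a (\<lambda>x. ExIn C (\<lambda>y. Mem x y)))
          (AllIn a (\<lambda>l. Imp (Conj (Exists (\<lambda>x. Mem x l))
                                   (AllIn l (\<lambda>x. ExIn C (\<lambda>y. Conj (Mem y l) (Mem x y)))))
                             (Mem l C))))"

definition stationary_stmt :: "'v \<Rightarrow> 'v \<Rightarrow> 'v stmt" where
  "stationary_stmt a T =
     Conj (AllIn T (\<lambda>x. Mem x a))
          (Forall (\<lambda>C. Imp (club_stmt a C) (ExIn C (\<lambda>x. Mem x T))))"

text \<open>\<open>subsets_le Y m\<close> is \<open>[Y]\<^sup>m\<close>, the set of subsets of \<open>Y\<close> of size at most \<open>m\<close>.\<close>

definition subsets_le :: "'v::zfc \<Rightarrow> 'v \<Rightarrow> 'v" where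
  "subsets_le Y m = mkset {x. elts x \<subseteq> elts Y \<and> elts x \<lesssim> elts m}"

definition club_in :: "'v::zfc \<Rightarrow> 'v \<Rightarrow> 'v set \<Rightarrow> bool" where
  "club_in Y m C \<longleftrightarrow>
     C \<subseteq> elts (subsets_le Y m) \<and>
     (\<forall>x\<in>elts (subsets_le Y m). \<exists>c\<in>C. elts x \<subseteq> elts c) \<and>
     (\<forall>D x. D \<subseteq> C \<and> D \<noteq> {} \<and> D \<lesssim> elts m \<and>
        (\<forall>a\<in>D. \<forall>b\<in>D. elts a \<subseteq> elts b \<or> elts b \<subseteq> elts a) \<and>
        elts x = \<Union> (elts ` D) \<longrightarrow> x \<in> C)"

definition stationary_in :: "'v::zfc \<Rightarrow> 'v \<Rightarrow> 'v set \<Rightarrow> bool" where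
  "stationary_in Y m S \<longleftrightarrow>
     S \<subseteq> elts (subsets_le Y m) \<and> (\<forall>C. club_in Y m C \<longrightarrow> S \<inter> C \<noteq> {})"


section \<open>Stationary set preserving forcing\<close>

definition SSP :: "'v::zfc set" where
  "SSP = {PP. forcing_notion PP \<and>
     (\<forall>T. holds (stationary_stmt omega1 T) \<longrightarrow>
        (\<forall>p\<in>elts (carrier PP). p \<tturnstile>\<^bsub>PP\<^esub> stationary_stmt (check PP omega1) (check PP T)))}"


section \<open>Infinity-subcomplete forcing\<close>

subsection \<open>Structures, satisfaction and elementary embeddings\<close>

text \<open>A pair \<open>M\<close>, \<open>A\<close> of sets stands for the structure \<open>\<langle>M, \<in>, A\<rangle>\<close>.\<close>

primrec sat_stmt :: "'v \<Rightarrow> 'v \<Rightarrow> fm \<Rightarrow> (nat \<Rightarrow> 'v) \<Rightarrow> 'v stmt" where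
  "sat_stmt M A (FMem i j) = (\<lambda>e. Mem (e i) (e j))"
| "sat_stmt M A (FEq i j) = (\<lambda>e. Eq (e i) (e j))"
| "sat_stmt M A (FPred i) = (\<lambda>e. Mem (e i) A)"
| "sat_stmt M A (FNeg \<phi>) = (\<lambda>e. Neg (sat_stmt M A \<phi> e))"
| "sat_stmt M A (FConj \<phi> \<psi>) = (\<lambda>e. Conj (sat_stmt M A \<phi> e) (sat_stmt M A \<psi> e))"
| "sat_stmt M A (FAll \<phi>) = (\<lambda>e. AllIn M (\<lambda>x. sat_stmt M A \<phi> (case_nat x e)))"

definition sat :: "'v::zfc \<Rightarrow> 'v \<Rightarrow> fm \<Rightarrow> (nat \<Rightarrow> 'v) \<Rightarrow> bool" where
  "sat M A \<phi> e \<longleftrightarrow> holds (sat_stmt M A \<phi> e)"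

text \<open>The free variables of \<open>\<phi>\<close> have indices below \<open>arity \<phi>\<close>.\<close>

primrec arity :: "fm \<Rightarrow> nat" where
  "arity (FMem i j) = max (Suc i) (Suc j)"
| "arity (FEq i j) = max (Suc i) (Suc j)"
| "arity (FPred i) = Suc i"
| "arity (FNeg \<phi>) = arity \<phi>"
| "arity (FConj \<phi> \<psi>) = max (arity \<phi>) (arity \<psi>)"
| "arity (FAll \<phi>) = arity \<phi> - 1"

definition upair_stmt :: "'v \<Rightarrow> 'v \<Rightarrow> 'v \<Rightarrow> 'v stmt" where
  "upair_stmt u x y =
     Conj (Mem x u) (Conj (Mem y u) (AllIn u (\<lambda>w. Disj (Eq w x) (Eq w y))))"

definition pair_stmt :: "'v \<Rightarrow> 'v \<Rightarrow> 'v \<Rightarrow> 'v stmt" where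
  "pair_stmt z x y =
     ExIn z (\<lambda>u. ExIn z (\<lambda>v. Conj (upair_stmt u x x) (Conj (upair_stmt v x y) (upair_stmt z u v))))"

text \<open>\<open>maps_stmt s x y\<close> says that \<open>\<langle>x, y\<rangle> \<in> s\<close>.\<close>

definition maps_stmt :: "'v \<Rightarrow> 'v \<Rightarrow> 'v \<Rightarrow> 'v stmt" where
  "maps_stmt s x y = ExIn s (\<lambda>z. pair_stmt z x y)"

definition function_stmt :: "'v \<Rightarrow> 'v \<Rightarrow> 'v \<Rightarrow> 'v stmt" where
  "function_stmt s M N =
     Conj (AllIn s (\<lambda>z. ExIn M (\<lambda>x. ExIn N (\<lambda>y. pair_stmt z x y))))
          (AllIn M (\<lambda>x. ExIn N (\<lambda>y. Conj (maps_stmt s x y)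
                                          (AllIn N (\<lambda>y'. Imp (maps_stmt s x y') (Eq y' y))))))"

text \<open>
  \<open>preserves_stmt s M A N B \<phi> n\<close> says that for all \<open>x\<^sub>1, \<dots>, x\<^sub>n \<in> M\<close>, \<open>\<phi>\<close> holds of these in
  \<open>\<langle>M, \<in>, A\<rangle>\<close> iff it holds of \<open>s(x\<^sub>1), \<dots>, s(x\<^sub>n)\<close> in \<open>\<langle>N, \<in>, B\<rangle>\<close>; the assignments \<open>d\<close>, \<open>e\<close>
  accumulate the values.
\<close>

primrec preserves_stmt ::
    "'v \<Rightarrow> 'v \<Rightarrow> 'v \<Rightarrow> 'v \<Rightarrow> 'v \<Rightarrow> fm \<Rightarrow> nat \<Rightarrow> (nat \<Rightarrow> 'v) \<Rightarrow> (nat \<Rightarrow> 'v) \<Rightarrow> 'v stmt" where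
  "preserves_stmt s M A N B \<phi> 0 = (\<lambda>d e. Iff (sat_stmt M A \<phi> d) (sat_stmt N B \<phi> e))"
| "preserves_stmt s M A N B \<phi> (Suc n) = (\<lambda>d e.
     AllIn M (\<lambda>x. AllIn N (\<lambda>y. Imp (maps_stmt s x y)
       (preserves_stmt s M A N B \<phi> n (case_nat x d) (case_nat y e)))))"

definition elem_emb_stmt :: "'v \<Rightarrow> 'v \<Rightarrow> 'v \<Rightarrow> 'v \<Rightarrow> 'v \<Rightarrow> 'v stmt" where
  "elem_emb_stmt s M A N B =
     Conj (function_stmt s M N)
          (AllFm (\<lambda>\<phi>. preserves_stmt s M A N B \<phi> (arity \<phi>) (\<lambda>_. undefined) (\<lambda>_. undefined)))"


subsection \<open>Models of ZFC without power set, constructible hierarchies, fullness\<close>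

text \<open>
  \<open>\<langle>M, \<in>, A\<rangle>\<close> is a transitive model of ZFC without the power set axiom, where separation and
  collection are for formulas with the predicate \<open>A\<close>, and choice is the principle that every set
  can be well-ordered. Each clause is the relativization of an axiom to \<open>M\<close>, simplified by means of
  the transitivity of \<open>M\<close>; extensionality and foundation hold in every transitive set.
\<close>

definition ZFC_minus :: "'v::zfc \<Rightarrow> 'v \<Rightarrow> bool" where
  "ZFC_minus M A \<longleftrightarrow>
     Transset M \<and> elts A \<subseteq> elts M \<and>
     (\<forall>x\<in>elts M. \<forall>y\<in>elts M. \<exists>z\<in>elts M. elts z = {x, y}) \<and>
     (\<forall>x\<in>elts M. \<exists>z\<in>elts M. elts z = \<Union> (elts ` elts x)) \<and>
     (\<exists>x\<in>elts M. (\<exists>e\<in>elts x. elts e = {}) \<and>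
        (\<forall>y\<in>elts x. \<exists>z\<in>elts x. elts z = insert y (elts y))) \<and>
     (\<forall>\<phi> e. range e \<subseteq> elts M \<longrightarrow>
        (\<forall>a\<in>elts M. \<exists>b\<in>elts M. elts b = {x \<in> elts a. sat M A \<phi> (case_nat x e)})) \<and>
     (\<forall>\<phi> e. range e \<subseteq> elts M \<longrightarrow>
        (\<forall>a\<in>elts M. (\<forall>x\<in>elts a. \<exists>y\<in>elts M. sat M A \<phi> (case_nat y (case_nat x e))) \<longrightarrow>
           (\<exists>b\<in>elts M. \<forall>x\<in>elts a. \<exists>y\<in>elts b. sat M A \<phi> (case_nat y (case_nat x e))))) \<and>
     (\<forall>a\<in>elts M. \<exists>r\<in>elts M.
        linear_order_on (elts a) {(x, y). kpair x y \<in> elts r} \<and>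
        (\<forall>b\<in>elts M. elts b \<subseteq> elts a \<and> elts b \<noteq> {} \<longrightarrow>
           (\<exists>x\<in>elts b. \<forall>y\<in>elts b. kpair x y \<in> elts r)))"

text \<open>
  The subsets of \<open>M\<close> definable over \<open>\<langle>M, \<in>, A\<rangle>\<close> with parameters. Variable 0 is the defining
  variable; only the parameters that may occur in \<open>\<phi>\<close> are required to be in \<open>M\<close>, which matters
  for \<open>M = \<emptyset>\<close>.
\<close>

definition Definable :: "'v::zfc \<Rightarrow> 'v \<Rightarrow> 'v set" where
  "Definable A M = {y. \<exists>\<phi> e. (\<forall>i. Suc i < arity \<phi> \<longrightarrow> e i \<in> elts M) \<and>
                         elts y = {x \<in> elts M. sat M A \<phi> (case_nat x e)}}"

text \<open>
  The constructible hierarchy relative to the predicate \<open>A\<close>, starting with the transitive set \<open>X\<close>: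
  \<open>L\<^sub>0 = X\<close>, \<open>L\<^sub>a\<^sub>+\<^sub>1 = Definable A L\<^sub>a\<close>, and unions at limits.
\<close>

function Lhier :: "'v::zfc \<Rightarrow> 'v \<Rightarrow> 'v \<Rightarrow> 'v" where
  "Lhier X A a = mkset (elts X \<union> (\<Union>b\<in>elts a. Definable A (Lhier X A b)))"
  by pat_completeness auto
termination
  by (relation "inv_image {(x, y). x \<in> elts y} (\<lambda>(X, A, a). a)") (simp_all add: zfc_foundation)

declare Lhier.simps [simp del]

text \<open>\<open>L_rel A t\<close> is \<open>L\<^sub>t[A]\<close>; \<open>L_over M A t\<close> is \<open>L\<^sub>t(N)\<close> for the structure \<open>N = \<langle>M, \<in>, A\<rangle>\<close>.\<close>

definition L_rel :: "'v::zfc \<Rightarrow> 'v \<Rightarrow> 'v" where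
  "L_rel A t = Lhier (mkset {}) A t"

definition L_over :: "'v::zfc \<Rightarrow> 'v \<Rightarrow> 'v \<Rightarrow> 'v" where
  "L_over M A t = Lhier (tc (upair M A)) (mkset {}) t"

definition full :: "'v::zfc \<Rightarrow> 'v \<Rightarrow> bool" where
  "full M A \<longleftrightarrow>
     ZFC_minus M A \<and>
     (\<exists>g. Ord g \<and> elts g \<noteq> {} \<and> ZFC_minus (L_over M A g) (mkset {}) \<and>
        (\<forall>a\<in>elts M. \<forall>f\<in>elts (L_over M A g). holds (function_stmt f a M) \<longrightarrow>
           (\<exists>r\<in>elts M. elts r = {y. \<exists>x. kpair x y \<in> elts f})))"


subsection \<open>The class\<close>

text \<open>
  In the following, \<open>\<langle>N, \<in>, B\<rangle>\<close> is \<open>L\<^sub>\<tau>\<^sup>A\<close>, and primed variables belong to the countable model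
  \<open>\<langle>N', \<in>, B'\<rangle>\<close>.
\<close>

definition infinity_SC :: "'v::zfc set" where
  "infinity_SC = {PP. forcing_notion PP \<and>
     (\<exists>\<theta>. Card \<theta> \<and> PP \<in> elts (Hset \<theta>) \<and>
       (\<forall>\<tau> A N B. Ord \<tau> \<and> \<theta> \<in> elts \<tau> \<and>
          N = L_rel A \<tau> \<and> B = mkset (elts A \<inter> elts N) \<and>
          ZFC_minus N B \<and> elts (Hset \<theta>) \<subseteq> elts N \<longrightarrow>
         (\<forall>N' B' \<sigma> \<theta>' PP' G' s' S' Y.
            holds (elem_emb_stmt \<sigma> N' B' N B) \<and>
            countable (elts N') \<and> Transset N' \<and> full N' B' \<and>
            kpair (kpair \<theta>' PP') (kpair \<theta> PP) \<in> elts \<sigma> \<and>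
            generic_over N' PP' G' \<and>
            s' \<in> elts N' \<and> S' = kpair s' (kpair \<theta>' PP') \<and> kpair S' Y \<in> elts \<sigma> \<longrightarrow>
           (\<exists>p\<in>elts (carrier PP).
              p \<tturnstile>\<^bsub>PP\<^esub> Exists (\<lambda>s.
                Conj (elem_emb_stmt s (check PP N') (check PP B') (check PP N) (check PP B))
               (Conj (maps_stmt s (check PP S') (check PP Y))
                     (AllIn (check PP G') (\<lambda>g. ExIn (generic_name PP) (\<lambda>h. maps_stmt s g h)))))))))}"


section \<open>The strong reflection principle\<close>

text \<open>\<open>\<langle>Q i | i < l\<rangle>\<close> is a continuous \<open>\<in>\<close>-chain of members of \<open>S\<close>.\<close>

definition cont_chain :: "'v::zfc \<Rightarrow> 'v \<Rightarrow> ('v \<Rightarrow> 'v) \<Rightarrow> bool" where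
  "cont_chain S l Q \<longleftrightarrow>
     (\<forall>i\<in>elts l. Q i \<in> elts S) \<and>
     (\<forall>i. succ i \<in> elts l \<longrightarrow> Q i \<in> elts (Q (succ i))) \<and>
     (\<forall>j\<in>elts l. Limit j \<longrightarrow> elts (Q j) = (\<Union>i\<in>elts j. elts (Q i)))"

definition P_SRP :: "'v::zfc \<Rightarrow> 'v" where
  "P_SRP S = mkforcing
     {vseq (succ d) Q | d Q. d \<in> elts omega1 \<and> cont_chain S (succ d) Q}
     (\<lambda>q p. elts p \<subseteq> elts q)"

definition SRP :: "'v::zfc set \<Rightarrow> bool" where
  "SRP \<Gamma> \<longleftrightarrow>
     (\<forall>\<kappa> S. regular \<kappa> \<and> elts omega2 \<subseteq> elts \<kappa> \<and>
        stationary_in (Hset \<kappa>) omega (elts S) \<and> P_SRP S \<in> \<Gamma> \<longrightarrow>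
        (\<exists>Q. cont_chain S omega1 Q))"


section \<open>The diagonal strong reflection principle\<close>

text \<open>\<open>SS\<close> is the collection of stationary sets; \<open>T i\<close> matters only for \<open>i < \<omega>\<^sub>1\<close>.\<close>

definition P_DSRP :: "'v::zfc \<Rightarrow> 'v \<Rightarrow> ('v \<Rightarrow> 'v) \<Rightarrow> 'v" where
  "P_DSRP \<kappa> SS T = mkforcing
     {kpair (vseq (succ d) Q) (vseq l S) | d l Q S.
        d \<in> elts omega1 \<and> l \<in> elts omega1 \<and>
        cont_chain (subsets_le (Hset \<kappa>) omega) (succ d) Q \<and>
        (\<forall>i\<in>elts l. S i \<in> elts SS) \<and>
        (\<forall>a\<in>elts (succ d). \<forall>i\<in>elts omega1.
           a \<in> elts (T i) \<longrightarrow> i \<in> elts l \<and> Q a \<in> elts (S i))}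
     (\<lambda>q p. \<exists>Qq Sq Qp Sp. q = kpair Qq Sq \<and> p = kpair Qp Sp \<and>
        elts Qp \<subseteq> elts Qq \<and> elts Sp \<subseteq> elts Sq)"

definition diagonal_chain ::
    "'v::zfc \<Rightarrow> 'v \<Rightarrow> ('v \<Rightarrow> 'v) \<Rightarrow> 'v \<Rightarrow> ('v \<Rightarrow> 'v) \<Rightarrow> ('v \<Rightarrow> 'v) \<Rightarrow> bool" where
  "diagonal_chain \<kappa> SS T X Q S \<longleftrightarrow>
     cont_chain (subsets_le (Hset \<kappa>) omega) omega1 Q \<and>
     (\<forall>i\<in>elts omega1. S i \<in> elts SS) \<and>
     (\<forall>i\<in>elts omega1. \<forall>j\<in>elts omega1. i \<in> elts (T j) \<longrightarrow> Q i \<in> elts (S j)) \<and>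
     elts (Hset \<kappa>) \<inter> elts X = (\<Union>a\<in>elts omega1. elts (Q a)) \<and>
     (\<forall>a\<in>elts omega1. vseq a Q \<in> elts (Hset \<kappa>) \<inter> elts X) \<and>
     elts SS \<inter> elts X = S ` elts omega1"

definition DSRP_at :: "'v::zfc \<Rightarrow> 'v \<Rightarrow> ('v \<Rightarrow> 'v) \<Rightarrow> bool" where
  "DSRP_at \<kappa> SS T \<longleftrightarrow>
     (\<exists>\<theta>. regular \<theta> \<and> elts SS \<subseteq> elts (Hset \<theta>) \<and> two_less \<kappa> \<in> elts \<theta> \<and>
        stationary_in (Hset \<theta>) omega1
          {X \<in> elts (subsets_le (Hset \<theta>) omega1).
             elts omega1 \<subseteq> elts X \<and> (\<exists>Q S. diagonal_chain \<kappa> SS T X Q S)})"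

definition DSRP :: "'v::zfc set \<Rightarrow> bool" where
  "DSRP \<Gamma> \<longleftrightarrow>
     (\<forall>\<kappa> SS T. regular \<kappa> \<and> omega1 \<in> elts \<kappa> \<and>
        elts SS \<noteq> {} \<and> (\<forall>S\<in>elts SS. stationary_in (Hset \<kappa>) omega (elts S)) \<and>
        (\<forall>i\<in>elts omega1. holds (stationary_stmt omega1 (T i))) \<and>
        (\<forall>i\<in>elts omega1. \<forall>j\<in>elts omega1. i \<noteq> j \<longrightarrow> elts (T i) \<inter> elts (T j) = {}) \<and>
        P_DSRP \<kappa> SS T \<in> \<Gamma> \<longrightarrow>
        DSRP_at \<kappa> SS T)"

end

theory Submission
  imports Defs
begin

text \<open>
  Diagonal reflection is applied to the singleton \<open>{S}\<close> and to a partition \<open>T\<close> of \<open>omega1\<close> into stationary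
  sets, which exists by Ulam's theorem (\<open>stationary_partition\<close>). As the pieces cover \<open>omega1\<close> and \<open>S\<close> is the
  only stationary set in question, all members of a diagonal chain belong to \<open>S\<close>. A single diagonal chain
  is therefore the chain required by the strong reflection principle, and it remains to see that the
  diagonal poset \<open>PP\<close> belongs to \<open>\<Gamma>\<close> whenever the poset \<open>QQ\<close> of countable chains through \<open>S\<close> does.

  A condition of \<open>PP\<close> amounts to a condition of \<open>QQ\<close> together with a countable ordinal, the length of a
  constant sequence, that bounds the indices of the pieces met so far. Since this length can always be
  increased, two conditions with the same first coordinate are inseparable, and the projection to the
  first coordinate shows that the two posets have the same generic extensions (\<open>fst_proj\<close>). Names translate
  along the projection, and a statement is forced by a condition iff its translation is forced by the
  first coordinate (\<open>forces_t\<close>). Stationary set preservation transfers at once (\<open>SSP_lift\<close>).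

  For subcompleteness (\<open>infinity_SC_lift\<close>) let \<open>\<theta>\<close> witness that \<open>QQ\<close> is subcomplete; its cardinal successor
  witnesses that \<open>PP\<close> is. Given \<open>\<sigma>\<close> with \<open>PP\<close> and the successor of \<open>\<theta>\<close> in its range, \<open>QQ\<close> and \<open>\<theta>\<close> are in the
  range as well, being definable from them. The embedding obtained from \<open>QQ\<close> for the projected generic
  filter sends conditions of the original filter to conditions whose first coordinates are in the
  projected filter, and these are exactly the elements of the generic filter for \<open>PP\<close> (\<open>forces_lift\<close>).

  Since forcing is given by the forcing relation, the generic extension is only accessible through
  forced statements. Two devices keep this manageable: the relation \<open>stmt_rel\<close> between statements of
  the same shape, which yields congruence for forced equality as well as transfer between posets; and
  the closure rules for \<open>definable\<close>, which make elementarity usable without explicit formulas.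
\<close>

section \<open>Sets and classes\<close>

text \<open>The classes \<open>A\<close> for which \<open>mkset A\<close> is meaningful.\<close>

definition small :: "'v::zfc set \<Rightarrow> bool" where
  "small A \<longleftrightarrow> (\<exists>x. elts x = A)"

lemma small_elts [simp, intro]: "small (elts x)"
  by (auto simp: small_def)

lemma elts_mkset [simp]: "small A \<Longrightarrow> elts (mkset A) = A"
  unfolding small_def mkset_def by (rule theI') (metis zfc_extensionality)

lemma elts_inj: "elts x = elts y \<longleftrightarrow> x = y"
  by (metis zfc_extensionality)

lemma elts_eqI: "(\<And>b. b \<in> elts x \<longleftrightarrow> b \<in> elts y) \<Longrightarrow> x = y"
  by (rule zfc_extensionality) (rule set_eqI)

lemma small_image:
  fixes f :: "'v::zfc \<Rightarrow> 'v"
  assumes "small A" shows "small (f ` A)"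
proof -
  obtain x where x: "elts x = A" using assms unfolding small_def by auto
  show ?thesis unfolding small_def x[symmetric] by (rule zfc_replacement)
qed

lemma small_subset:
  assumes "small B" "A \<subseteq> B" shows "small A"
proof -
  obtain x where x: "elts x = B" using assms(1) unfolding small_def by auto
  obtain y where y: "elts y = {z \<in> elts x. z \<in> A}"
    using zfc_separation[of x "\<lambda>z. z \<in> A"] by (rule exE)
  have "elts y = A" unfolding y x using assms(2) by blast
  then show ?thesis unfolding small_def by (rule exI)
qed

lemma small_UN:
  fixes B :: "'v::zfc \<Rightarrow> 'v set"
  assumes "small A" "\<And>x. x \<in> A \<Longrightarrow> small (B x)" shows "small (\<Union>x\<in>A. B x)"
proof -
  obtain z where z: "elts z = (\<lambda>x. mkset (B x)) ` A"
    using small_image[OF assms(1)] unfolding small_def by (rule exE)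
  obtain y where "elts y = \<Union> (elts ` elts z)" using zfc_union[of z] by (rule exE)
  moreover have "elts (mkset (B x)) = B x" if "x \<in> A" for x using assms that by simp
  ultimately have "elts y = (\<Union>x\<in>A. B x)" using z by auto
  then show ?thesis unfolding small_def by (rule exI)
qed

lemma small_pair: "small {x, y}"
  unfolding small_def by (rule zfc_pairing)

lemma small_Un:
  assumes "small A" "small B" shows "small (A \<union> B)"
proof -
  have "small (\<Union>x\<in>{mkset A, mkset B}. elts x)" by (intro small_UN small_pair small_elts)
  then show ?thesis using assms by simp
qed

lemma small_insert: "small A \<Longrightarrow> small (insert x A)"
  using small_Un[OF small_pair[of x x]] by simp

lemma small_empty [simp]: "small {}"
  by (rule small_subset[OF small_elts]) simp

lemma small_Times_image:
  fixes f :: "'v::zfc \<Rightarrow> 'v \<Rightarrow> 'v"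
  assumes "small A" "small B" shows "small {f x y | x y. x \<in> A \<and> y \<in> B}"
proof -
  have "small (\<Union>x\<in>A. (\<lambda>y. f x y) ` B)" by (intro small_UN small_image assms)
  moreover have "(\<Union>x\<in>A. (\<lambda>y. f x y) ` B) = {f x y | x y. x \<in> A \<and> y \<in> B}" by auto
  ultimately show ?thesis by simp
qed

lemma small_Pow: "small {z. elts z \<subseteq> elts x}"
  unfolding small_def by (rule zfc_power)

lemma mem_induct [case_names step]:
  assumes "\<And>x. (\<And>y. y \<in> elts x \<Longrightarrow> P y) \<Longrightarrow> P x" shows "P (x::'v::zfc)"
  using wf_induct[OF zfc_foundation, of P] assms by blast

lemma mem_irrefl: "x \<notin> elts (x::'v::zfc)"
  by (induction x rule: mem_induct) blast

lemma elts_upair [simp]: "elts (upair x y) = {x, y}"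
  unfolding upair_def by (simp add: small_pair)

lemma upair_inject: "upair x y = upair u v \<longleftrightarrow> (x = u \<and> y = v) \<or> (x = v \<and> y = u)"
proof
  assume "upair x y = upair u v"
  then have "{x, y} = {u, v}" by (metis elts_upair)
  then show "(x = u \<and> y = v) \<or> (x = v \<and> y = u)" by (auto simp: doubleton_eq_iff)
next
  show "(x = u \<and> y = v) \<or> (x = v \<and> y = u) \<Longrightarrow> upair x y = upair u v"
    by (auto simp: upair_def insert_commute)
qed

lemma kpair_inject [simp]: "kpair x y = kpair u v \<longleftrightarrow> x = u \<and> y = v"
  unfolding kpair_def upair_inject by auto

lemma elts_kpair: "elts (kpair x y) = {upair x x, upair x y}"
  unfolding kpair_def by simp

lemma elts_succ [simp]: "elts (succ x) = insert x (elts x)"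
  unfolding succ_def by (simp add: small_insert)

lemma elts_vseq [simp]: "elts (vseq l f) = (\<lambda>i. kpair i (f i)) ` elts l"
  unfolding vseq_def by (simp add: small_image)

lemma elts_subsets_le: "elts (subsets_le Y m) = {x. elts x \<subseteq> elts Y \<and> elts x \<lesssim> elts m}"
  unfolding subsets_le_def by (rule elts_mkset) (rule small_subset[OF small_Pow[of Y]], auto)

section \<open>Transitive closures and ordinals\<close>

lemma exists_Transset: "\<exists>y. Transset y \<and> elts x \<subseteq> elts (y::'v::zfc)"
proof (induction x rule: mem_induct)
  case (step x)
  then obtain f where f: "\<And>y. y \<in> elts x \<Longrightarrow> Transset (f y) \<and> elts y \<subseteq> elts (f y)" by metis
  define z where "z = mkset (elts x \<union> (\<Union>y\<in>elts x. elts (f y)))"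
  have z: "elts z = elts x \<union> (\<Union>y\<in>elts x. elts (f y))"
    unfolding z_def by (rule elts_mkset) (intro small_Un small_UN small_elts)
  have "Transset z" unfolding Transset_def z using f unfolding Transset_def by blast
  then show ?case using z by blast
qed

lemma elts_tc: "elts (tc x) = \<Inter> {elts y | y. Transset y \<and> elts x \<subseteq> elts y}"
proof -
  obtain y where y: "Transset y" "elts x \<subseteq> elts y" using exists_Transset by blast
  show ?thesis unfolding tc_def
    by (rule elts_mkset, rule small_subset[OF small_elts[of y]]) (use y in blast)
qed

lemma subset_tc: "elts x \<subseteq> elts (tc x)"
  unfolding elts_tc by blast

lemma Transset_tc: "Transset (tc x)"
  unfolding Transset_def elts_tc by blast

lemma tc_least: "Transset y \<Longrightarrow> elts x \<subseteq> elts y \<Longrightarrow> elts (tc x) \<subseteq> elts y"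
  unfolding elts_tc by blast

lemma tc_mono: "y \<in> elts (tc x) \<Longrightarrow> elts (tc y) \<subseteq> elts (tc x)"
  by (rule tc_least[OF Transset_tc]) (use Transset_tc in \<open>auto simp: Transset_def\<close>)

lemma tc_Transset: "Transset x \<Longrightarrow> tc x = x"
  by (rule zfc_extensionality) (intro subset_antisym subset_tc tc_least subset_refl)

lemma tc_subset_UN: "elts (tc x) \<subseteq> elts x \<union> (\<Union>y\<in>elts x. elts (tc y))"
proof -
  define z where "z = mkset (elts x \<union> (\<Union>y\<in>elts x. elts (tc y)))"
  have z: "elts z = elts x \<union> (\<Union>y\<in>elts x. elts (tc y))"
    unfolding z_def by (rule elts_mkset) (intro small_Un small_UN small_elts)
  have "Transset z" unfolding Transset_def z
  proof (intro ballI subsetI)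
    fix y b assume y: "y \<in> elts x \<union> (\<Union>y\<in>elts x. elts (tc y))" and b: "b \<in> elts y"
    from y obtain c where c: "c \<in> elts x" "y = c \<or> y \<in> elts (tc c)" by auto
    then have "b \<in> elts (tc c)" using b subset_tc[of c] Transset_tc[of c] unfolding Transset_def by auto
    then show "b \<in> elts x \<union> (\<Union>y\<in>elts x. elts (tc y))" using c by auto
  qed
  from tc_least[OF this, of x] show ?thesis using z by auto
qed

text \<open>A set is recovered by Mostowski collapse from the membership relation of its transitive
  closure, copied along an injection into \<open>k\<close>; so the sets of hereditary size at most \<open>|k|\<close> can
  be indexed by relations on \<open>k\<close>.\<close>

lemma small_hereditary: "small {x::'v::zfc. elts (tc x) \<lesssim> elts (k::'v)}"
proof -
  define H where "H = {x::'v. elts (tc x) \<lesssim> elts k}"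
  have "\<forall>x\<in>H. \<exists>f. inj_on f (elts (tc x)) \<and> f ` elts (tc x) \<subseteq> elts k"
    unfolding H_def lepoll_def by simp
  then obtain f where f: "\<And>x. x \<in> H \<Longrightarrow> inj_on (f x) (elts (tc x)) \<and> f x ` elts (tc x) \<subseteq> elts k"
    by metis
  define K where "K = {kpair b c | b c. b \<in> elts k \<and> c \<in> elts k}"
  have sK: "small K" unfolding K_def by (rule small_Times_image) auto
  define R where "R x = {kpair (f x b) (f x c) | b c. b \<in> elts c \<and> c \<in> elts (tc x)}" for x
  define r where "r x = mkset (R x)" for x
  define i where "i x = mkset (f x ` elts x)" for x
  have mt: "b \<in> elts (tc x)" if "b \<in> elts c" "c \<in> elts (tc x)" for b c x
    using that Transset_tc unfolding Transset_def by blast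
  have RK: "R x \<subseteq> K" if "x \<in> H" for x
  proof
    fix z assume "z \<in> R x"
    then obtain b c where z: "z = kpair (f x b) (f x c)" "b \<in> elts c" "c \<in> elts (tc x)"
      unfolding R_def by auto
    then show "z \<in> K" using f[OF that] mt[OF z(2,3)] unfolding K_def by auto
  qed
  have er: "elts (r x) = R x" if "x \<in> H" for x
    unfolding r_def by (rule elts_mkset, rule small_subset[OF sK RK[OF that]])
  have ei: "elts (i x) = f x ` elts x" for x
    unfolding i_def by (intro elts_mkset small_image small_elts)
  have inj: "inj_on (\<lambda>x. kpair (r x) (i x)) H"
  proof (rule inj_onI)
    fix x y assume H: "x \<in> H" "y \<in> H" and "kpair (r x) (i x) = kpair (r y) (i y)"
    then have Re: "R x = R y" and ie: "f x ` elts x = f y ` elts y" using er ei by (metis kpair_inject)+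
    have key: "\<forall>c. b \<in> elts (tc x) \<longrightarrow> c \<in> elts (tc y) \<longrightarrow> f x b = f y c \<longrightarrow> b = c" for b
    proof (induction b rule: mem_induct)
      case (step b)
      show ?case
      proof (intro allI impI)
        fix c assume b: "b \<in> elts (tc x)" and c: "c \<in> elts (tc y)" and e: "f x b = f y c"
        have "d \<in> elts c" if d: "d \<in> elts b" for d
        proof -
          have "kpair (f x d) (f x b) \<in> R y" using Re d b unfolding R_def by blast
          then obtain d' c' where *: "f x d = f y d'" "f x b = f y c'" "d' \<in> elts c'" "c' \<in> elts (tc y)"
            unfolding R_def by auto
          then have "c' = c" using f[OF H(2)] c e by (metis inj_onD)
          then show ?thesis using step[OF d] * mt b d by metis
        qed
        moreover have "d \<in> elts b" if d: "d \<in> elts c" for d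
        proof -
          have "kpair (f y d) (f y c) \<in> R x" using Re d c unfolding R_def by blast
          then obtain d' c' where *: "f y d = f x d'" "f y c = f x c'" "d' \<in> elts c'" "c' \<in> elts (tc x)"
            unfolding R_def by auto
          then have "c' = b" using f[OF H(1)] b e by (metis inj_onD)
          then show ?thesis using step[of d'] * mt c d by metis
        qed
        ultimately show "b = c" by (intro elts_eqI iffI)
      qed
    qed
    show "x = y"
    proof (intro elts_eqI iffI)
      fix b assume b: "b \<in> elts x"
      then obtain c where "c \<in> elts y" "f x b = f y c" using ie by (metis imageE imageI)
      then show "b \<in> elts y" using key b subset_tc by (metis subsetD)
    next
      fix b assume b: "b \<in> elts y"
      then obtain c where "c \<in> elts x" "f x c = f y b" using ie by (metis imageE imageI)
      then show "b \<in> elts x" using key b subset_tc by (metis subsetD)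
    qed
  qed
  define D where "D = {kpair u v | u v. u \<in> {z. elts z \<subseteq> elts (mkset K)} \<and> v \<in> {z. elts z \<subseteq> elts k}}"
  have sD: "small D" unfolding D_def by (rule small_Times_image) (rule small_Pow)+
  have "(\<lambda>x. kpair (r x) (i x)) ` H \<subseteq> D"
  proof (rule image_subsetI)
    fix x assume x: "x \<in> H"
    have "elts (r x) \<subseteq> elts (mkset K)" using er[OF x] RK[OF x] sK by simp
    moreover have "f x ` elts x \<subseteq> elts k"
      by (rule order_trans[OF image_mono[OF subset_tc]]) (rule conjunct2[OF f[OF x]])
    then have "elts (i x) \<subseteq> elts k" unfolding ei .
    ultimately show "kpair (r x) (i x) \<in> D" unfolding D_def by auto
  qed
  then have "small ((\<lambda>x. kpair (r x) (i x)) ` H)" by (rule small_subset[OF sD])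
  then have "small (inv_into H (\<lambda>x. kpair (r x) (i x)) ` (\<lambda>x. kpair (r x) (i x)) ` H)"
    by (rule small_image)
  then show ?thesis using inj unfolding H_def by simp
qed

lemma elts_Hset: "elts (Hset k) = {x. elts (tc x) \<prec> elts k}"
  unfolding Hset_def
  by (rule elts_mkset) (rule small_subset[OF small_hereditary[of k]], auto simp: lesspoll_imp_lepoll)

lemma Ord_elts: "Ord x \<Longrightarrow> y \<in> elts x \<Longrightarrow> Ord y"
  unfolding Ord_def Transset_def by blast

lemma Ord_trans: "Ord z \<Longrightarrow> x \<in> elts y \<Longrightarrow> y \<in> elts z \<Longrightarrow> x \<in> elts z"
  unfolding Ord_def Transset_def by blast

lemma Ord_linear: "Ord x \<Longrightarrow> Ord (y::'v::zfc) \<Longrightarrow> x \<in> elts y \<or> x = y \<or> y \<in> elts x"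
proof (induction x arbitrary: y rule: mem_induct)
  case (step x)
  note IHx = step
  from IHx(3) show ?case
  proof (induction y rule: mem_induct)
    case (step y)
    show ?case
    proof (rule ccontr)
      assume n: "\<not> ?thesis"
      have "elts x \<subseteq> elts y"
      proof
        fix z assume z: "z \<in> elts x"
        from IHx(1)[OF z Ord_elts[OF IHx(2) z] step(2)]
        show "z \<in> elts y" using n z Ord_trans[OF IHx(2) _ z, of y] by auto
      qed
      moreover have "elts y \<subseteq> elts x"
      proof
        fix z assume z: "z \<in> elts y"
        from step(1)[OF z Ord_elts[OF step(2) z]]
        show "z \<in> elts x" using n z Ord_trans[OF step(2) _ z, of x] by auto
      qed
      ultimately show False using n by (metis zfc_extensionality subset_antisym)
    qed
  qed
qed

lemma Ord_subset_iff: "Ord x \<Longrightarrow> Ord y \<Longrightarrow> elts x \<subseteq> elts y \<longleftrightarrow> x \<in> elts y \<or> x = y"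
  using Ord_linear[of x y] Ord_trans[of y _ x] mem_irrefl[of y] by auto

lemma Ord_linear_le: "Ord x \<Longrightarrow> Ord y \<Longrightarrow> x \<in> elts y \<or> elts y \<subseteq> elts x"
  using Ord_linear[of x y] Ord_trans[of x _ y] by auto

lemma OrdI: "(\<And>y. y \<in> elts x \<Longrightarrow> Ord y) \<Longrightarrow> (\<And>y z. y \<in> elts x \<Longrightarrow> z \<in> elts y \<Longrightarrow> z \<in> elts x) \<Longrightarrow> Ord x"
  unfolding Ord_def Transset_def by blast

lemma not_small_Ord: "\<not> small {x::'v::zfc. Ord x}"
proof
  assume *: "small {x::'v. Ord x}"
  then have e: "elts (mkset {x::'v. Ord x}) = {x::'v. Ord x}" by (rule elts_mkset)
  have "Ord (mkset {x::'v. Ord x})"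
    by (rule OrdI; unfold e mem_Collect_eq) (assumption, rule Ord_elts)
  with e have "mkset {x::'v. Ord x} \<in> elts (mkset {x::'v. Ord x})" by simp
  then show False using mem_irrefl by blast
qed

text \<open>The ordinals embeddable in \<open>k\<close> belong to the set of \<open>small_hereditary\<close>, whereas the ordinals form a proper class.\<close>

lemma Hartogs: "\<exists>a. Ord (a::'v) \<and> \<not> elts a \<lesssim> elts (k::'v::zfc)"
proof (rule ccontr)
  assume "\<not> ?thesis"
  then have "{x::'v. Ord x} \<subseteq> {x. elts (tc x) \<lesssim> elts k}"
  proof (intro subsetI CollectI)
    fix x :: 'v assume n: "\<nexists>a. Ord (a::'v) \<and> \<not> elts a \<lesssim> elts k" and "x \<in> {x. Ord x}"
    then have "Ord x" "elts x \<lesssim> elts k" by auto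
    then show "elts (tc x) \<lesssim> elts k" using tc_Transset[of x] unfolding Ord_def by simp
  qed
  then have "small {x::'v. Ord x}" by (rule small_subset[OF small_hereditary])
  then show False using not_small_Ord by (rule notE[rotated])
qed

lemma least_Ord:
  assumes "Ord a" "P (a::'v::zfc)"
  shows "Ord (least_Ord P)" "P (least_Ord P)" "\<And>y. y \<in> elts (least_Ord P) \<Longrightarrow> \<not> P y"
proof -
  have "\<exists>x. Ord x \<and> P x \<and> (\<forall>y\<in>elts x. \<not> P y)" using assms
  proof (induction a rule: mem_induct)
    case (step a)
    then show ?case
      using Ord_elts by (cases "\<exists>y\<in>elts a. P y") auto
  qed
  moreover have "x = y" if "Ord x \<and> P x \<and> (\<forall>y\<in>elts x. \<not> P y)"
    "Ord y \<and> P y \<and> (\<forall>z\<in>elts y. \<not> P z)" for x y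
    using that Ord_linear[of x y] by auto
  ultimately have "\<exists>!x. Ord x \<and> P x \<and> (\<forall>y\<in>elts x. \<not> P y)" by (rule ex_ex1I)
  then have "Ord (least_Ord P) \<and> P (least_Ord P) \<and> (\<forall>y\<in>elts (least_Ord P). \<not> P y)"
    unfolding least_Ord_def by (rule theI')
  then show "Ord (least_Ord P)" "P (least_Ord P)" "\<And>y. y \<in> elts (least_Ord P) \<Longrightarrow> \<not> P y"
    by (auto simp only:)
qed

lemma least_Ord_subset: "Ord a \<Longrightarrow> P a \<Longrightarrow> elts (least_Ord P) \<subseteq> elts a"
proof -
  assume a: "Ord a" "P a"
  note l = least_Ord[of a P, OF a]
  have "a \<notin> elts (least_Ord P)" using l(3) a(2) by (rule contrapos_pn[rotated])
  then have "least_Ord P \<in> elts a \<or> least_Ord P = a" using Ord_linear[OF l(1) a(1)] by (elim disjE) simp_all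
  then show ?thesis using Ord_subset_iff[OF l(1) a(1)] by (rule iffD2[rotated])
qed

lemma small_nat_image: "small (range (f :: nat \<Rightarrow> 'v::zfc))"
proof -
  obtain x e :: 'v where e: "e \<in> elts x" "elts e = {}"
     and s: "\<And>y. y \<in> elts x \<Longrightarrow> \<exists>z\<in>elts x. elts z = insert y (elts y)"
    using zfc_infinity by metis
  define g where "g n = (succ ^^ n) e" for n
  have gx: "g n \<in> elts x" for n
  proof (induction n)
    case (Suc n)
    then show ?case using s[of "g n"] elts_inj[of _ "succ (g n)"] by (auto simp: g_def)
  qed (simp add: g_def e)
  have gm: "g m \<in> elts (g n)" if "m < n" for m n
    using that by (induction n) (auto simp: g_def less_Suc_eq)
  have "inj g" by (rule injI) (metis gm mem_irrefl linorder_neqE_nat)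
  then have "range f = (\<lambda>y. f (inv g y)) ` range g" by (auto simp: image_iff)
  moreover have "small (range g)" by (rule small_subset[OF small_elts[of x]]) (use gx in blast)
  ultimately show ?thesis using small_image by metis
qed

lemma countable_small: "countable A \<Longrightarrow> small (A :: 'v::zfc set)"
  by (cases "A = {}") (simp, metis small_nat_image range_from_nat_into)

lemma exists_countably_infinite: "\<exists>x::'v::zfc. countable (elts x) \<and> infinite (elts x)"
proof -
  obtain a :: 'v where "Ord a" "infinite (elts a)"
  proof -
    have inf: "infinite {x::'v. Ord x}"
    proof
      assume "finite {x::'v. Ord x}"
      then show False using not_small_Ord countable_small[OF countable_finite] by metis
    qed
    obtain f :: "nat \<Rightarrow> 'v" where f: "inj f" "range f \<subseteq> {x::'v. Ord x}"
      using inf infinite_countable_subset by blast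
    obtain x :: 'v where x: "elts x = range f" using small_nat_image[of f] unfolding small_def by auto
    obtain a :: 'v where "Ord a" "\<not> elts a \<lesssim> elts x" using Hartogs by metis
    moreover have "infinite (elts x)" unfolding x by (rule range_inj_infinite[OF f(1)])
    ultimately show ?thesis using that finite_lepoll_infinite by metis
  qed
  then obtain B where "B \<subseteq> elts a" "countable B" "infinite B"
    using infinite_countable_subset' by blast
  then show ?thesis using countable_small[of B] unfolding small_def by metis
qed

lemma omega_props: "Ord (omega::'v::zfc)" "infinite (elts (omega::'v))"
   "\<And>x. x \<in> elts (omega::'v) \<Longrightarrow> finite (elts x)"
proof -
  obtain x :: 'v where "infinite (elts x)" using exists_countably_infinite by blast
  moreover obtain a :: 'v where a: "Ord a" "\<not> elts a \<lesssim> elts x" using Hartogs by metis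
  ultimately have "infinite (elts a)" using finite_lepoll_infinite by blast
  note l = least_Ord[where P = "\<lambda>x. infinite (elts x)", OF a(1) this, folded omega_def]
  show "Ord (omega::'v::zfc)" by (rule l(1))
  show "infinite (elts (omega::'v))" by (rule l(2))
  show "finite (elts x)" if "x \<in> elts (omega::'v)" for x using l(3)[OF that] by (rule notnotD)
qed

lemma omega1_props: "Ord (omega1::'v::zfc)" "uncountable (elts (omega1::'v))"
   "\<And>x. x \<in> elts (omega1::'v) \<Longrightarrow> countable (elts x)"
   "\<And>a::'v. Ord a \<Longrightarrow> uncountable (elts a) \<Longrightarrow> elts (omega1::'v) \<subseteq> elts a"
proof -
  obtain x :: 'v where x: "countable (elts x)" "infinite (elts x)" using exists_countably_infinite by blast
  obtain a :: 'v where a: "Ord a" "\<not> elts a \<lesssim> elts x" using Hartogs by metis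
  have u: "uncountable (elts a)"
  proof
    assume "countable (elts a)"
    moreover have "(UNIV::nat set) \<lesssim> elts x" using x infinite_le_lepoll by blast
    moreover have "elts a \<lesssim> (UNIV::nat set)" using calculation
      by (meson countableE lepoll_def subset_UNIV)
    ultimately show False using a lepoll_trans by blast
  qed
  note l = least_Ord[where P = "\<lambda>x. uncountable (elts x)", OF a(1) u, folded omega1_def]
    least_Ord_subset[where P = "\<lambda>x. uncountable (elts x)", folded omega1_def]
  show "Ord (omega1::'v::zfc)" by (rule l(1))
  show "uncountable (elts (omega1::'v))" by (rule l(2))
  show "countable (elts x)" if "x \<in> elts (omega1::'v)" for x using l(3)[OF that] by (rule notnotD)
  show "elts (omega1::'v) \<subseteq> elts a" if "Ord a" "uncountable (elts a)" for a using l(4)[OF that] .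
qed

lemma countable_lepoll_omega: "elts x \<lesssim> elts (omega::'v::zfc) \<longleftrightarrow> countable (elts x)"
proof -
  have c: "countable (elts (omega::'v))"
  proof (rule ccontr)
    assume "uncountable (elts (omega::'v))"
    moreover obtain a where a: "a \<in> elts (omega::'v)" "infinite (elts a)"
    proof -
      obtain B where B: "B \<subseteq> elts (omega::'v)" "countable B" "infinite B"
        using omega_props infinite_countable_subset' by metis
      have "countable (\<Union>b\<in>B. elts b)"
        using B omega_props(3) countable_finite by (intro countable_UN) auto
      then have "countable ((\<Union>b\<in>B. elts b) \<union> B)" using B by (intro countable_Un)
      then have "\<not> elts (omega::'v) \<subseteq> (\<Union>b\<in>B. elts b) \<union> B" using \<open>uncountable (elts (omega::'v))\<close> countable_subset by metis
      then obtain c where c: "c \<in> elts (omega::'v)" "c \<notin> (\<Union>b\<in>B. elts b)" "c \<notin> B" by auto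
      have "B \<subseteq> elts c"
      proof
        fix b assume b: "b \<in> B"
        then have "Ord b" "Ord c" using B(1) c(1) omega_props(1) Ord_elts by (metis subsetD)+
        moreover have "c \<notin> elts b" "b \<noteq> c" using b c by auto
        ultimately show "b \<in> elts c" using Ord_linear[of b c] by simp
      qed
      then show ?thesis using that c B finite_subset by metis
    qed
    ultimately show False using omega_props by blast
  qed
  show ?thesis
  proof
    assume "countable (elts x)"
    then have "elts x \<lesssim> (UNIV::nat set)" by (meson countableE lepoll_def subset_UNIV)
    moreover have "(UNIV::nat set) \<lesssim> elts (omega::'v)" using omega_props(2) infinite_le_lepoll by metis
    ultimately show "elts x \<lesssim> elts (omega::'v)" by (rule lepoll_trans)
  qed (use c countable_lepoll in blast)
qed

lemma omega1_in_omega2: "omega1 \<in> elts (omega2::'v::zfc)"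
proof -
  obtain a :: 'v where a: "Ord a" "\<not> elts a \<lesssim> elts (omega1::'v)" using Hartogs by metis
  note l = least_Ord[where P="\<lambda>x. \<not> elts x \<lesssim> elts (omega1::'v)", OF a, folded omega2_def]
  have "\<not> elts (omega2::'v) \<subseteq> elts (omega1::'v)"
    using l(2) subset_imp_lepoll by (rule contrapos_nn)
  then show ?thesis using Ord_linear_le[OF omega1_props(1) l(1)] by simp
qed

lemma omega1_bounded:
  assumes "countable A" "A \<subseteq> elts (omega1::'v::zfc)"
  shows "\<exists>b\<in>elts omega1. A \<subseteq> elts b"
proof -
  have "countable (elts b)" if "b \<in> A" for b using omega1_props(3) that assms(2) by auto
  then have "countable (\<Union>b\<in>A. elts b)"
    using assms(1) by (intro countable_UN)
  then have "countable ((\<Union>b\<in>A. elts b) \<union> A)" using assms(1) by (intro countable_Un)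
  then have "\<not> elts (omega1::'v) \<subseteq> (\<Union>b\<in>A. elts b) \<union> A" using omega1_props(2) countable_subset by metis
  then obtain c where c: "c \<in> elts (omega1::'v)" "c \<notin> (\<Union>b\<in>A. elts b)" "c \<notin> A" by auto
  have "A \<subseteq> elts c"
  proof
    fix b assume b: "b \<in> A"
    then have "Ord b" "Ord c" using assms(2) c(1) omega1_props(1) Ord_elts by (metis subsetD)+
    moreover have "c \<notin> elts b" "b \<noteq> c" using b c by auto
    ultimately show "b \<in> elts c" using Ord_linear[of b c] by simp
  qed
  then show ?thesis using c(1) by (rule bexI)
qed

section \<open>Stationary subsets of omega1\<close>

definition club1 :: "'v::zfc set \<Rightarrow> bool" where
  "club1 C \<longleftrightarrow> C \<subseteq> elts omega1 \<and> (\<forall>x\<in>elts omega1. \<exists>y\<in>C. x \<in> elts y) \<and>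
     (\<forall>l\<in>elts omega1. elts l \<noteq> {} \<and> (\<forall>x\<in>elts l. \<exists>y\<in>C. y \<in> elts l \<and> x \<in> elts y) \<longrightarrow> l \<in> C)"

definition stat1 :: "'v::zfc set \<Rightarrow> bool" where
  "stat1 T \<longleftrightarrow> T \<subseteq> elts omega1 \<and> (\<forall>C. club1 C \<longrightarrow> C \<inter> T \<noteq> {})"

lemma holds_derived [simp]:
  "holds (Imp \<phi> \<psi>) \<longleftrightarrow> (holds \<phi> \<longrightarrow> holds \<psi>)"
  "holds (Disj \<phi> \<psi>) \<longleftrightarrow> holds \<phi> \<or> holds \<psi>"
  "holds (Iff \<phi> \<psi>) \<longleftrightarrow> (holds \<phi> \<longleftrightarrow> holds \<psi>)"
  "holds (Exists F) \<longleftrightarrow> (\<exists>x. holds (F x))"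
  "holds (AllIn a F) \<longleftrightarrow> (\<forall>x\<in>elts a. holds (F x))"
  "holds (ExIn a F) \<longleftrightarrow> (\<exists>x\<in>elts a. holds (F x))"
  by (auto simp: Imp_def Disj_def Iff_def Exists_def AllIn_def ExIn_def)

lemma holds_club: "holds (club_stmt omega1 C) \<longleftrightarrow> club1 (elts C)"
  unfolding club_stmt_def club1_def by (simp add: subset_iff ex_in_conv[symmetric] Ball_def)

text \<open>Clubs in \<open>stationary_stmt\<close> are members of \<open>V\<close>, those in \<open>stat1\<close> are arbitrary classes; this makes no
  difference because subclasses of \<open>omega1\<close> are sets.\<close>

lemma stationary_iff_stat1: "holds (stationary_stmt omega1 T) \<longleftrightarrow> stat1 (elts T)"
proof -
  have "(\<forall>C. club1 (elts C) \<longrightarrow> elts C \<inter> elts T \<noteq> {}) \<longleftrightarrow> (\<forall>C. club1 C \<longrightarrow> C \<inter> elts T \<noteq> {})"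
  proof (intro iffI allI impI)
    fix C :: "'a set" assume *: "\<forall>C. club1 (elts C) \<longrightarrow> elts C \<inter> elts T \<noteq> {}" "club1 C"
    then have "small C" using small_subset[OF small_elts] unfolding club1_def by metis
    then have "elts (mkset C) = C" by (rule elts_mkset)
    then show "C \<inter> elts T \<noteq> {}" using * by metis
  qed simp
  moreover have "(\<exists>x\<in>elts C. x \<in> elts T) \<longleftrightarrow> elts C \<inter> elts T \<noteq> {}" for C by auto
  ultimately show ?thesis
    unfolding stationary_stmt_def stat1_def by (simp add: holds_club subset_eq)
qed

lemma club1_INT:
  fixes C :: "nat \<Rightarrow> 'v::zfc set"
  assumes "\<And>n. club1 (C n)" shows "club1 (\<Inter>n. C n)"
  unfolding club1_def
proof (intro conjI ballI impI)
  show "(\<Inter>n. C n) \<subseteq> elts omega1" using assms[of 0] unfolding club1_def by auto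
next
  fix x :: 'v assume x: "x \<in> elts omega1"
  have "\<exists>y. y \<in> C n \<and> z \<in> elts y" if "z \<in> elts omega1" for n z
    using assms[of n] that unfolding club1_def by auto
  note ex = this
  define g where "g n z = (SOME y. y \<in> C n \<and> z \<in> elts y)" for n z
  have g: "g n z \<in> C n \<and> z \<in> elts (g n z)" if "z \<in> elts omega1" for n z
    unfolding g_def by (rule someI_ex[OF ex[OF that]])
  have gw: "g n z \<in> elts omega1" if "z \<in> elts omega1" for n z
    using g[OF that] assms[of n] unfolding club1_def by auto
  \<comment> \<open>Step \<open>k\<close> climbs into the club numbered by the first component of \<open>k\<close>, so that every club is
     entered cofinally often below the supremum.\<close>
  define s where "s = rec_nat x (\<lambda>k z. g (fst (prod_decode k)) z)"
  have s0: "s 0 = x" and sS: "s (Suc k) = g (fst (prod_decode k)) (s k)" for k by (simp_all add: s_def)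
  have sw: "s k \<in> elts omega1" for k
    by (induction k) (simp_all add: s0 sS x gw)
  have sm: "s k \<in> elts (s (Suc k))" for k using g[OF sw] by (simp add: sS)
  have Os: "Ord (s k)" for k using sw Ord_elts omega1_props(1) by metis
  have mono: "elts (s k) \<subseteq> elts (s k')" if "k \<le> k'" for k k'
    using that
  proof (induction rule: dec_induct)
    case (step n)
    then show ?case using Ord_subset_iff[OF Os Os, of n "Suc n"] sm[of n] by auto
  qed simp
  obtain b where b: "b \<in> elts (omega1::'v)" "range s \<subseteq> elts b"
    using omega1_bounded[of "range s"] sw by auto
  have Ob: "Ord b" using b Ord_elts omega1_props(1) by metis
  define A where "A = (\<Union>k. elts (s k))"
  have Ab: "A \<subseteq> elts b" unfolding A_def using b Ord_trans[OF Ob] by auto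
  have A: "Ord (mkset A)" "elts (mkset A) = A"
  proof -
    show e: "elts (mkset A) = A" by (rule elts_mkset[OF small_subset[OF small_elts Ab]])
    show "Ord (mkset A)"
    proof (rule OrdI, unfold e)
      show "Ord y" if "y \<in> A" for y using that Ab Ob Ord_elts by (metis subsetD)
      show "y \<in> A" if "z \<in> A" "y \<in> elts z" for z y
        using that Ord_trans[OF Os] unfolding A_def by auto
    qed
  qed
  have lw: "mkset A \<in> elts omega1"
  proof -
    have "mkset A \<in> elts b \<or> mkset A = b" using Ord_subset_iff[OF A(1) Ob] A(2) Ab by simp
    then show ?thesis using b(1) Ord_trans[OF omega1_props(1) _ b(1)] by auto
  qed
  have xA: "x \<in> A" unfolding A_def using sm[of 0] s0 by (metis UN_I UNIV_I)
  have "mkset A \<in> C n" for n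
  proof -
    have "\<exists>y\<in>C n. y \<in> A \<and> z \<in> elts y" if z: "z \<in> A" for z
    proof -
      obtain k where k: "z \<in> elts (s k)" using z unfolding A_def by auto
      define k' where "k' = prod_encode (n, k)"
      have "k \<le> k'" unfolding k'_def by (rule le_prod_encode_2)
      then have "z \<in> elts (s (Suc k'))" using mono[of k "Suc k'"] k by auto
      moreover have "s (Suc k') \<in> C n" using g[OF sw[of k']] by (simp add: sS k'_def)
      moreover have "s (Suc k') \<in> A" unfolding A_def using sm by auto
      ultimately show ?thesis by auto
    qed
    then show ?thesis using assms[of n] lw A(2) xA unfolding club1_def by auto
  qed
  then show "\<exists>y\<in>\<Inter>n. C n. x \<in> elts y" using A(2) xA by (intro bexI[of _ "mkset A"]) auto
next
  fix l :: 'v assume l: "l \<in> elts omega1"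
    and *: "elts l \<noteq> {} \<and> (\<forall>x\<in>elts l. \<exists>y\<in>\<Inter>n. C n. y \<in> elts l \<and> x \<in> elts y)"
  have "l \<in> C n" for n
    using assms[of n] l * unfolding club1_def by (metis INT_D UNIV_I)
  then show "l \<in> (\<Inter>n. C n)" by auto
qed

text \<open>The order isomorphism of a set of ordinals with an ordinal.\<close>

function coll :: "'v::zfc set \<Rightarrow> 'v \<Rightarrow> 'v" where
  "coll A x = mkset (coll A ` (A \<inter> elts x))"
  by pat_completeness auto
termination
  by (relation "inv_image {(x, y). x \<in> elts y} snd") (simp_all add: zfc_foundation)

declare coll.simps [simp del]

lemma elts_coll: "elts (coll A x) = coll A ` (A \<inter> elts x)"
  by (subst coll.simps, rule elts_mkset, rule small_image, rule small_subset[OF small_elts[of x]]) simp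

lemma uncountable_subset_omega1:
  assumes "A \<subseteq> elts (omega1::'v::zfc)" "uncountable A"
  shows "\<exists>f::'v \<Rightarrow> 'v. inj_on f (elts omega1) \<and> f ` elts omega1 \<subseteq> A"
proof -
  have OA: "Ord a" if "a \<in> A" for a using that assms Ord_elts omega1_props(1) by (metis subsetD)
  have Tr: "Transset (coll A a)" if "Ord a" for a
    unfolding Transset_def elts_coll
  proof (intro ballI)
    fix y assume "y \<in> coll A ` (A \<inter> elts a)"
    then obtain b where b: "y = coll A b" "b \<in> A" "b \<in> elts a" by auto
    show "elts y \<subseteq> coll A ` (A \<inter> elts a)"
      unfolding b(1) elts_coll using Ord_trans[OF that _ b(3)] by auto
  qed
  have Oc: "Ord (coll A a)" if "a \<in> A" for a
    unfolding Ord_def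
  proof (intro conjI ballI)
    show "Transset (coll A a)" using Tr OA[OF that] .
    fix y assume "y \<in> elts (coll A a)"
    then obtain b where "y = coll A b" "b \<in> A" unfolding elts_coll by auto
    then show "Transset y" using Tr OA by simp
  qed
  have inj: "inj_on (coll A) A"
  proof (rule inj_onI)
    fix a b assume ab: "a \<in> A" "b \<in> A" "coll A a = coll A b"
    have "a \<notin> elts b" "b \<notin> elts a"
      using ab mem_irrefl[of "coll A a"] elts_coll[of A a] elts_coll[of A b] by (metis IntI image_eqI)+
    then show "a = b" using Ord_linear[OF OA[OF ab(1)] OA[OF ab(2)]] by simp
  qed
  define R where "R = coll A ` A"
  have sR: "small R" unfolding R_def by (intro small_image small_subset[OF small_elts assms(1)])
  have R: "Ord (mkset R)" "elts (mkset R) = R"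
  proof -
    show e: "elts (mkset R) = R" by (rule elts_mkset[OF sR])
    show "Ord (mkset R)"
    proof (rule OrdI, unfold e)
      show "Ord y" if "y \<in> R" for y using that Oc unfolding R_def by auto
      show "y \<in> R" if "z \<in> R" "y \<in> elts z" for z y using that unfolding R_def by (auto simp: elts_coll)
    qed
  qed
  have "uncountable R" unfolding R_def using assms(2) inj countable_image_inj_on by metis
  then have "elts omega1 \<subseteq> R" using omega1_props(4)[OF R(1)] R(2) by simp
  then have sub: "elts omega1 \<subseteq> coll A ` A" unfolding R_def .
  have "inj_on (inv_into A (coll A)) (elts omega1)" using sub by (rule inj_on_inv_into)
  moreover have "inv_into A (coll A) ` elts omega1 \<subseteq> A"
    by (rule image_subsetI, rule inv_into_into, rule subsetD[OF sub])
  ultimately show ?thesis by (intro exI[of _ "inv_into A (coll A)"] conjI)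
qed

lemma stat1_superset: "stat1 T \<Longrightarrow> T \<subseteq> T' \<Longrightarrow> T' \<subseteq> elts omega1 \<Longrightarrow> stat1 T'"
  unfolding stat1_def by blast

text \<open>Ulam's matrix. Fix injections \<open>f a\<close> of the countable ordinals \<open>a\<close> into the natural numbers, and let
  \<open>U n x\<close> consist of the \<open>a\<close> above \<open>x\<close> with \<open>f a x = n\<close>. For fixed \<open>x\<close> these countably many sets cover a
  final segment, so one of them is stationary; for fixed \<open>n\<close> they are pairwise disjoint. Some \<open>n\<close> serves
  uncountably many \<open>x\<close>.\<close>

lemma disjoint_stationary_sets:
  "\<exists>W::'v::zfc \<Rightarrow> 'v set. (\<forall>i\<in>elts omega1. stat1 (W i)) \<and>
     (\<forall>i\<in>elts omega1. \<forall>j\<in>elts omega1. i \<noteq> j \<longrightarrow> W i \<inter> W j = {})"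
proof -
  have "\<exists>f :: 'v \<Rightarrow> nat. inj_on f (elts a)" if "a \<in> elts (omega1::'v)" for a
    using omega1_props(3)[OF that] by (auto elim: countableE)
  then obtain f :: "'v \<Rightarrow> 'v \<Rightarrow> nat" where f: "\<And>a. a \<in> elts omega1 \<Longrightarrow> inj_on (f a) (elts a)" by metis
  define U where "U n x = {a \<in> elts omega1. x \<in> elts a \<and> f a x = n}" for n x
  have "\<exists>n. stat1 (U n x)" if x: "x \<in> elts omega1" for x
  proof (rule ccontr)
    assume "\<not> ?thesis"
    then have "\<exists>C. club1 C \<and> C \<inter> U n x = {}" for n
      unfolding stat1_def U_def by auto
    then obtain C where C: "\<And>n. club1 (C n) \<and> C n \<inter> U n x = {}" by metis
    then have "club1 (\<Inter>n. C n)" using club1_INT by metis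
    then obtain a where a: "a \<in> (\<Inter>n. C n)" "x \<in> elts a" "a \<in> elts omega1"
      using x unfolding club1_def by blast
    then have "a \<in> C (f a x) \<inter> U (f a x) x" unfolding U_def by auto
    then show False using C by auto
  qed
  then obtain n where n: "\<And>x. x \<in> elts omega1 \<Longrightarrow> stat1 (U (n x) x)" by metis
  have "\<exists>m. uncountable {x \<in> elts (omega1::'v). n x = m}"
  proof (rule ccontr)
    assume "\<not> ?thesis"
    then have "countable (\<Union>m\<in>UNIV. {x \<in> elts (omega1::'v). n x = m})" by (intro countable_UN) auto
    moreover have "(\<Union>m\<in>UNIV. {x \<in> elts (omega1::'v). n x = m}) = elts omega1" by auto
    ultimately show False using omega1_props(2)[where 'v = 'v] by simp
  qed
  then obtain m where "uncountable {x \<in> elts (omega1::'v). n x = m}" by auto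
  then obtain e where e: "inj_on e (elts (omega1::'v))" "e ` elts omega1 \<subseteq> {x \<in> elts omega1. n x = m}"
    using uncountable_subset_omega1[of "{x \<in> elts (omega1::'v). n x = m}"] by auto
  have "stat1 (U m (e i))" if "i \<in> elts omega1" for i
    using n[of "e i"] e(2) that by auto
  moreover have "U m (e i) \<inter> U m (e j) = {}" if "i \<in> elts omega1" "j \<in> elts omega1" "i \<noteq> j" for i j
  proof -
    have "e i \<noteq> e j" using e(1) that by (metis inj_onD)
    moreover have "x = y" if "a \<in> elts omega1" "x \<in> elts a" "y \<in> elts a" "f a x = f a y" for a x y
      using inj_onD[OF f[OF that(1)] that(4) that(2,3)] .
    ultimately show ?thesis unfolding U_def by auto
  qed
  ultimately show ?thesis by (intro exI[of _ "\<lambda>i. U m (e i)"]) auto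
qed

lemma omega1_empty_mem: "mkset {} \<in> elts (omega1::'v::zfc)"
proof -
  have "Ord (mkset {}::'v)" unfolding Ord_def Transset_def by simp
  then show ?thesis using Ord_linear_le[OF _ omega1_props(1)] omega1_props(2) countable_subset
    by (metis countable_empty elts_mkset small_empty)
qed

text \<open>Whatever the disjoint sets leave over is added to the one with index 0.\<close>

lemma stationary_partition:
  "\<exists>T::'v::zfc \<Rightarrow> 'v. (\<forall>i\<in>elts omega1. stat1 (elts (T i))) \<and>
     (\<forall>i\<in>elts omega1. \<forall>j\<in>elts omega1. i \<noteq> j \<longrightarrow> elts (T i) \<inter> elts (T j) = {}) \<and>
     (\<forall>a\<in>elts omega1. \<exists>i\<in>elts omega1. a \<in> elts (T i))"
proof -
  obtain W :: "'v \<Rightarrow> 'v set" where W: "\<And>i. i \<in> elts omega1 \<Longrightarrow> stat1 (W i)"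
    "\<And>i j. i \<in> elts omega1 \<Longrightarrow> j \<in> elts omega1 \<Longrightarrow> i \<noteq> j \<Longrightarrow> W i \<inter> W j = {}"
    using disjoint_stationary_sets by metis
  define z :: 'v where "z = mkset {}"
  have z: "z \<in> elts omega1" unfolding z_def by (rule omega1_empty_mem)
  define W' where "W' i = (if i = z then elts omega1 - (\<Union>j\<in>elts omega1 - {z}. W j) else W i)" for i
  have W1: "W i \<subseteq> elts omega1" if "i \<in> elts omega1" for i using W(1)[OF that] unfolding stat1_def by simp
  have W'1: "W' i \<subseteq> elts omega1" if "i \<in> elts omega1" for i using W1[OF that] unfolding W'_def by auto
  have el: "elts (mkset (W' i)) = W' i" if "i \<in> elts omega1" for i
    by (rule elts_mkset, rule small_subset[OF small_elts W'1[OF that]])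
  have st: "stat1 (W' i)" if i: "i \<in> elts omega1" for i
  proof (rule stat1_superset[OF W(1)[OF i] _ W'1[OF i]])
    show "W i \<subseteq> W' i" unfolding W'_def using W1[OF i] W(2)[OF i] by auto
  qed
  have dis: "W' i \<inter> W' j = {}" if "i \<in> elts omega1" "j \<in> elts omega1" "i \<noteq> j" for i j
    using W(2)[OF that] that unfolding W'_def by auto
  have cov: "\<exists>i\<in>elts omega1. a \<in> W' i" if "a \<in> elts omega1" for a
    using that z unfolding W'_def by (cases "\<exists>j\<in>elts omega1 - {z}. a \<in> W j") auto
  show ?thesis
    using el st dis cov by (intro exI[of _ "\<lambda>i. mkset (W' i)"]) simp
qed

section \<open>Cardinal arithmetic and stationary subsets of the countable subsets\<close>

lemma lepoll_iff_ordLeq: "A \<lesssim> B \<longleftrightarrow> ordLeq3 (card_of A) (card_of B)"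
  unfolding lepoll_def by (rule card_of_ordLeq)

lemma UN_lepoll:
  assumes "infinite M" "I \<lesssim> M" "\<And>i. i \<in> I \<Longrightarrow> A i \<lesssim> M" shows "(\<Union>i\<in>I. A i) \<lesssim> M"
  using assms unfolding lepoll_iff_ordLeq by (intro card_of_UNION_ordLeq_infinite) auto

lemma Un_lepoll:
  assumes "infinite M" "A \<lesssim> M" "B \<lesssim> M" shows "A \<union> B \<lesssim> M"
proof -
  have "{True, False} \<lesssim> M" using assms(1) by (intro finite_lepoll_infinite) auto
  then have "(\<Union>i\<in>{True, False}. if i then A else B) \<lesssim> M" using assms by (intro UN_lepoll) auto
  then show ?thesis by (simp add: Un_commute)
qed

lemma Times_lepoll:
  assumes "infinite M" "A \<lesssim> M" "B \<lesssim> M" shows "A \<times> B \<lesssim> M"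
proof -
  have "(\<Union>a\<in>A. Pair a ` B) \<lesssim> M" 
    using assms image_lepoll lepoll_trans by (intro UN_lepoll) blast+
  moreover have "(\<Union>a\<in>A. Pair a ` B) = A \<times> B" by auto
  ultimately show ?thesis by simp
qed

lemma club_in_mem:
  assumes "infinite (elts m)" "a \<in> elts Y"
  shows "club_in Y m {x \<in> elts (subsets_le Y m). a \<in> elts x}"
  unfolding club_in_def
proof (intro conjI ballI allI impI)
  fix x assume "x \<in> elts (subsets_le Y m)"
  then have x: "elts x \<subseteq> elts Y" "elts x \<lesssim> elts m" unfolding elts_subsets_le by auto
  define c where "c = mkset (insert a (elts x))"
  have c: "elts c = insert a (elts x)" unfolding c_def by (intro elts_mkset small_insert small_elts)
  have "{a} \<lesssim> elts m" using assms(1) by (intro finite_lepoll_infinite) auto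
  then have "elts c \<lesssim> elts m" unfolding c using Un_lepoll[OF assms(1) _ x(2), of "{a}"] by simp
  then show "\<exists>c\<in>{x \<in> elts (subsets_le Y m). a \<in> elts x}. elts x \<subseteq> elts c"
    using c x assms(2) unfolding elts_subsets_le by (intro bexI[of _ c]) auto
next
  fix D x assume D: "D \<subseteq> {x \<in> elts (subsets_le Y m). a \<in> elts x} \<and> D \<noteq> {} \<and> D \<lesssim> elts m \<and>
     (\<forall>a\<in>D. \<forall>b\<in>D. elts a \<subseteq> elts b \<or> elts b \<subseteq> elts a) \<and> elts x = \<Union> (elts ` D)"
  have "(\<Union>d\<in>D. elts d) \<lesssim> elts m"
    by (rule UN_lepoll) (use assms D in \<open>auto simp: elts_subsets_le\<close>)
  then show "x \<in> {x \<in> elts (subsets_le Y m). a \<in> elts x}"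
    using D by (auto simp: elts_subsets_le)
qed simp

lemma stationary_inD: "stationary_in Y m S \<Longrightarrow> club_in Y m C \<Longrightarrow> S \<inter> C \<noteq> {}"
  unfolding stationary_in_def by simp

lemma stationary_in_nonempty: "infinite (elts m) \<Longrightarrow> a \<in> elts Y \<Longrightarrow> stationary_in Y m S \<Longrightarrow> S \<noteq> {}"
  using stationary_inD[OF _ club_in_mem[of m a Y]] by auto

text \<open>The union of a countable \<open>S\<close> is countable, hence omits some \<open>a\<close>, and the sets that contain \<open>a\<close> form a
  club.\<close>

lemma stationary_in_uncountable:
  fixes Y :: "'v::zfc"
  assumes "stationary_in Y omega S" "uncountable (elts Y)"
  shows "uncountable S"
proof
  assume c: "countable S"
  have "countable (elts x)" if "x \<in> S" for x
    using that assms(1) unfolding stationary_in_def elts_subsets_le countable_lepoll_omega by auto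
  then have "countable (\<Union>x\<in>S. elts x)" using c by (intro countable_UN)
  then have "\<not> elts Y \<subseteq> (\<Union>x\<in>S. elts x)" using assms(2) countable_subset by metis
  then obtain a where a: "a \<in> elts Y" "a \<notin> (\<Union>x\<in>S. elts x)" by auto
  have "S \<inter> {x \<in> elts (subsets_le Y omega). a \<in> elts x} \<noteq> {}"
    by (rule stationary_inD[OF assms(1) club_in_mem[OF omega_props(2) a(1)]])
  then show False using a(2) by auto
qed

lemma omega1_subset_Hset:
  assumes "Ord k" "elts (omega1::'v::zfc) \<subseteq> elts (k::'v)"
  shows "elts omega1 \<subseteq> elts (Hset k)"
proof
  fix a :: 'v assume a: "a \<in> elts omega1"
  have "tc a = a" using tc_Transset Ord_elts[OF omega1_props(1) a] unfolding Ord_def by metis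
  moreover have "countable (elts a)" using omega1_props(3)[OF a] .
  moreover have "uncountable (elts k)" using assms(2) omega1_props(2) countable_subset by metis
  moreover have "elts a \<subseteq> elts k" using a Ord_trans[OF omega1_props(1) _ a] assms(2) by auto
  ultimately show "a \<in> elts (Hset k)" unfolding elts_Hset
    using subset_imp_lepoll[of "elts a" "elts k"] countable_eqpoll eqpoll_sym lepoll_iff_leqpoll
    by (metis mem_Collect_eq)
qed

section \<open>The two forcing notions\<close>

lemma carrier_kpair [simp]: "carrier (kpair P R) = P"
  unfolding carrier_def by (rule the_equality) auto

lemma order_rel_kpair [simp]: "order_rel (kpair P R) = R"
  unfolding order_rel_def by (rule the_equality) auto

lemma small_order:
  fixes P :: "'v::zfc set"
  assumes "small P" shows "small {kpair q p | q p. q \<in> P \<and> p \<in> P \<and> lq q p}"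
  by (rule small_subset[OF small_Times_image[OF assms assms, of kpair]]) auto

lemma elts_carrier_mkforcing: "small P \<Longrightarrow> elts (carrier (mkforcing P lq)) = P"
  unfolding mkforcing_def by simp

lemma elts_order_mkforcing:
  "small P \<Longrightarrow> elts (order_rel (mkforcing P lq)) = {kpair q p | q p. q \<in> P \<and> p \<in> P \<and> lq q p}"
  unfolding mkforcing_def by (simp add: small_order)

lemma mkforcing_kpair: "mkforcing P lq = kpair (carrier (mkforcing P lq)) (order_rel (mkforcing P lq))"
  unfolding mkforcing_def by simp

lemma forcing_notion_mkforcing:
  assumes "small P" "P \<noteq> {}" "\<And>p. p \<in> P \<Longrightarrow> lq p p"
    "\<And>p q r. p \<in> P \<Longrightarrow> q \<in> P \<Longrightarrow> r \<in> P \<Longrightarrow> lq r q \<Longrightarrow> lq q p \<Longrightarrow> lq r p"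
  shows "forcing_notion (mkforcing P lq)"
  unfolding forcing_notion_def
proof (intro exI conjI)
  show "mkforcing P lq = kpair (carrier (mkforcing P lq)) (order_rel (mkforcing P lq))"
    by (rule mkforcing_kpair)
  note e = elts_carrier_mkforcing[OF assms(1)] elts_order_mkforcing[OF assms(1)]
  show "elts (carrier (mkforcing P lq)) \<noteq> {}" unfolding e by (rule assms(2))
  show "elts (order_rel (mkforcing P lq)) \<subseteq> {kpair q p |q p.
      q \<in> elts (carrier (mkforcing P lq)) \<and> p \<in> elts (carrier (mkforcing P lq))}"
    unfolding e by blast
  show "\<forall>p\<in>elts (carrier (mkforcing P lq)). kpair p p \<in> elts (order_rel (mkforcing P lq))"
    unfolding e using assms(3) by blast
  show "\<forall>p\<in>elts (carrier (mkforcing P lq)). \<forall>q\<in>elts (carrier (mkforcing P lq)).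
      \<forall>r\<in>elts (carrier (mkforcing P lq)). kpair r q \<in> elts (order_rel (mkforcing P lq)) \<longrightarrow>
        kpair q p \<in> elts (order_rel (mkforcing P lq)) \<longrightarrow> kpair r p \<in> elts (order_rel (mkforcing P lq))"
    unfolding e
  proof (intro ballI impI)
    fix p q r assume P: "p \<in> P" "q \<in> P" "r \<in> P" and R:
      "kpair r q \<in> {kpair q p |q p. q \<in> P \<and> p \<in> P \<and> lq q p}"
      "kpair q p \<in> {kpair q p |q p. q \<in> P \<and> p \<in> P \<and> lq q p}"
    from R have "lq r q" "lq q p" by auto
    then have "lq r p" using P assms(4) by metis
    then show "kpair r p \<in> {kpair q p |q p. q \<in> P \<and> p \<in> P \<and> lq q p}" using P by auto
  qed
qed

text \<open>\<open>\<langle>C, R\<rangle>\<close> projects to \<open>\<langle>C1, R1\<rangle>\<close> by dropping second coordinates. The last two clauses say that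
  second coordinates carry no information about the generic filter.\<close>

definition fst_proj :: "'v::zfc \<Rightarrow> 'v \<Rightarrow> 'v \<Rightarrow> 'v \<Rightarrow> bool" where
  "fst_proj C R C1 R1 \<longleftrightarrow>
     (\<forall>z\<in>elts C. \<exists>q w. z = kpair q w) \<and>
     (\<forall>q. q \<in> elts C1 \<longleftrightarrow> (\<exists>w. kpair q w \<in> elts C)) \<and>
     (\<forall>z. z \<in> elts R1 \<longleftrightarrow> (\<exists>q p v w. z = kpair q p \<and> kpair (kpair q v) (kpair p w) \<in> elts R)) \<and>
     (\<forall>q v s w. kpair q v \<in> elts C \<longrightarrow> kpair s w \<in> elts C \<longrightarrow> kpair q s \<in> elts R1 \<longrightarrow>
        (\<exists>u. kpair q u \<in> elts C \<and> kpair (kpair q u) (kpair q v) \<in> elts R \<and>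
           kpair (kpair q u) (kpair s w) \<in> elts R)) \<and>
     (\<forall>q p w. kpair q p \<in> elts R1 \<longrightarrow> kpair q w \<in> elts C \<longrightarrow>
        (\<exists>v. kpair p v \<in> elts C \<and> kpair (kpair q w) (kpair p v) \<in> elts R))"

lemma fst_projD:
  assumes "fst_proj C R C1 R1"
  shows "z \<in> elts C \<Longrightarrow> \<exists>q w. z = kpair q w"
    and "q \<in> elts C1 \<longleftrightarrow> (\<exists>w. kpair q w \<in> elts C)"
    and "z \<in> elts R1 \<longleftrightarrow> (\<exists>q p v w. z = kpair q p \<and> kpair (kpair q v) (kpair p w) \<in> elts R)"
    and "kpair q v \<in> elts C \<Longrightarrow> kpair s w \<in> elts C \<Longrightarrow> kpair q s \<in> elts R1 \<Longrightarrow>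
      \<exists>u. kpair q u \<in> elts C \<and> kpair (kpair q u) (kpair q v) \<in> elts R \<and> kpair (kpair q u) (kpair s w) \<in> elts R"
    and "kpair q p \<in> elts R1 \<Longrightarrow> kpair q w \<in> elts C \<Longrightarrow>
      \<exists>v. kpair p v \<in> elts C \<and> kpair (kpair q w) (kpair p v) \<in> elts R"
proof -
  note p = assms[unfolded fst_proj_def]
  note p2 = p[THEN conjunct2] note p3 = p2[THEN conjunct2] note p4 = p3[THEN conjunct2]
  show "z \<in> elts C \<Longrightarrow> \<exists>q w. z = kpair q w" using p[THEN conjunct1] by (rule bspec)
  show "q \<in> elts C1 \<longleftrightarrow> (\<exists>w. kpair q w \<in> elts C)" using p2[THEN conjunct1, THEN spec] .
  show "z \<in> elts R1 \<longleftrightarrow> (\<exists>q p v w. z = kpair q p \<and> kpair (kpair q v) (kpair p w) \<in> elts R)"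
    using p3[THEN conjunct1, THEN spec] .
qed (use assms[unfolded fst_proj_def, THEN conjunct2, THEN conjunct2, THEN conjunct2] in blast)+

lemma fst_proj_unique: "fst_proj C R C1 R1 \<Longrightarrow> fst_proj C R C2 R2 \<Longrightarrow> C1 = C2 \<and> R1 = R2"
  by (intro conjI elts_eqI) (simp_all only: fst_projD(2,3))

definition srp_conds :: "'v::zfc \<Rightarrow> 'v set" where
  "srp_conds S = {vseq (succ d) Q | d Q. d \<in> elts omega1 \<and> cont_chain S (succ d) Q}"

definition index_bound :: "('v::zfc \<Rightarrow> 'v) \<Rightarrow> 'v \<Rightarrow> 'v \<Rightarrow> bool" where
  "index_bound T q l \<longleftrightarrow>
     (\<forall>a u i. kpair a u \<in> elts q \<longrightarrow> i \<in> elts omega1 \<longrightarrow> a \<in> elts (T i) \<longrightarrow> i \<in> elts l)"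

lemma P_SRP_eq: "P_SRP S = mkforcing (srp_conds S) (\<lambda>q p. elts p \<subseteq> elts q)"
  unfolding P_SRP_def srp_conds_def ..

lemma cont_chain_mem: "cont_chain S l Q \<Longrightarrow> i \<in> elts l \<Longrightarrow> Q i \<in> elts S"
  unfolding cont_chain_def by (elim conjE bspec)

lemma small_srp_conds: "small (srp_conds (S::'v::zfc))"
proof -
  define K where "K = {kpair i x | i x. i \<in> elts (omega1::'v) \<and> x \<in> elts S}"
  have K: "small K" unfolding K_def by (intro small_Times_image small_elts)
  have "elts (vseq (succ d) Q) \<subseteq> elts (mkset K)" if "d \<in> elts omega1" "cont_chain S (succ d) Q" for d Q
  proof -
    have "i \<in> elts omega1" if "i \<in> elts (succ d)" for i
      using that \<open>d \<in> elts omega1\<close> Ord_trans[OF omega1_props(1)] by auto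
    moreover have "Q i \<in> elts S" if "i \<in> elts (succ d)" for i
      using cont_chain_mem[OF \<open>cont_chain S (succ d) Q\<close> that] .
    ultimately show ?thesis unfolding elts_vseq elts_mkset[OF K] unfolding K_def by blast
  qed
  then have "srp_conds S \<subseteq> {z. elts z \<subseteq> elts (mkset K)}" unfolding srp_conds_def by blast
  then show ?thesis by (rule small_subset[OF small_Pow])
qed

lemma cont_chain_subset:
  "cont_chain A l Q \<Longrightarrow> (\<And>i. i \<in> elts l \<Longrightarrow> Q i \<in> elts B) \<Longrightarrow> cont_chain B l Q"
  unfolding cont_chain_def by simp

lemma Ord_max:
  assumes "l \<in> elts (omega1::'v::zfc)" "m \<in> elts omega1"
  shows "\<exists>n\<in>elts omega1. elts l \<subseteq> elts n \<and> elts m \<subseteq> elts n"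
proof -
  have O: "Ord l" "Ord m" using assms omega1_props(1) Ord_elts by metis+
  show ?thesis
  proof (cases "l \<in> elts m")
    case True then show ?thesis using Ord_subset_iff[OF O] assms(2) by (intro bexI[of _ m]) auto
  next
    case False then show ?thesis using Ord_linear_le[OF O] assms(1) by (intro bexI[of _ l]) auto
  qed
qed

locale dsrp_setup =
  fixes \<kappa> S :: "'v::zfc" and T :: "'v \<Rightarrow> 'v"
  assumes S_sub: "elts S \<subseteq> elts (subsets_le (Hset \<kappa>) omega)"
    and T_disj: "\<And>i j. i \<in> elts omega1 \<Longrightarrow> j \<in> elts omega1 \<Longrightarrow> i \<noteq> j \<Longrightarrow> elts (T i) \<inter> elts (T j) = {}"
    and T_cover: "\<And>a. a \<in> elts omega1 \<Longrightarrow> \<exists>i\<in>elts omega1. a \<in> elts (T i)"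
begin

definition dsrp_conds :: "'v set" where
  "dsrp_conds = {kpair q (vseq l (\<lambda>_. S)) | q l. q \<in> srp_conds S \<and> l \<in> elts omega1 \<and> index_bound T q l}"

definition dsrp_le :: "'v \<Rightarrow> 'v \<Rightarrow> bool" where
  "dsrp_le q p \<longleftrightarrow> (\<exists>Qq Sq Qp Sp. q = kpair Qq Sq \<and> p = kpair Qp Sp \<and>
        elts Qp \<subseteq> elts Qq \<and> elts Sp \<subseteq> elts Sq)"

lemma index_bound_vseq:
  "index_bound T (vseq l Q) m \<longleftrightarrow> (\<forall>a\<in>elts l. \<forall>i\<in>elts omega1. a \<in> elts (T i) \<longrightarrow> i \<in> elts m)"
  unfolding index_bound_def by auto

lemma vseq_cong: "(\<And>i. i \<in> elts l \<Longrightarrow> f i = g i) \<Longrightarrow> vseq l f = vseq l g"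
  by (rule zfc_extensionality) (auto simp: image_iff)

text \<open>Because the sets \<open>T i\<close> cover \<open>omega1\<close>, the third clause in the definition of the diagonal poset makes
  every member of the chain an element of \<open>S\<close>; what remains of the second coordinate is its length.\<close>

lemma dsrp_conds_eq:
  "{kpair (vseq (succ d) Q) (vseq l S') | d l Q S'.
        d \<in> elts omega1 \<and> l \<in> elts omega1 \<and>
        cont_chain (subsets_le (Hset \<kappa>) omega) (succ d) Q \<and>
        (\<forall>i\<in>elts l. S' i \<in> elts (upair S S)) \<and>
        (\<forall>a\<in>elts (succ d). \<forall>i\<in>elts omega1.
           a \<in> elts (T i) \<longrightarrow> i \<in> elts l \<and> Q a \<in> elts (S' i))} = dsrp_conds"
  (is "?A = _")
  proof (rule subset_antisym)
    show "?A \<subseteq> dsrp_conds"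
    proof
      fix z assume "z \<in> ?A"
      then obtain d l Q S' where z: "z = kpair (vseq (succ d) Q) (vseq l S')"
        and d: "d \<in> elts omega1" and l: "l \<in> elts omega1"
        and Q: "cont_chain (subsets_le (Hset \<kappa>) omega) (succ d) Q"
        and S': "\<forall>i\<in>elts l. S' i \<in> elts (upair S S)"
        and T: "\<forall>a\<in>elts (succ d). \<forall>i\<in>elts omega1.
           a \<in> elts (T i) \<longrightarrow> i \<in> elts l \<and> Q a \<in> elts (S' i)" by blast
      have S'S: "S' i = S" if "i \<in> elts l" for i using S' that by simp
      have QS: "Q a \<in> elts S" if a: "a \<in> elts (succ d)" for a
      proof -
        have "a \<in> elts omega1" using a d Ord_trans[OF omega1_props(1)] by auto
        then obtain i where "i \<in> elts omega1" "a \<in> elts (T i)" using T_cover by blast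
        then show ?thesis using T a S'S by metis
      qed
      then have "cont_chain S (succ d) Q" by (rule cont_chain_subset[OF Q])
      moreover have "vseq l S' = vseq l (\<lambda>_. S)" using S'S by (rule vseq_cong)
      moreover have "index_bound T (vseq (succ d) Q) l" unfolding index_bound_vseq using T by simp
      ultimately show "z \<in> dsrp_conds" unfolding dsrp_conds_def srp_conds_def using z d l
        by (intro CollectI exI[of _ "vseq (succ d) Q"] exI[of _ l] exI[of _ d] exI[of _ Q] conjI) simp_all
    qed
  next
    show "dsrp_conds \<subseteq> ?A"
    proof
      fix z assume "z \<in> dsrp_conds"
      then obtain d Q l where z: "z = kpair (vseq (succ d) Q) (vseq l (\<lambda>_. S))"
        and d: "d \<in> elts omega1" and l: "l \<in> elts omega1" and Q: "cont_chain S (succ d) Q"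
        and b: "index_bound T (vseq (succ d) Q) l" unfolding dsrp_conds_def srp_conds_def by blast
      have QS: "Q a \<in> elts S" if a: "a \<in> elts (succ d)" for a
        using cont_chain_mem[OF Q a] .
      have "cont_chain (subsets_le (Hset \<kappa>) omega) (succ d) Q"
        by (rule cont_chain_subset[OF Q]) (rule subsetD[OF S_sub QS])
      moreover have "\<forall>a\<in>elts (succ d). \<forall>i\<in>elts omega1.
           a \<in> elts (T i) \<longrightarrow> i \<in> elts l \<and> Q a \<in> elts S"
        using b QS unfolding index_bound_vseq by simp
      ultimately show "z \<in> ?A" using z d l
        by (intro CollectI exI[of _ d] exI[of _ l] exI[of _ Q] exI[of _ "\<lambda>_. S"]) simp
    qed
  qed

abbreviation "QQ \<equiv> P_SRP S"
abbreviation "PP \<equiv> P_DSRP \<kappa> (upair S S) T"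

lemma PP_eq: "PP = mkforcing dsrp_conds dsrp_le"
  unfolding P_DSRP_def dsrp_conds_eq dsrp_le_def[abs_def] ..

lemma small_dsrp_conds: "small dsrp_conds"
  by (rule small_subset[OF small_Times_image[OF small_srp_conds[of S] small_elts[of omega1],
      of "\<lambda>q l. kpair q (vseq l (\<lambda>_. S))"]]) (auto simp: dsrp_conds_def)

text \<open>A countable ordinal meets only countably many of the disjoint sets \<open>T i\<close>.\<close>

lemma exists_index_bound:
  assumes "q \<in> srp_conds S" shows "\<exists>l\<in>elts omega1. index_bound T q l"
proof -
  obtain d Q where q: "q = vseq (succ d) Q" "d \<in> elts omega1" using assms unfolding srp_conds_def by auto
  define A where "A = {i \<in> elts omega1. \<exists>a\<in>elts (succ d). a \<in> elts (T i)}"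
  have "A \<subseteq> (\<lambda>a. THE i. i \<in> elts omega1 \<and> a \<in> elts (T i)) ` elts (succ d)"
  proof
    fix i assume "i \<in> A"
    then obtain a where a: "i \<in> elts omega1" "a \<in> elts (succ d)" "a \<in> elts (T i)" unfolding A_def by auto
    have "(THE i. i \<in> elts omega1 \<and> a \<in> elts (T i)) = i"
      by (rule the_equality) (use a T_disj in auto)
    then show "i \<in> (\<lambda>a. THE i. i \<in> elts omega1 \<and> a \<in> elts (T i)) ` elts (succ d)" using a(2) by blast
  qed
  moreover have "countable (elts (succ d))" using omega1_props(3)[OF q(2)] by simp
  ultimately have "countable A" by (rule countable_subset[OF _ countable_image])
  moreover have "A \<subseteq> elts omega1" unfolding A_def by simp
  ultimately obtain l where l: "l \<in> elts omega1" "A \<subseteq> elts l" using omega1_bounded[of A] by auto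
  have "index_bound T q l" unfolding q(1) index_bound_vseq using l(2) unfolding A_def by auto
  then show ?thesis using l(1) by auto
qed

lemma kpair_dsrp_conds:
  "kpair q w \<in> dsrp_conds \<longleftrightarrow>
     (\<exists>l. w = vseq l (\<lambda>_. S) \<and> q \<in> srp_conds S \<and> l \<in> elts omega1 \<and> index_bound T q l)"
  unfolding dsrp_conds_def by auto

lemma dsrp_le_kpair [simp]:
  "dsrp_le (kpair q v) (kpair p w) \<longleftrightarrow> elts p \<subseteq> elts q \<and> elts w \<subseteq> elts v"
  unfolding dsrp_le_def by auto

lemma index_bound_mono:
  "index_bound T q l \<Longrightarrow> elts q' \<subseteq> elts q \<Longrightarrow> elts l \<subseteq> elts l' \<Longrightarrow> index_bound T q' l'"
  unfolding index_bound_def by (meson subsetD)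

lemma vseq_mono: "elts l \<subseteq> elts l' \<Longrightarrow> elts (vseq l f) \<subseteq> elts (vseq l' f)"
  by auto

text \<open>Second coordinates can be lengthened freely. This is why they carry no information.\<close>

lemma common_extension:
  assumes "q \<in> srp_conds S" "l \<in> elts omega1" "m \<in> elts omega1" "index_bound T q l"
  shows "\<exists>u. kpair q u \<in> dsrp_conds \<and> elts (vseq l (\<lambda>_. S)) \<subseteq> elts u \<and> elts (vseq m (\<lambda>_. S)) \<subseteq> elts u"
proof -
  obtain n where n: "n \<in> elts omega1" "elts l \<subseteq> elts n" "elts m \<subseteq> elts n"
    using Ord_max[OF assms(2,3)] by auto
  then show ?thesis
    using index_bound_mono[OF assms(4) subset_refl n(2)] assms(1) vseq_mono[OF n(2)] vseq_mono[OF n(3)]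
    unfolding kpair_dsrp_conds by (intro exI[of _ "vseq n (\<lambda>_. S)"] conjI exI[of _ n] refl)
qed

lemma fst_proj: "fst_proj (carrier PP) (order_rel PP) (carrier QQ) (order_rel QQ)"
  unfolding fst_proj_def PP_eq P_SRP_eq
    elts_carrier_mkforcing[OF small_dsrp_conds] elts_carrier_mkforcing[OF small_srp_conds]
    elts_order_mkforcing[OF small_dsrp_conds] elts_order_mkforcing[OF small_srp_conds]
proof (intro conjI allI impI ballI)
  show "\<exists>q w. z = kpair q w" if "z \<in> dsrp_conds" for z using that unfolding dsrp_conds_def by auto
  show "q \<in> srp_conds S \<longleftrightarrow> (\<exists>w. kpair q w \<in> dsrp_conds)" for q
    unfolding kpair_dsrp_conds using exists_index_bound by metis
  show "z \<in> {kpair q p |q p. q \<in> srp_conds S \<and> p \<in> srp_conds S \<and> elts p \<subseteq> elts q} \<longleftrightarrow>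
        (\<exists>q p v w. z = kpair q p \<and> kpair (kpair q v) (kpair p w)
           \<in> {kpair q p |q p. q \<in> dsrp_conds \<and> p \<in> dsrp_conds \<and> dsrp_le q p})" (is "?l \<longleftrightarrow> ?r") for z
  proof
    assume ?l
    then obtain q p where z: "z = kpair q p" "q \<in> srp_conds S" "p \<in> srp_conds S" "elts p \<subseteq> elts q" by auto
    obtain l where l: "l \<in> elts omega1" "index_bound T q l" using exists_index_bound[OF z(2)] by auto
    then have "index_bound T p l" using index_bound_mono z(4) by blast
    then show ?r using z l
      by (intro exI[of _ q] exI[of _ p] exI[of _ "vseq l (\<lambda>_. S)"]) (auto simp: kpair_dsrp_conds)
  next
    assume ?r
    then show ?l by (auto simp: kpair_dsrp_conds)
  qed
next
  fix q v s w assume a: "kpair q v \<in> dsrp_conds" "kpair s w \<in> dsrp_conds"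
    "kpair q s \<in> {kpair q p |q p. q \<in> srp_conds S \<and> p \<in> srp_conds S \<and> elts p \<subseteq> elts q}"
  then obtain l m where l: "v = vseq l (\<lambda>_. S)" "q \<in> srp_conds S" "l \<in> elts omega1" "index_bound T q l"
    and m: "w = vseq m (\<lambda>_. S)" "m \<in> elts omega1" and "elts s \<subseteq> elts q" unfolding kpair_dsrp_conds by auto
  then show "\<exists>u. kpair q u \<in> dsrp_conds \<and> kpair (kpair q u) (kpair q v) \<in> {kpair q p |q p. q \<in> dsrp_conds \<and> p \<in> dsrp_conds \<and> dsrp_le q p} \<and>
           kpair (kpair q u) (kpair s w) \<in> {kpair q p |q p. q \<in> dsrp_conds \<and> p \<in> dsrp_conds \<and> dsrp_le q p}"
    using common_extension[OF l(2,3) m(2) l(4)] a(1,2) by auto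
next
  fix q p w assume a: "kpair q p \<in> {kpair q p |q p. q \<in> srp_conds S \<and> p \<in> srp_conds S \<and> elts p \<subseteq> elts q}"
    "kpair q w \<in> dsrp_conds"
  then have "kpair p w \<in> dsrp_conds" using index_bound_mono unfolding kpair_dsrp_conds by auto
  then show "\<exists>v. kpair p v \<in> dsrp_conds \<and> kpair (kpair q w) (kpair p v) \<in> {kpair q p |q p. q \<in> dsrp_conds \<and> p \<in> dsrp_conds \<and> dsrp_le q p}"
    using a by auto
qed

lemma forcing_notion_PP:
  assumes "forcing_notion QQ" shows "forcing_notion PP"
proof -
  obtain q where "q \<in> srp_conds S"
    using assms elts_carrier_mkforcing[OF small_srp_conds[of S]]
    unfolding forcing_notion_def P_SRP_eq by (metis carrier_kpair ex_in_conv)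
  then obtain w where "kpair q w \<in> dsrp_conds" using exists_index_bound kpair_dsrp_conds by metis
  then show ?thesis unfolding PP_eq
  proof (intro forcing_notion_mkforcing small_dsrp_conds)
    show "dsrp_le p p" if "p \<in> dsrp_conds" for p using that unfolding dsrp_conds_def by auto
    show "dsrp_le r p" if "dsrp_le r q" "dsrp_le q p" for p q r
    proof -
      from that(1) obtain a b c d where 1: "r = kpair a b" "q = kpair c d" "elts c \<subseteq> elts a" "elts d \<subseteq> elts b"
        unfolding dsrp_le_def by blast
      from that(2) obtain e f where 2: "p = kpair e f" "elts e \<subseteq> elts c" "elts f \<subseteq> elts d"
        unfolding 1(2) dsrp_le_def by auto
      show ?thesis using order_trans[OF 2(2) 1(3)] order_trans[OF 2(3) 1(4)] unfolding 1(1) 2(1) by simp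
    qed
  qed blast
qed

end

section \<open>Relating statements\<close>

text \<open>Statements of the same shape whose parameters are related by \<open>E\<close> and whose quantifiers range
  over pairs related by \<open>U\<close>. With forced equality for \<open>E\<close> this gives congruence of forcing; with the
  graph of a translation of names it transfers forcing from one poset to another.\<close>

inductive stmt_rel :: "('v \<Rightarrow> 'v \<Rightarrow> bool) \<Rightarrow> ('v \<Rightarrow> 'v \<Rightarrow> bool) \<Rightarrow> 'v stmt \<Rightarrow> 'v stmt \<Rightarrow> bool"
  for U E where
  Mem: "E a a' \<Longrightarrow> E b b' \<Longrightarrow> stmt_rel U E (Mem a b) (Mem a' b')"
| Eq: "E a a' \<Longrightarrow> E b b' \<Longrightarrow> stmt_rel U E (Eq a b) (Eq a' b')"
| Neg: "stmt_rel U E \<phi> \<psi> \<Longrightarrow> stmt_rel U E (Neg \<phi>) (Neg \<psi>)"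
| Conj: "stmt_rel U E \<phi> \<psi> \<Longrightarrow> stmt_rel U E \<phi>' \<psi>' \<Longrightarrow> stmt_rel U E (Conj \<phi> \<phi>') (Conj \<psi> \<psi>')"
| Forall: "(\<And>x y. U x y \<Longrightarrow> stmt_rel U E (F x) (G y)) \<Longrightarrow> stmt_rel U E (Forall F) (Forall G)"
| AllFm: "(\<And>\<phi>. stmt_rel U E (F \<phi>) (G \<phi>)) \<Longrightarrow> stmt_rel U E (AllFm F) (AllFm G)"

context
  fixes U E :: "'v \<Rightarrow> 'v \<Rightarrow> bool"
  assumes UE: "\<And>x y. U x y \<Longrightarrow> E x y"
begin

lemma stmt_rel_Imp: "stmt_rel U E \<phi> \<psi> \<Longrightarrow> stmt_rel U E \<phi>' \<psi>' \<Longrightarrow> stmt_rel U E (Imp \<phi> \<phi>') (Imp \<psi> \<psi>')"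
  unfolding Imp_def by (intro stmt_rel.intros)

lemma stmt_rel_Disj: "stmt_rel U E \<phi> \<psi> \<Longrightarrow> stmt_rel U E \<phi>' \<psi>' \<Longrightarrow> stmt_rel U E (Disj \<phi> \<phi>') (Disj \<psi> \<psi>')"
  unfolding Disj_def by (intro stmt_rel.intros)

lemma stmt_rel_Iff: "stmt_rel U E \<phi> \<psi> \<Longrightarrow> stmt_rel U E \<phi>' \<psi>' \<Longrightarrow> stmt_rel U E (Iff \<phi> \<phi>') (Iff \<psi> \<psi>')"
  unfolding Iff_def by (intro stmt_rel.intros stmt_rel_Imp)

lemma stmt_rel_Exists: "(\<And>x y. U x y \<Longrightarrow> stmt_rel U E (F x) (G y)) \<Longrightarrow> stmt_rel U E (Exists F) (Exists G)"
  unfolding Exists_def by (intro stmt_rel.intros)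

lemma stmt_rel_AllIn:
  assumes "E a b" "\<And>x y. U x y \<Longrightarrow> stmt_rel U E (F x) (G y)" shows "stmt_rel U E (AllIn a F) (AllIn b G)"
  unfolding AllIn_def using assms UE by (intro stmt_rel.Forall stmt_rel_Imp stmt_rel.Mem)

lemma stmt_rel_ExIn:
  assumes "E a b" "\<And>x y. U x y \<Longrightarrow> stmt_rel U E (F x) (G y)" shows "stmt_rel U E (ExIn a F) (ExIn b G)"
  unfolding ExIn_def using assms UE by (intro stmt_rel_Exists stmt_rel.Conj stmt_rel.Mem)

lemmas stmt_rel_derived = stmt_rel.Mem stmt_rel.Eq stmt_rel.Neg stmt_rel.Conj stmt_rel.AllFm
  stmt_rel_Imp stmt_rel_Disj stmt_rel_Iff stmt_rel_Exists stmt_rel_AllIn stmt_rel_ExIn stmt_rel.Forall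

lemma stmt_rel_maps:
  assumes "E s s'" "E x x'" "E y y'" shows "stmt_rel U E (maps_stmt s x y) (maps_stmt s' x' y')"
  unfolding maps_stmt_def pair_stmt_def upair_stmt_def
  by (intro stmt_rel_derived assms; erule UE)

lemma stmt_rel_stationary:
  assumes "E a a'" "E t t'" shows "stmt_rel U E (stationary_stmt a t) (stationary_stmt a' t')"
  unfolding stationary_stmt_def club_stmt_def
  by (intro stmt_rel_derived assms; erule UE)

lemma stmt_rel_sat:
  assumes "E M M'" "E A A'"
  shows "\<forall>i<arity \<phi>. E (d i) (d' i) \<Longrightarrow> stmt_rel U E (sat_stmt M A \<phi> d) (sat_stmt M' A' \<phi> d')"
proof (induction \<phi> arbitrary: d d')
  case (FAll \<phi>)
  have "stmt_rel U E (sat_stmt M A \<phi> (case_nat x d)) (sat_stmt M' A' \<phi> (case_nat y d'))" if "U x y" for x y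
    by (rule FAll.IH) (use FAll.prems UE[OF that] in \<open>auto split: nat.split\<close>)
  then show ?case unfolding sat_stmt.simps by (intro stmt_rel_AllIn assms(1))
qed (auto intro!: stmt_rel.intros assms(2))

lemma stmt_rel_preserves:
  assumes "E s s'" "E M M'" "E A A'" "E N N'" "E B B'"
  shows "\<forall>i. i + n < arity \<phi> \<longrightarrow> E (d i) (d' i) \<and> E (e i) (e' i) \<Longrightarrow> 
    stmt_rel U E (preserves_stmt s M A N B \<phi> n d e) (preserves_stmt s' M' A' N' B' \<phi> n d' e')"
proof (induction n arbitrary: d d' e e')
  case 0
  then show ?case unfolding preserves_stmt.simps by (intro stmt_rel_Iff stmt_rel_sat assms) auto
next
  case (Suc n)
  show ?case unfolding preserves_stmt.simps
  proof (intro stmt_rel_AllIn stmt_rel_Imp stmt_rel_maps assms Suc.IH)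
    fix x x' y y' assume "U x x'" "U y y'"
    then show "\<forall>i. i + n < arity \<phi> \<longrightarrow> E (case_nat x d i) (case_nat x' d' i) \<and>
            E (case_nat y e i) (case_nat y' e' i)"
      using Suc.prems UE by (auto split: nat.split)
  qed (erule UE)+
qed

lemma stmt_rel_elem_emb:
  assumes "E s s'" "E M M'" "E A A'" "E N N'" "E B B'"
  shows "stmt_rel U E (elem_emb_stmt s M A N B) (elem_emb_stmt s' M' A' N' B')"
proof -
  have "stmt_rel U E (function_stmt s M N) (function_stmt s' M' N')"
    unfolding function_stmt_def maps_stmt_def pair_stmt_def upair_stmt_def
    by (intro stmt_rel_derived assms; erule UE)
  then show ?thesis unfolding elem_emb_stmt_def
    by (intro stmt_rel.Conj stmt_rel.AllFm stmt_rel_preserves assms) auto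
qed

end

section \<open>The forcing relation\<close>

lemma elts_check: "elts (check PP x) = {kpair (check PP y) p | y p. y \<in> elts x \<and> p \<in> elts (carrier PP)}"
  by (subst check.simps, subst elts_mkset) (intro small_UN small_image small_elts, auto)

lemma elts_generic_name: "elts (generic_name PP) = (\<lambda>p. kpair (check PP p) p) ` elts (carrier PP)"
  unfolding generic_name_def by (intro elts_mkset small_image small_elts)

lemma pairs_check: "pairs (check PP x) = {(check PP y, p) | y p. y \<in> elts x \<and> p \<in> elts (carrier PP)}"
  unfolding pairs_def elts_check by auto

lemma is_name_check: "is_name PP (check PP x)"
proof (induction x rule: mem_induct)
  case (step x)
  show ?case
  proof (rule is_name.intros)
    fix z assume "z \<in> elts (check PP x)"
    then obtain y p where "z = kpair (check PP y) p" "y \<in> elts x" "p \<in> elts (carrier PP)"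
      unfolding elts_check by auto
    then show "\<exists>y p. z = kpair y p \<and> p \<in> elts (carrier PP) \<and> is_name PP y" using step by metis
  qed
qed

lemma pairs_rank: "(c, s) \<in> pairs a \<Longrightarrow> (c, a) \<in> {(x, y). x \<in> elts y}\<^sup>+"
proof -
  assume "(c, s) \<in> pairs a"
  then have "kpair c s \<in> elts a" unfolding pairs_def by simp
  moreover have "c \<in> elts (upair c c)" "upair c c \<in> elts (kpair c s)" by (auto simp: elts_kpair)
  ultimately show ?thesis
    by (meson CollectI case_prodI r_into_trancl trancl_into_trancl)
qed

lemma wf_trancl_mem: "wf ({(x, y). x \<in> elts (y::'v::zfc)}\<^sup>+)"
  by (rule wf_trancl[OF zfc_foundation])

lemma name_induct [case_names step]:
  assumes "\<And>a. (\<And>c s. (c, s) \<in> pairs a \<Longrightarrow> P c) \<Longrightarrow> P a" shows "P (a::'v::zfc)"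
proof (induction a rule: wf_induct[OF wf_trancl_mem])
  case (1 a)
  show ?case
    by (rule assms) (use 1 pairs_rank in metis)
qed

lemma is_name_pairs: "is_name PP a \<Longrightarrow> (c, s) \<in> pairs a \<Longrightarrow> is_name PP c \<and> s \<in> elts (carrier PP)"
proof (erule is_name.cases)
  fix x assume a: "(c, s) \<in> pairs a" "a = x"
    and *: "\<And>z. z \<in> elts x \<Longrightarrow> \<exists>y p. z = kpair y p \<and> p \<in> elts (carrier PP) \<and> is_name PP y"
  have "kpair c s \<in> elts x" using a unfolding pairs_def by simp
  from *[OF this] show "is_name PP c \<and> s \<in> elts (carrier PP)" by auto
qed

locale forcing =
  fixes PP :: "'v::zfc"
  assumes forcing_notion: "forcing_notion PP"
begin

lemma order_rel_subset:
  "elts (order_rel PP) \<subseteq> {kpair q p | q p. q \<in> elts (carrier PP) \<and> p \<in> elts (carrier PP)}"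
  and le_refl: "p \<in> elts (carrier PP) \<Longrightarrow> le PP p p"
  and le_trans': "p \<in> elts (carrier PP) \<Longrightarrow> q \<in> elts (carrier PP) \<Longrightarrow> r \<in> elts (carrier PP) \<Longrightarrow>
    le PP r q \<Longrightarrow> le PP q p \<Longrightarrow> le PP r p"
proof -
  obtain P R where PR: "PP = kpair P R" and *: "elts R \<subseteq> {kpair q p | q p. q \<in> elts P \<and> p \<in> elts P}"
        "\<forall>p\<in>elts P. kpair p p \<in> elts R"
        "\<forall>p\<in>elts P. \<forall>q\<in>elts P. \<forall>r\<in>elts P.
           kpair r q \<in> elts R \<longrightarrow> kpair q p \<in> elts R \<longrightarrow> kpair r p \<in> elts R"
    using forcing_notion unfolding forcing_notion_def by (elim exE conjE)
  show "elts (order_rel PP) \<subseteq> {kpair q p | q p. q \<in> elts (carrier PP) \<and> p \<in> elts (carrier PP)}"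
    using *(1) unfolding PR carrier_kpair order_rel_kpair .
  show "p \<in> elts (carrier PP) \<Longrightarrow> le PP p p"
    using *(2) unfolding PR carrier_kpair order_rel_kpair le_def by (rule bspec)
  show "p \<in> elts (carrier PP) \<Longrightarrow> q \<in> elts (carrier PP) \<Longrightarrow> r \<in> elts (carrier PP) \<Longrightarrow>
    le PP r q \<Longrightarrow> le PP q p \<Longrightarrow> le PP r p"
    using *(3) unfolding PR carrier_kpair order_rel_kpair le_def by metis
qed

lemma le_carrier: assumes "le PP q p" shows "q \<in> elts (carrier PP)" "p \<in> elts (carrier PP)"
  using subsetD[OF order_rel_subset assms[unfolded le_def]] by auto

lemma le_trans: assumes "le PP r q" "le PP q p" shows "le PP r p"
  using le_trans'[OF le_carrier(2)[OF assms(2)] le_carrier(1)[OF assms(2)] le_carrier(1)[OF assms(1)] assms] .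

text \<open>With \<open>near\<close>, the statement that \<open>q\<close> does not exclude membership, forced membership becomes a density
  statement, and forced equality a pair of forced inclusions (\<open>forces_eq_iff\<close>), one the mirror image of
  the other.\<close>

definition near :: "'v \<Rightarrow> 'v \<Rightarrow> 'v \<Rightarrow> bool" where
  "near a b q \<longleftrightarrow> (\<exists>d t r. (d, t) \<in> pairs b \<and> le PP r q \<and> le PP r t \<and> forces_eq PP a d r)"

definition covered :: "'v \<Rightarrow> 'v \<Rightarrow> 'v \<Rightarrow> bool" where
  "covered a b p \<longleftrightarrow> (\<forall>c s q. (c, s) \<in> pairs a \<longrightarrow> le PP q p \<longrightarrow> le PP q s \<longrightarrow> near c b q)"

lemma nearI: "(d, t) \<in> pairs b \<Longrightarrow> le PP r q \<Longrightarrow> le PP r t \<Longrightarrow> forces_eq PP a d r \<Longrightarrow> near a b q"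
  unfolding near_def by blast

lemma nearE:
  assumes "near a b q"
  obtains d t r where "(d, t) \<in> pairs b" "le PP r q" "le PP r t" "forces_eq PP a d r"
  using assms unfolding near_def by blast

lemma near_mono: "near a b r \<Longrightarrow> le PP r q \<Longrightarrow> near a b q"
  by (erule nearE) (rule nearI[OF _ le_trans])

lemma coveredI:
  "(\<And>c s q. (c, s) \<in> pairs a \<Longrightarrow> le PP q p \<Longrightarrow> le PP q s \<Longrightarrow> near c b q) \<Longrightarrow> covered a b p"
  unfolding covered_def by blast

lemma coveredD: "covered a b p \<Longrightarrow> (c, s) \<in> pairs a \<Longrightarrow> le PP q p \<Longrightarrow> le PP q s \<Longrightarrow> near c b q"
  unfolding covered_def by blast

lemma forces_eq_sym: "forces_eq PP a b p \<Longrightarrow> forces_eq PP b a p"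
  by (induction rule: forces_eq.induct) (rule forces_eq.intros; blast)

lemma forces_eq_iff: "forces_eq PP a b p \<longleftrightarrow> covered a b p \<and> covered b a p"
proof
  have c: "covered a b p" if "forces_eq PP a b p" for a b
    using that
  proof cases
    case 1
    show ?thesis
    proof (rule coveredI)
      fix c s q assume "(c, s) \<in> pairs a" "le PP q p" "le PP q s"
      with 1(1) obtain y r where "y \<in> pairs b" "le PP r q" "le PP r (snd y)" "forces_eq PP c (fst y) r"
        by fastforce
      then show "near c b q" by (intro nearI[of "fst y" "snd y"]) simp_all
    qed
  qed
  show "covered a b p \<and> covered b a p" if "forces_eq PP a b p" using c that forces_eq_sym by blast
next
  assume *: "covered a b p \<and> covered b a p"
  show "forces_eq PP a b p"
  proof (rule forces_eq.intros; intro ballI allI impI)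
    fix x q assume "x \<in> pairs a" "le PP q p \<and> le PP q (snd x)"
    then have "near (fst x) b q" using * coveredD[of a b p "fst x" "snd x"] by simp
    then show "\<exists>y\<in>pairs b. \<exists>r. le PP r q \<and> le PP r (snd y) \<and> forces_eq PP (fst x) (fst y) r"
      by (rule nearE) force
  next
    fix y q assume "y \<in> pairs b" "le PP q p \<and> le PP q (snd y)"
    then have "near (fst y) a q" using * coveredD[of b a p "fst y" "snd y"] by simp
    then show "\<exists>x\<in>pairs a. \<exists>r. le PP r q \<and> le PP r (snd x) \<and> forces_eq PP (fst x) (fst y) r"
      by (rule nearE) (use forces_eq_sym in force)
  qed
qed

lemma forces_eq_mono: "forces_eq PP a b p \<Longrightarrow> le PP q p \<Longrightarrow> forces_eq PP a b q"
  unfolding forces_eq_iff covered_def using le_trans by blast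

lemma forces_eq_dense:
  assumes "\<And>q. le PP q p \<Longrightarrow> \<exists>r. le PP r q \<and> forces_eq PP a b r"
  shows "forces_eq PP a b p"
proof -
  have "covered a b p" if *: "\<And>q. le PP q p \<Longrightarrow> \<exists>r. le PP r q \<and> covered a b r" for a b
  proof (rule coveredI)
    fix c s q assume c: "(c, s) \<in> pairs a" "le PP q p" "le PP q s"
    obtain r where r: "le PP r q" "covered a b r" using * c(2) by metis
    have "near c b r" by (rule coveredD[OF r(2) c(1) le_refl[OF le_carrier(1)[OF r(1)]] le_trans[OF r(1) c(3)]])
    then show "near c b q" using r(1) by (rule near_mono)
  qed
  then show ?thesis unfolding forces_eq_iff using assms unfolding forces_eq_iff by metis
qed

lemma forces_eq_refl: "forces_eq PP a a p"
proof (induction a arbitrary: p rule: name_induct)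
  case (step a)
  have "covered a a p" by (rule coveredI) (metis step nearI le_refl le_carrier(1))
  then show ?case unfolding forces_eq_iff by simp
qed

lemma forces_eq_trans: "forces_eq PP a b p \<Longrightarrow> forces_eq PP b c p \<Longrightarrow> forces_eq PP a c p"
proof (induction a arbitrary: b c p rule: name_induct)
  case (step a)
  have c: "covered a b p" "covered b a p" "covered b c p" "covered c b p"
    using step(2,3) unfolding forces_eq_iff by auto
  have "covered a c p"
  proof (rule coveredI)
    fix x s q assume x: "(x, s) \<in> pairs a" "le PP q p" "le PP q s"
    from coveredD[OF c(1) x] obtain y t r where
      y: "(y, t) \<in> pairs b" "le PP r q" "le PP r t" "forces_eq PP x y r" by (rule nearE)
    from coveredD[OF c(3) y(1) le_trans[OF y(2) x(2)] y(3)] obtain z u r' where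
      z: "(z, u) \<in> pairs c" "le PP r' r" "le PP r' u" "forces_eq PP y z r'" by (rule nearE)
    show "near x c q"
      by (rule nearI[OF z(1) le_trans[OF z(2) y(2)] z(3) step(1)[OF x(1) forces_eq_mono[OF y(4) z(2)] z(4)]])
  qed
  moreover have "covered c a p"
  proof (rule coveredI)
    fix z u q assume z: "(z, u) \<in> pairs c" "le PP q p" "le PP q u"
    from coveredD[OF c(4) z] obtain y t r where
      y: "(y, t) \<in> pairs b" "le PP r q" "le PP r t" "forces_eq PP z y r" by (rule nearE)
    from coveredD[OF c(2) y(1) le_trans[OF y(2) z(2)] y(3)] obtain x s r' where
      x: "(x, s) \<in> pairs a" "le PP r' r" "le PP r' s" "forces_eq PP y x r'" by (rule nearE)
    have "forces_eq PP x z r'"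
      by (rule step(1)[OF x(1) forces_eq_sym[OF x(4)] forces_eq_sym[OF forces_eq_mono[OF y(4) x(2)]]])
    then show "near z a q" by (rule nearI[OF x(1) le_trans[OF x(2) y(2)] x(3) forces_eq_sym])
  qed
  ultimately show ?case unfolding forces_eq_iff by simp
qed

lemma forces_mem_iff: "forces_mem PP a b p \<longleftrightarrow> (\<forall>q. le PP q p \<longrightarrow> near a b q)"
proof -
  have "(\<exists>y\<in>pairs b. \<exists>r. le PP r q \<and> le PP r (snd y) \<and> forces_eq PP a (fst y) r) \<longleftrightarrow> near a b q" for q
    unfolding near_def by force
  then show ?thesis unfolding forces_mem_def by simp
qed

lemma forces_mem_mono: "forces_mem PP a b p \<Longrightarrow> le PP q p \<Longrightarrow> forces_mem PP a b q"
  unfolding forces_mem_def using le_trans by metis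

lemma forces_mem_dense:
  assumes "\<And>q. le PP q p \<Longrightarrow> \<exists>r. le PP r q \<and> forces_mem PP a b r"
  shows "forces_mem PP a b p"
  using assms near_mono le_refl le_carrier(1) unfolding forces_mem_iff by metis

lemma forces_mem_cong:
  assumes "forces_eq PP a a' p" "forces_eq PP b b' p" "forces_mem PP a b p"
  shows "forces_mem PP a' b' p"
  unfolding forces_mem_iff
proof (intro allI impI)
  fix q assume q: "le PP q p"
  have "near a b q" using assms(3) q unfolding forces_mem_iff by simp
  then obtain d t r where d: "(d, t) \<in> pairs b" "le PP r q" "le PP r t" "forces_eq PP a d r" by (rule nearE)
  have rp: "le PP r p" using le_trans[OF d(2) q] .
  have "covered b b' p" using assms(2) unfolding forces_eq_iff by simp
  from coveredD[OF this d(1) rp d(3)] obtain d' t' r' where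
    d': "(d', t') \<in> pairs b'" "le PP r' r" "le PP r' t'" "forces_eq PP d d' r'" by (rule nearE)
  have "forces_eq PP a' a r'" using forces_eq_mono[OF forces_eq_sym[OF assms(1)] le_trans[OF d'(2) rp]] .
  then have "forces_eq PP a' d' r'"
    using forces_eq_trans forces_eq_mono[OF d(4) d'(2)] d'(4) by metis
  then show "near a' b' q" by (rule nearI[OF d'(1) le_trans[OF d'(2) d(2)] d'(3)])
qed

lemma forces_mono: "p \<tturnstile>\<^bsub>PP\<^esub> \<phi> \<Longrightarrow> le PP q p \<Longrightarrow> q \<tturnstile>\<^bsub>PP\<^esub> \<phi>"
proof (induction \<phi> arbitrary: p q)
  case (Neg \<phi>)
  then show ?case using le_trans unfolding forces_stmt.simps by blast
next
  case (Conj \<phi> \<psi>)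
  then show ?case unfolding forces_stmt.simps by blast
next
  case (Forall F)
  then show ?case unfolding forces_stmt.simps by (metis rangeI)
next
  case (AllFm F)
  then show ?case unfolding forces_stmt.simps by (metis rangeI)
qed (simp_all add: forces_mem_mono forces_eq_mono)

lemma forces_dense: "(\<And>q. le PP q p \<Longrightarrow> \<exists>r. le PP r q \<and> r \<tturnstile>\<^bsub>PP\<^esub> \<phi>) \<Longrightarrow> p \<tturnstile>\<^bsub>PP\<^esub> \<phi>"
proof (induction \<phi> arbitrary: p)
  case (Neg \<phi>)
  show ?case unfolding forces_stmt.simps
  proof (intro allI impI notI)
    fix q assume q: "le PP q p" "q \<tturnstile>\<^bsub>PP\<^esub> \<phi>"
    then obtain r where r: "le PP r q" "r \<tturnstile>\<^bsub>PP\<^esub> Neg \<phi>" using Neg.prems by metis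
    then show False using forces_mono[OF q(2) r(1)] le_refl[OF le_carrier(1)[OF r(1)]] by simp
  qed
next
  case (Conj \<phi> \<psi>)
  have "\<exists>r. le PP r q \<and> r \<tturnstile>\<^bsub>PP\<^esub> \<phi> \<and> r \<tturnstile>\<^bsub>PP\<^esub> \<psi>" if "le PP q p" for q
    using Conj.prems[OF that] by simp
  then show ?case unfolding forces_stmt.simps
    using Conj.IH(1)[of p] Conj.IH(2)[of p] by metis
next
  case (Forall F)
  have *: "\<exists>r. le PP r q \<and> (\<forall>x. is_name PP x \<longrightarrow> r \<tturnstile>\<^bsub>PP\<^esub> F x)" if "le PP q p" for q
    using Forall.prems[OF that] by simp
  show ?case unfolding forces_stmt.simps
  proof (intro allI impI Forall.IH)
    fix x q assume "is_name PP x" "le PP q p"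
    then show "\<exists>r. le PP r q \<and> r \<tturnstile>\<^bsub>PP\<^esub> F x" using * by metis
  qed simp
next
  case (AllFm F)
  have *: "\<exists>r. le PP r q \<and> (\<forall>x. r \<tturnstile>\<^bsub>PP\<^esub> F x)" if "le PP q p" for q
    using AllFm.prems[OF that] by simp
  show ?case unfolding forces_stmt.simps
  proof (intro allI AllFm.IH)
    fix x q assume "le PP q p"
    then show "\<exists>r. le PP r q \<and> r \<tturnstile>\<^bsub>PP\<^esub> F x" using * by metis
  qed simp
qed (simp_all add: forces_mem_dense forces_eq_dense)

lemma forces_cong:
  "stmt_rel (\<lambda>x y. x = y \<and> is_name PP x) (\<lambda>a b. forces_eq PP a b p) \<phi> \<psi> \<Longrightarrow> le PP q p \<Longrightarrow>
    q \<tturnstile>\<^bsub>PP\<^esub> \<phi> \<longleftrightarrow> q \<tturnstile>\<^bsub>PP\<^esub> \<psi>"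
proof (induction arbitrary: q rule: stmt_rel.induct)
  case (Mem a a' b b')
  then have e: "forces_eq PP a a' q" "forces_eq PP b b' q" using forces_eq_mono by metis+
  show ?case unfolding forces_stmt.simps
    using forces_mem_cong[OF e] forces_mem_cong[OF forces_eq_sym[OF e(1)] forces_eq_sym[OF e(2)]]
    by (rule iffI)
next
  case (Eq a a' b b')
  then have e: "forces_eq PP a a' q" "forces_eq PP b b' q" using forces_eq_mono by metis+
  show ?case unfolding forces_stmt.simps
    using forces_eq_trans[OF forces_eq_trans[OF forces_eq_sym[OF e(1)]] e(2)]
      forces_eq_trans[OF forces_eq_trans[OF e(1)] forces_eq_sym[OF e(2)]]
    by (rule iffI)
next
  case (Neg \<phi> \<psi>)
  have "r \<tturnstile>\<^bsub>PP\<^esub> \<phi> \<longleftrightarrow> r \<tturnstile>\<^bsub>PP\<^esub> \<psi>" if "le PP r q" for r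
    using Neg.IH le_trans[OF that Neg.prems] by metis
  then show ?case unfolding forces_stmt.simps by metis
next
  case (Conj \<phi> \<psi> \<phi>' \<psi>')
  then show ?case unfolding forces_stmt.simps by metis
next
  case (Forall F G)
  have "q \<tturnstile>\<^bsub>PP\<^esub> F x \<longleftrightarrow> q \<tturnstile>\<^bsub>PP\<^esub> G x" if "is_name PP x" for x
    by (rule Forall.IH[OF _ Forall.prems]) (use that in simp)
  then show ?case unfolding forces_stmt.simps by metis
next
  case (AllFm F G)
  have "q \<tturnstile>\<^bsub>PP\<^esub> F \<phi> \<longleftrightarrow> q \<tturnstile>\<^bsub>PP\<^esub> G \<phi>" for \<phi>
    by (rule AllFm.IH[OF AllFm.prems])
  then show ?case unfolding forces_stmt.simps by metis
qed

lemma forces_Imp: "p \<tturnstile>\<^bsub>PP\<^esub> Imp \<phi> \<psi> \<longleftrightarrow> (\<forall>q. le PP q p \<longrightarrow> q \<tturnstile>\<^bsub>PP\<^esub> \<phi> \<longrightarrow> q \<tturnstile>\<^bsub>PP\<^esub> \<psi>)"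
proof
  assume *: "p \<tturnstile>\<^bsub>PP\<^esub> Imp \<phi> \<psi>"
  show "\<forall>q. le PP q p \<longrightarrow> q \<tturnstile>\<^bsub>PP\<^esub> \<phi> \<longrightarrow> q \<tturnstile>\<^bsub>PP\<^esub> \<psi>"
  proof (intro allI impI)
    fix q assume q: "le PP q p" "q \<tturnstile>\<^bsub>PP\<^esub> \<phi>"
    show "q \<tturnstile>\<^bsub>PP\<^esub> \<psi>"
    proof (rule forces_dense)
      fix r assume r: "le PP r q"
      have "le PP r p" "r \<tturnstile>\<^bsub>PP\<^esub> \<phi>" using le_trans r q forces_mono by metis+
      then show "\<exists>s. le PP s r \<and> s \<tturnstile>\<^bsub>PP\<^esub> \<psi>" using * unfolding Imp_def by auto
    qed
  qed
next
  assume *: "\<forall>q. le PP q p \<longrightarrow> q \<tturnstile>\<^bsub>PP\<^esub> \<phi> \<longrightarrow> q \<tturnstile>\<^bsub>PP\<^esub> \<psi>"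
  show "p \<tturnstile>\<^bsub>PP\<^esub> Imp \<phi> \<psi>"
    unfolding Imp_def using * le_refl le_carrier(1) by (simp, metis)
qed

lemma forces_Iff:
  assumes "p \<tturnstile>\<^bsub>PP\<^esub> Iff \<phi> \<psi>" "p \<in> elts (carrier PP)" shows "p \<tturnstile>\<^bsub>PP\<^esub> \<phi> \<longleftrightarrow> p \<tturnstile>\<^bsub>PP\<^esub> \<psi>"
  using assms le_refl unfolding Iff_def by (auto simp: forces_Imp)

lemma forces_Exists:
  "p \<tturnstile>\<^bsub>PP\<^esub> Exists F \<longleftrightarrow> (\<forall>q. le PP q p \<longrightarrow> (\<exists>r x. le PP r q \<and> is_name PP x \<and> r \<tturnstile>\<^bsub>PP\<^esub> F x))"
  unfolding Exists_def by (simp, metis)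

lemma forces_AllIn:
  "p \<tturnstile>\<^bsub>PP\<^esub> AllIn a F \<longleftrightarrow> (\<forall>x q. is_name PP x \<longrightarrow> le PP q p \<longrightarrow> forces_mem PP x a q \<longrightarrow> q \<tturnstile>\<^bsub>PP\<^esub> F x)"
  unfolding AllIn_def by (simp add: forces_Imp)

lemma forces_ExIn:
  "p \<tturnstile>\<^bsub>PP\<^esub> ExIn a F \<longleftrightarrow> (\<forall>q. le PP q p \<longrightarrow>
      (\<exists>r x. le PP r q \<and> is_name PP x \<and> forces_mem PP x a r \<and> r \<tturnstile>\<^bsub>PP\<^esub> F x))"
  unfolding ExIn_def by (simp add: forces_Exists)

subsection \<open>Canonical names\<close>

lemma near_check: "near a (check PP x) q \<longleftrightarrow> (\<exists>y\<in>elts x. \<exists>r. le PP r q \<and> forces_eq PP a (check PP y) r)"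
proof
  assume "near a (check PP x) q"
  then show "\<exists>y\<in>elts x. \<exists>r. le PP r q \<and> forces_eq PP a (check PP y) r"
    by (rule nearE) (auto simp: pairs_check)
next
  assume "\<exists>y\<in>elts x. \<exists>r. le PP r q \<and> forces_eq PP a (check PP y) r"
  then obtain y r where y: "y \<in> elts x" "le PP r q" "forces_eq PP a (check PP y) r" by blast
  have r: "r \<in> elts (carrier PP)" using le_carrier y(2) by metis
  then have "(check PP y, r) \<in> pairs (check PP x)" unfolding pairs_check using y(1) by blast
  then show "near a (check PP x) q" using y(2) le_refl[OF r] y(3) by (rule nearI)
qed

lemma forces_mem_checkD:
  "forces_mem PP a (check PP x) p \<Longrightarrow> le PP q p \<Longrightarrow> \<exists>y r. y \<in> elts x \<and> le PP r q \<and> forces_eq PP a (check PP y) r"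
  unfolding forces_mem_iff near_check by blast

lemma forces_mem_check: "y \<in> elts x \<Longrightarrow> forces_mem PP (check PP y) (check PP x) p"
  unfolding forces_mem_iff near_check using forces_eq_refl le_refl le_carrier(1) by blast

lemma forces_eq_check: "forces_eq PP (check PP x) (check PP y) p \<Longrightarrow> p \<in> elts (carrier PP) \<Longrightarrow> x = y"
proof (induction x arbitrary: y p rule: mem_induct)
  case (step x)
  have *: "near (check PP z) b p" if "z \<in> elts u" "covered (check PP u) b p" for z u b
  proof (rule coveredD[OF that(2)])
    show "(check PP z, p) \<in> pairs (check PP u)" unfolding pairs_check using step(3) that(1) by blast
  qed (rule le_refl[OF step(3)])+
  have c: "covered (check PP x) (check PP y) p" "covered (check PP y) (check PP x) p"
    using step(2) unfolding forces_eq_iff by auto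
  show ?case
  proof (intro elts_eqI iffI)
    fix z assume z: "z \<in> elts x"
    then show "z \<in> elts y" using *[OF z c(1)] step(1)[OF z] le_carrier(1) unfolding near_check by metis
  next
    fix z assume z: "z \<in> elts y"
    then show "z \<in> elts x"
      using *[OF z c(2)] step(1) le_carrier(1) forces_eq_sym unfolding near_check by metis
  qed
qed

lemma forces_mem_check_iff:
  assumes "p \<in> elts (carrier PP)"
  shows "forces_mem PP (check PP y) (check PP x) p \<longleftrightarrow> y \<in> elts x"
proof
  assume "forces_mem PP (check PP y) (check PP x) p"
  from forces_mem_checkD[OF this le_refl[OF assms]] show "y \<in> elts x"
    using forces_eq_check le_carrier by metis
qed (rule forces_mem_check)

lemma forces_eq_check_iff:
  assumes "p \<in> elts (carrier PP)"
  shows "forces_eq PP (check PP y) (check PP x) p \<longleftrightarrow> y = x"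
  using forces_eq_check[OF _ assms] forces_eq_refl by metis

text \<open>Satisfaction in a structure of the ground model is absolute.\<close>

lemma forces_sat_check:
  "p \<in> elts (carrier PP) \<Longrightarrow> \<forall>i<arity \<phi>. d i = check PP (e i) \<Longrightarrow>
    p \<tturnstile>\<^bsub>PP\<^esub> sat_stmt (check PP M) (check PP A) \<phi> d \<longleftrightarrow> sat M A \<phi> e"
proof (induction \<phi> arbitrary: d e p)
  case (FNeg \<phi>)
  have "q \<tturnstile>\<^bsub>PP\<^esub> sat_stmt (check PP M) (check PP A) \<phi> d \<longleftrightarrow> sat M A \<phi> e" if "le PP q p" for q
    using FNeg.IH[of q d e] FNeg.prems le_carrier[OF that] by simp
  then show ?case using le_refl[OF FNeg.prems(1)] unfolding sat_def by auto
next
  case (FAll \<phi>)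
  let ?F = "\<lambda>x. sat_stmt (check PP M) (check PP A) \<phi> (case_nat x d)"
  have *: "q \<tturnstile>\<^bsub>PP\<^esub> ?F (check PP x) \<longleftrightarrow> sat M A \<phi> (case_nat x e)" if "le PP q p" for q x
    by (rule FAll.IH) (use FAll.prems le_carrier[OF that] in \<open>auto split: nat.split\<close>)
  have cong: "r \<tturnstile>\<^bsub>PP\<^esub> ?F x \<longleftrightarrow> r \<tturnstile>\<^bsub>PP\<^esub> ?F y" if "forces_eq PP x y r" "r \<in> elts (carrier PP)" for x y r
  proof (rule forces_cong[OF stmt_rel_sat])
    show "\<forall>i<arity \<phi>. forces_eq PP (case_nat x d i) (case_nat y d i) r"
      using that(1) forces_eq_refl by (auto split: nat.split)
  qed (use that forces_eq_refl le_refl in auto)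
  have "p \<tturnstile>\<^bsub>PP\<^esub> AllIn (check PP M) ?F \<longleftrightarrow> (\<forall>x\<in>elts M. sat M A \<phi> (case_nat x e))"
  proof
    assume a: "p \<tturnstile>\<^bsub>PP\<^esub> AllIn (check PP M) ?F"
    show "\<forall>x\<in>elts M. sat M A \<phi> (case_nat x e)"
    proof
      fix x assume "x \<in> elts M"
      then have "p \<tturnstile>\<^bsub>PP\<^esub> ?F (check PP x)"
        using a[unfolded forces_AllIn] is_name_check le_refl[OF FAll.prems(1)] forces_mem_check by metis
      then show "sat M A \<phi> (case_nat x e)" using * le_refl[OF FAll.prems(1)] by metis
    qed
  next
    assume a: "\<forall>x\<in>elts M. sat M A \<phi> (case_nat x e)"
    show "p \<tturnstile>\<^bsub>PP\<^esub> AllIn (check PP M) ?F"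
      unfolding forces_AllIn
    proof (intro allI impI, rule forces_dense)
      fix x q r assume "forces_mem PP x (check PP M) q" "le PP q p" "le PP r q"
      then obtain y s where y: "y \<in> elts M" "le PP s r" "forces_eq PP x (check PP y) s"
        using forces_mem_checkD by metis
      have "le PP s p" using y le_trans \<open>le PP q p\<close> \<open>le PP r q\<close> by metis
      then have "s \<tturnstile>\<^bsub>PP\<^esub> ?F (check PP y)" using * a y(1) by metis
      then have "s \<tturnstile>\<^bsub>PP\<^esub> ?F x" using cong[OF y(3)] le_carrier y(2) by metis
      then show "\<exists>s. le PP s r \<and> s \<tturnstile>\<^bsub>PP\<^esub> ?F x" using y(2) by metis
    qed
  qed
  then show ?case unfolding sat_def by simp
next
  case (FConj \<phi> \<psi>)
  have "p \<tturnstile>\<^bsub>PP\<^esub> sat_stmt (check PP M) (check PP A) \<phi> d \<longleftrightarrow> sat M A \<phi> e"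
    "p \<tturnstile>\<^bsub>PP\<^esub> sat_stmt (check PP M) (check PP A) \<psi> d \<longleftrightarrow> sat M A \<psi> e"
    using FConj.IH[of p d e] FConj.prems by simp_all
  then show ?case unfolding sat_def by simp
qed (simp_all add: sat_def forces_mem_check_iff forces_eq_check_iff)

end

section \<open>Projections that preserve the generic extension\<close>

lemma small_pairs_image: "small ((\<lambda>x. f (fst x) (snd x)) ` pairs a)"
  for f :: "'v::zfc \<Rightarrow> 'v \<Rightarrow> 'v"
proof (rule small_subset)
  show "small ((\<lambda>z. f (carrier z) (order_rel z)) ` elts a)" by (intro small_image small_elts)
  show "(\<lambda>x. f (fst x) (snd x)) ` pairs a \<subseteq> (\<lambda>z. f (carrier z) (order_rel z)) ` elts a"
  proof (rule image_subsetI)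
    fix x assume "x \<in> pairs a"
    then have "kpair (fst x) (snd x) \<in> elts a" unfolding pairs_def by auto
    then show "f (fst x) (snd x) \<in> (\<lambda>z. f (carrier z) (order_rel z)) ` elts a"
      by (rule rev_image_eqI) simp
  qed
qed

text \<open>The translation of names along a map \<open>pr\<close> of the set \<open>C\<close> of conditions. Pairs whose second
  coordinate is not a condition never contribute to an interpretation and are dropped.\<close>

function tr :: "'v::zfc \<Rightarrow> ('v \<Rightarrow> 'v) \<Rightarrow> 'v \<Rightarrow> 'v" where
  "tr C pr a = mkset ((\<lambda>x. kpair (tr C pr (fst x)) (pr (snd x))) ` {x \<in> pairs a. snd x \<in> elts C})"
  by pat_completeness auto
termination
proof (relation "inv_image ({(x, y). x \<in> elts y}\<^sup>+) (\<lambda>(C, pr, a). a)")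
  show "wf (inv_image ({(x, y). x \<in> elts y}\<^sup>+) (\<lambda>(C, pr, a). a))" by (rule wf_inv_image[OF wf_trancl_mem])
  show "((C, pr, fst x), C, pr, a) \<in> inv_image ({(x, y). x \<in> elts y}\<^sup>+) (\<lambda>(C, pr, a). a)"
    if "x \<in> {x \<in> pairs a. snd x \<in> elts C}" for pr :: "'v \<Rightarrow> 'v" and C a x
    using pairs_rank[of "fst x" "snd x" a] that by simp
qed

declare tr.simps [simp del]

lemma elts_tr: "elts (tr C pr a) = {kpair (tr C pr c) (pr s) | c s. (c, s) \<in> pairs a \<and> s \<in> elts C}"
proof -
  have "elts (tr C pr a) = (\<lambda>x. kpair (tr C pr (fst x)) (pr (snd x))) ` {x \<in> pairs a. snd x \<in> elts C}"
    by (subst tr.simps, rule elts_mkset, rule small_subset[OF small_pairs_image[of _ a], OF image_mono]) simp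
  then show ?thesis by force
qed

lemma pairs_tr: "pairs (tr C pr a) = {(tr C pr c, pr s) | c s. (c, s) \<in> pairs a \<and> s \<in> elts C}"
  unfolding pairs_def[of "tr C pr a"] elts_tr by auto

text \<open>By \<open>pr_lift\<close>, conditions with the same image are inseparable in \<open>PP\<close>. So the two posets have the same
  generic extensions, and forcing can be transferred along the translation of names.\<close>

locale projection = P: forcing PP + Q: forcing QQ for PP QQ :: "'v::zfc" +
  fixes pr :: "'v \<Rightarrow> 'v"
  assumes pr_carrier: "p \<in> elts (carrier PP) \<Longrightarrow> pr p \<in> elts (carrier QQ)"
    and pr_surj: "q \<in> elts (carrier QQ) \<Longrightarrow> \<exists>p\<in>elts (carrier PP). pr p = q"
    and pr_mono: "le PP q p \<Longrightarrow> le QQ (pr q) (pr p)"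
    and pr_lift: "q \<in> elts (carrier PP) \<Longrightarrow> s \<in> elts (carrier PP) \<Longrightarrow> le QQ (pr q) (pr s) \<Longrightarrow>
      \<exists>r. le PP r q \<and> le PP r s \<and> pr r = pr q"
begin

lemma pr_lift1:
  assumes "p \<in> elts (carrier PP)" "le QQ q (pr p)" shows "\<exists>r. le PP r p \<and> pr r = q"
proof -
  obtain r where "r \<in> elts (carrier PP)" "pr r = q" using pr_surj Q.le_carrier assms(2) by metis
  then show ?thesis using pr_lift[of r p] assms by metis
qed

lemma pr_lift2:
  assumes "p \<in> elts (carrier PP)" "s \<in> elts (carrier PP)" "le QQ q (pr p)" "le QQ q (pr s)"
  shows "\<exists>r. le PP r p \<and> le PP r s \<and> pr r = q"
proof -
  obtain r where r: "le PP r p" "pr r = q" using pr_lift1 assms by metis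
  then obtain r' where "le PP r' r" "le PP r' s" "pr r' = q"
    using pr_lift[of r s] assms P.le_carrier by metis
  then show ?thesis using P.le_trans r by metis
qed

abbreviation "t \<equiv> tr (carrier PP) pr"

lemma pairs_tI: "(c, s) \<in> pairs a \<Longrightarrow> s \<in> elts (carrier PP) \<Longrightarrow> (t c, pr s) \<in> pairs (t a)"
  unfolding pairs_tr by auto

lemma pairs_tD: "(c', s') \<in> pairs (t a) \<Longrightarrow>
    \<exists>c s. c' = t c \<and> s' = pr s \<and> (c, s) \<in> pairs a \<and> s \<in> elts (carrier PP)"
  unfolding pairs_tr by auto

lemma near_t:
  assumes "q \<in> elts (carrier PP)"
    and IH: "\<And>d u r. (d, u) \<in> pairs b \<Longrightarrow> r \<in> elts (carrier PP) \<Longrightarrow>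
      forces_eq PP a d r \<longleftrightarrow> forces_eq QQ (t a) (t d) (pr r)"
  shows "P.near a b q \<longleftrightarrow> Q.near (t a) (t b) (pr q)"
proof
  assume "P.near a b q"
  then obtain d u r where d: "(d, u) \<in> pairs b" "le PP r q" "le PP r u" "forces_eq PP a d r" by (rule P.nearE)
  note c = P.le_carrier[OF d(3)]
  show "Q.near (t a) (t b) (pr q)"
    by (rule Q.nearI[OF pairs_tI[OF d(1) c(2)] pr_mono[OF d(2)] pr_mono[OF d(3)]])
      (use IH[OF d(1) c(1)] d(4) in simp)
next
  assume "Q.near (t a) (t b) (pr q)"
  then obtain d' u' r' where d': "(d', u') \<in> pairs (t b)" "le QQ r' (pr q)" "le QQ r' u'" "forces_eq QQ (t a) d' r'"
    by (rule Q.nearE)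
  then obtain d u where d: "d' = t d" "u' = pr u" "(d, u) \<in> pairs b" "u \<in> elts (carrier PP)"
    using pairs_tD by metis
  then obtain r where r: "le PP r q" "le PP r u" "pr r = r'" using pr_lift2[OF assms(1)] d'(2,3) by metis
  then have "forces_eq PP a d r" using IH[OF d(3) P.le_carrier(1)[OF r(1)]] d'(4) d(1) by simp
  then show "P.near a b q" by (rule P.nearI[OF d(3) r(1,2)])
qed

lemma covered_t:
  assumes p: "p \<in> elts (carrier PP)"
    and IH: "\<And>c s d u r. (c, s) \<in> pairs a \<Longrightarrow> (d, u) \<in> pairs b \<Longrightarrow> r \<in> elts (carrier PP) \<Longrightarrow>
      forces_eq PP c d r \<longleftrightarrow> forces_eq QQ (t c) (t d) (pr r)"
  shows "P.covered a b p \<longleftrightarrow> Q.covered (t a) (t b) (pr p)"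
proof
  assume P: "P.covered a b p"
  show "Q.covered (t a) (t b) (pr p)"
  proof (rule Q.coveredI)
    fix c' s' q assume c': "(c', s') \<in> pairs (t a)" "le QQ q (pr p)" "le QQ q s'"
    then obtain c s where c: "c' = t c" "s' = pr s" "(c, s) \<in> pairs a" "s \<in> elts (carrier PP)"
      using pairs_tD by metis
    then obtain r where r: "le PP r p" "le PP r s" "pr r = q" using pr_lift2[OF p] c'(2,3) by metis
    show "Q.near c' (t b) q"
      using P.coveredD[OF P c(3) r(1,2)] near_t[OF P.le_carrier(1)[OF r(1)] IH[OF c(3)]] c(1) r(3) by simp
  qed
next
  assume Q: "Q.covered (t a) (t b) (pr p)"
  show "P.covered a b p"
  proof (rule P.coveredI)
    fix c s q assume c: "(c, s) \<in> pairs a" "le PP q p" "le PP q s"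
    have "Q.near (t c) (t b) (pr q)"
      using Q.coveredD[OF Q pairs_tI[OF c(1) P.le_carrier(2)[OF c(3)]] pr_mono[OF c(2)] pr_mono[OF c(3)]] .
    then show "P.near c b q" using near_t[OF P.le_carrier(1)[OF c(2)] IH[OF c(1)]] by simp
  qed
qed

lemma forces_eq_t: "p \<in> elts (carrier PP) \<Longrightarrow> forces_eq PP a b p \<longleftrightarrow> forces_eq QQ (t a) (t b) (pr p)"
proof (induction a arbitrary: b p rule: name_induct)
  case (step a)
  have "forces_eq PP d c r \<longleftrightarrow> forces_eq QQ (t d) (t c) (pr r)"
    if "(c, s) \<in> pairs a" "r \<in> elts (carrier PP)" for c s d r
    using step(1)[OF that] P.forces_eq_sym Q.forces_eq_sym by metis
  then have "P.covered b a p \<longleftrightarrow> Q.covered (t b) (t a) (pr p)" by (intro covered_t step(2))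
  moreover have "P.covered a b p \<longleftrightarrow> Q.covered (t a) (t b) (pr p)" by (intro covered_t step)
  ultimately show ?case unfolding P.forces_eq_iff Q.forces_eq_iff by simp
qed

lemma forces_mem_t:
  assumes "p \<in> elts (carrier PP)" shows "forces_mem PP a b p \<longleftrightarrow> forces_mem QQ (t a) (t b) (pr p)"
proof -
  have "P.near a b q \<longleftrightarrow> Q.near (t a) (t b) (pr q)" if "le PP q p" for q
    by (rule near_t[OF P.le_carrier(1)[OF that] forces_eq_t])
  then show ?thesis unfolding P.forces_mem_iff Q.forces_mem_iff
    using pr_lift1[OF assms] pr_mono by metis
qed

lemma is_name_t: "is_name PP a \<Longrightarrow> is_name QQ (t a)"
proof (induction a rule: name_induct)
  case (step a)
  show ?case
  proof (rule is_name.intros)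
    fix z assume "z \<in> elts (t a)"
    then obtain c s where c: "z = kpair (t c) (pr s)" "(c, s) \<in> pairs a" "s \<in> elts (carrier PP)"
      unfolding elts_tr by auto
    then have "is_name QQ (t c)" using step is_name_pairs by metis
    then show "\<exists>y p. z = kpair y p \<and> p \<in> elts (carrier QQ) \<and> is_name QQ y" using c pr_carrier by metis
  qed
qed

text \<open>A preimage of a name is obtained by attaching to each element all preimages of its condition.\<close>

lemma is_name_lift: "is_name QQ y \<Longrightarrow> \<exists>x. is_name PP x \<and> t x = y"
proof (induction y rule: name_induct)
  case (step y)
  then have "\<exists>x. is_name PP x \<and> t x = c" if "(c, s) \<in> pairs y" for c s
    using that is_name_pairs[OF step(2) that] by metis
  then obtain g where g: "\<And>c s. (c, s) \<in> pairs y \<Longrightarrow> is_name PP (g c) \<and> t (g c) = c" by metis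
  define f where "f c s = mkset ((\<lambda>p. kpair (g c) p) ` {p \<in> elts (carrier PP). pr p = s})" for c s
  have f: "elts (f c s) = {kpair (g c) p | p. p \<in> elts (carrier PP) \<and> pr p = s}" for c s
    unfolding f_def by (subst elts_mkset) (rule small_image, rule small_subset[OF small_elts[of "carrier PP"]], auto)
  define x where "x = mkset (\<Union>z\<in>(\<lambda>x. f (fst x) (snd x)) ` pairs y. elts z)"
  have "elts x = (\<Union>z\<in>(\<lambda>x. f (fst x) (snd x)) ` pairs y. elts z)"
    unfolding x_def by (intro elts_mkset small_UN small_pairs_image small_elts)
  then have x: "elts x = {kpair (g c) p | c p. (c, pr p) \<in> pairs y \<and> p \<in> elts (carrier PP)}"
    by (fastforce simp: f)
  have "is_name PP x"
  proof (rule is_name.intros)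
    fix z assume "z \<in> elts x"
    then obtain c p where "z = kpair (g c) p" "(c, pr p) \<in> pairs y" "p \<in> elts (carrier PP)" unfolding x by auto
    then show "\<exists>y p. z = kpair y p \<and> p \<in> elts (carrier PP) \<and> is_name PP y" using g by metis
  qed
  moreover have "t x = y"
  proof (rule elts_eqI)
    fix z
    have "z \<in> elts (t x) \<longleftrightarrow> (\<exists>c p. z = kpair (t (g c)) (pr p) \<and> (c, pr p) \<in> pairs y \<and> p \<in> elts (carrier PP))"
      unfolding elts_tr pairs_def[of x] x by auto
    also have "\<dots> \<longleftrightarrow> (\<exists>c s. z = kpair c s \<and> (c, s) \<in> pairs y)"
      using g pr_surj is_name_pairs[OF step(2)] by metis
    also have "\<dots> \<longleftrightarrow> z \<in> elts y"
    proof
      assume "z \<in> elts y"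
      with step(2) show "\<exists>c s. z = kpair c s \<and> (c, s) \<in> pairs y"
        by cases (metis CollectI case_prodI pairs_def)
    qed (auto simp: pairs_def)
    finally show "z \<in> elts (t x) \<longleftrightarrow> z \<in> elts y" .
  qed
  ultimately show ?case by auto
qed

lemma forces_t:
  "stmt_rel (\<lambda>x y. is_name PP x \<and> y = t x) (\<lambda>x y. y = t x) \<phi> \<psi> \<Longrightarrow> p \<in> elts (carrier PP) \<Longrightarrow>
    p \<tturnstile>\<^bsub>PP\<^esub> \<phi> \<longleftrightarrow> pr p \<tturnstile>\<^bsub>QQ\<^esub> \<psi>"
proof (induction arbitrary: p rule: stmt_rel.induct)
  case (Mem a a' b b')
  then show ?case using forces_mem_t by simp
next
  case (Eq a a' b b')
  then show ?case using forces_eq_t by simp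
next
  case (Neg \<phi> \<psi>)
  show ?case unfolding forces_stmt.simps
  proof (intro iffI allI impI)
    fix q assume *: "\<forall>q. le PP q p \<longrightarrow> \<not> q \<tturnstile>\<^bsub>PP\<^esub> \<phi>" "le QQ q (pr p)"
    then obtain r where "le PP r p" "pr r = q" using pr_lift1 Neg.prems by metis
    then show "\<not> q \<tturnstile>\<^bsub>QQ\<^esub> \<psi>" using * Neg.IH P.le_carrier by metis
  next
    fix q assume *: "\<forall>q. le QQ q (pr p) \<longrightarrow> \<not> q \<tturnstile>\<^bsub>QQ\<^esub> \<psi>" "le PP q p"
    then show "\<not> q \<tturnstile>\<^bsub>PP\<^esub> \<phi>" using pr_mono Neg.IH P.le_carrier by metis
  qed
next
  case (Conj \<phi> \<psi> \<phi>' \<psi>')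
  then show ?case unfolding forces_stmt.simps by metis
next
  case (Forall F G)
  have "p \<tturnstile>\<^bsub>PP\<^esub> F x \<longleftrightarrow> pr p \<tturnstile>\<^bsub>QQ\<^esub> G (t x)" if "is_name PP x" for x
    by (rule Forall.IH[OF _ Forall.prems]) (use that in simp)
  then show ?case unfolding forces_stmt.simps using is_name_t is_name_lift by metis
next
  case (AllFm F G)
  have "p \<tturnstile>\<^bsub>PP\<^esub> F \<phi> \<longleftrightarrow> pr p \<tturnstile>\<^bsub>QQ\<^esub> G \<phi>" for \<phi>
    by (rule AllFm.IH[OF AllFm.prems])
  then show ?case unfolding forces_stmt.simps by metis
qed

lemma t_check: "t (check PP x) = check QQ x"
proof (induction x rule: mem_induct)
  case (step x)
  show ?case
  proof (rule elts_eqI)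
    fix z
    have "z \<in> elts (t (check PP x)) \<longleftrightarrow> (\<exists>y p. z = kpair (t (check PP y)) (pr p) \<and> y \<in> elts x \<and> p \<in> elts (carrier PP))"
      unfolding elts_tr pairs_check by auto
    also have "\<dots> \<longleftrightarrow> (\<exists>y q. z = kpair (check QQ y) q \<and> y \<in> elts x \<and> q \<in> elts (carrier QQ))"
      using step pr_carrier pr_surj by metis
    finally show "z \<in> elts (t (check PP x)) \<longleftrightarrow> z \<in> elts (check QQ x)" unfolding elts_check by simp
  qed
qed

text \<open>A name in the language of the larger poset for the generic filter of the smaller one.\<close>

definition proj_name :: 'v where
  "proj_name = mkset ((\<lambda>p. kpair (check PP (pr p)) p) ` elts (carrier PP))"

lemma elts_proj_name: "elts proj_name = (\<lambda>p. kpair (check PP (pr p)) p) ` elts (carrier PP)"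
  unfolding proj_name_def by (intro elts_mkset small_image small_elts)

lemma t_proj_name: "t proj_name = generic_name QQ"
proof (rule elts_eqI)
  fix z
  have "z \<in> elts (t proj_name) \<longleftrightarrow> (\<exists>p. z = kpair (t (check PP (pr p))) (pr p) \<and> p \<in> elts (carrier PP))"
    unfolding elts_tr pairs_def elts_proj_name by auto
  also have "\<dots> \<longleftrightarrow> z \<in> elts (generic_name QQ)"
    unfolding t_check elts_generic_name using pr_surj pr_carrier by auto
  finally show "z \<in> elts (t proj_name) \<longleftrightarrow> z \<in> elts (generic_name QQ)" .
qed

lemma SSP_lift:
  assumes "QQ \<in> SSP" shows "PP \<in> SSP"
proof -
  have "p \<tturnstile>\<^bsub>PP\<^esub> stationary_stmt (check PP omega1) (check PP T)"
    if "holds (stationary_stmt omega1 T)" "p \<in> elts (carrier PP)" for T p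
  proof -
    have "pr p \<tturnstile>\<^bsub>QQ\<^esub> stationary_stmt (check QQ omega1) (check QQ T)"
      using assms that pr_carrier unfolding SSP_def by simp
    then show ?thesis
      using forces_t[OF stmt_rel_stationary that(2)] t_check by metis
  qed
  then show ?thesis unfolding SSP_def using P.forcing_notion by simp
qed

end

section \<open>Definable relations and elementary maps\<close>

definition pair_closed :: "'v::zfc \<Rightarrow> bool" where
  "pair_closed M \<longleftrightarrow> Transset M \<and> (\<forall>x\<in>elts M. \<forall>y\<in>elts M. upair x y \<in> elts M)"

text \<open>The formula must be the same for all structures, since \<open>P\<close> is evaluated on both sides of an elementary
  map. The rules below construct it by resolution; variables bound in \<open>P\<close> become de Bruijn indices of \<open>e\<close>.\<close>

definition definable :: "('v::zfc \<Rightarrow> (nat \<Rightarrow> 'v) \<Rightarrow> bool) \<Rightarrow> bool" where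
  "definable P \<longleftrightarrow> (\<exists>\<phi>. \<forall>M A e. pair_closed M \<longrightarrow> range e \<subseteq> elts M \<longrightarrow> (sat M A \<phi> e \<longleftrightarrow> P M e))"

lemma definableI:
  "(\<And>M A e. pair_closed M \<Longrightarrow> range e \<subseteq> elts M \<Longrightarrow> sat M A \<phi> e \<longleftrightarrow> P M e) \<Longrightarrow> definable P"
  unfolding definable_def by blast

lemma definable_cong:
  assumes "definable P'" "\<And>M e. pair_closed M \<Longrightarrow> range e \<subseteq> elts M \<Longrightarrow> P M e \<longleftrightarrow> P' M e"
  shows "definable P"
  using assms unfolding definable_def by metis

lemma definable_mem: "definable (\<lambda>M e. e i \<in> elts (e j))"
  by (rule definableI[of "FMem i j"]) (simp add: sat_def)

lemma definable_eq: "definable (\<lambda>M e. e i = e j)"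
  by (rule definableI[of "FEq i j"]) (simp add: sat_def)

lemma definable_not: "definable P \<Longrightarrow> definable (\<lambda>M e. \<not> P M e)"
proof -
  assume "definable P"
  then obtain \<phi> where "\<forall>M A e. pair_closed M \<longrightarrow> range e \<subseteq> elts M \<longrightarrow> (sat M A \<phi> e \<longleftrightarrow> P M e)"
    unfolding definable_def by (rule exE)
  then show ?thesis by (intro definableI[of "FNeg \<phi>"]) (simp add: sat_def)
qed

lemma definable_conj: "definable P \<Longrightarrow> definable Q \<Longrightarrow> definable (\<lambda>M e. P M e \<and> Q M e)"
proof -
  assume "definable P" "definable Q"
  then obtain \<phi> \<psi> where "\<forall>M A e. pair_closed M \<longrightarrow> range e \<subseteq> elts M \<longrightarrow> (sat M A \<phi> e \<longleftrightarrow> P M e)"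
    "\<forall>M A e. pair_closed M \<longrightarrow> range e \<subseteq> elts M \<longrightarrow> (sat M A \<psi> e \<longleftrightarrow> Q M e)"
    unfolding definable_def by (elim exE)
  then show ?thesis by (intro definableI[of "FConj \<phi> \<psi>"]) (simp add: sat_def)
qed

lemma range_case_nat: "range e \<subseteq> A \<Longrightarrow> x \<in> A \<Longrightarrow> range (case_nat x e) \<subseteq> A"
proof (rule image_subsetI)
  fix i assume "range e \<subseteq> A" "x \<in> A"
  then show "case_nat x e i \<in> A" using range_subsetD[of e A] by (cases i) simp_all
qed

lemma definable_all:
  assumes "definable (\<lambda>M e. Q M (e 0) (\<lambda>i. e (Suc i)))"
  shows "definable (\<lambda>M e. \<forall>x\<in>elts M. Q M x e)"
proof -
  obtain \<phi> where *: "\<And>M A e. pair_closed M \<Longrightarrow> range e \<subseteq> elts M \<Longrightarrow> sat M A \<phi> e \<longleftrightarrow> Q M (e 0) (\<lambda>i. e (Suc i))"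
    using assms unfolding definable_def by metis
  show ?thesis
  proof (rule definableI[of "FAll \<phi>"])
    fix M A :: 'a and e :: "nat \<Rightarrow> 'a" assume M: "pair_closed M" "range e \<subseteq> elts M"
    have "sat M A \<phi> (case_nat x e) \<longleftrightarrow> Q M x e" if "x \<in> elts M" for x
    proof -
      have "range (case_nat x e) \<subseteq> elts M" by (rule range_case_nat[OF M(2) that])
      from *[OF M(1) this] show ?thesis by simp
    qed
    then show "sat M A (FAll \<phi>) e \<longleftrightarrow> (\<forall>x\<in>elts M. Q M x e)" unfolding sat_def by simp
  qed
qed

lemma definable_ex:
  assumes "definable (\<lambda>M e. Q M (e 0) (\<lambda>i. e (Suc i)))"
  shows "definable (\<lambda>M e. \<exists>x\<in>elts M. Q M x e)"
  using definable_not[OF definable_all[of "\<lambda>M x e. \<not> Q M x e", OF definable_not[OF assms]]] by simp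

lemma definable_imp: "definable P \<Longrightarrow> definable Q \<Longrightarrow> definable (\<lambda>M e. P M e \<longrightarrow> Q M e)"
  using definable_not[OF definable_conj[OF _ definable_not], of P Q] by simp

lemma definable_disj: "definable P \<Longrightarrow> definable Q \<Longrightarrow> definable (\<lambda>M e. P M e \<or> Q M e)"
  using definable_imp[OF definable_not, of P Q] by (simp add: disj_imp)

lemma definable_iff: "definable P \<Longrightarrow> definable Q \<Longrightarrow> definable (\<lambda>M e. P M e \<longleftrightarrow> Q M e)"
  using definable_conj[OF definable_imp definable_imp, of P Q Q P] by (simp add: iff_conv_conj_imp)

lemma definable_upair: "definable (\<lambda>M e. e i = upair (e j) (e k))"
proof (rule definable_cong)
  show "definable (\<lambda>M e. \<forall>w\<in>elts M. w \<in> elts (e i) \<longleftrightarrow> w = e j \<or> w = e k)"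
    by (intro definable_all definable_iff definable_disj definable_mem definable_eq)
next
  fix M and e :: "nat \<Rightarrow> 'a" assume M: "pair_closed M" "range e \<subseteq> elts M"
  have el: "e i \<in> elts M" "e j \<in> elts M" "e k \<in> elts M" using M(2) by auto
  show "e i = upair (e j) (e k) \<longleftrightarrow> (\<forall>w\<in>elts M. w \<in> elts (e i) \<longleftrightarrow> w = e j \<or> w = e k)"
  proof
    assume *: "\<forall>w\<in>elts M. w \<in> elts (e i) \<longleftrightarrow> w = e j \<or> w = e k"
    have "elts (e i) \<subseteq> elts M" using M(1) el(1) unfolding pair_closed_def Transset_def by metis
    then show "e i = upair (e j) (e k)" by (intro elts_eqI) (use * el in auto)
  qed simp
qed

lemma definable_kpair: "definable (\<lambda>M e. e i = kpair (e j) (e k))"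
proof (rule definable_cong)
  show "definable (\<lambda>M e. \<exists>u\<in>elts M. \<exists>v\<in>elts M. u = upair (e j) (e j) \<and> v = upair (e j) (e k) \<and> e i = upair u v)"
    by (intro definable_ex definable_conj definable_upair)
next
  fix M and e :: "nat \<Rightarrow> 'a" assume M: "pair_closed M" "range e \<subseteq> elts M"
  then have "e j \<in> elts M" "e k \<in> elts M" by auto
  then show "e i = kpair (e j) (e k) \<longleftrightarrow>
    (\<exists>u\<in>elts M. \<exists>v\<in>elts M. u = upair (e j) (e j) \<and> v = upair (e j) (e k) \<and> e i = upair u v)"
    using M(1) unfolding pair_closed_def kpair_def by auto
qed

lemmas definable_intros = definable_mem definable_eq definable_kpair definable_not definable_conj
  definable_disj definable_imp definable_iff definable_all definable_ex

lemma pair_closed_kpair: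
  assumes "pair_closed M" shows "kpair x y \<in> elts M \<longleftrightarrow> x \<in> elts M \<and> y \<in> elts M"
proof
  assume k: "kpair x y \<in> elts M"
  have T: "c \<in> elts M" if "c \<in> elts b" "b \<in> elts M" for b c
    using assms that unfolding pair_closed_def Transset_def by auto
  have "upair x y \<in> elts M" by (rule T[OF _ k]) (simp add: elts_kpair)
  then show "x \<in> elts M \<and> y \<in> elts M" using T[of x "upair x y"] T[of y "upair x y"] by simp
qed (use assms in \<open>auto simp: pair_closed_def kpair_def\<close>)

lemma pair_closed_trans: "pair_closed M \<Longrightarrow> x \<in> elts y \<Longrightarrow> y \<in> elts M \<Longrightarrow> x \<in> elts M"
  unfolding pair_closed_def Transset_def by auto

lemma ZFC_minus_pair_closed: 
  assumes "ZFC_minus M A" shows "pair_closed M"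
proof -
  have T: "Transset M" using assms unfolding ZFC_minus_def by (elim conjE)
  have p: "\<forall>x\<in>elts M. \<forall>y\<in>elts M. \<exists>z\<in>elts M. elts z = {x, y}"
    using assms unfolding ZFC_minus_def by (elim conjE)
  have "upair x y \<in> elts M" if xy: "x \<in> elts M" "y \<in> elts M" for x y
  proof -
    obtain z where "z \<in> elts M" "elts z = {x, y}"
      by (rule bexE[OF bspec[OF bspec[OF p xy(1)] xy(2)]])
    moreover have "elts (upair x y) = {x, y}" by simp
    ultimately show ?thesis using zfc_extensionality by metis
  qed
  then show ?thesis unfolding pair_closed_def using T by simp
qed

lemma ZFC_minus_separation:
  assumes "ZFC_minus M A" "definable P" "range e \<subseteq> elts M" "a \<in> elts M"
  shows "\<exists>b\<in>elts M. elts b = {x \<in> elts a. P M (case_nat x e)}"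
proof -
  have s: "\<forall>\<phi> e. range e \<subseteq> elts M \<longrightarrow>
        (\<forall>a\<in>elts M. \<exists>b\<in>elts M. elts b = {x \<in> elts a. sat M A \<phi> (case_nat x e)})"
    using assms(1) unfolding ZFC_minus_def by (elim conjE)
  have pc: "pair_closed M" using ZFC_minus_pair_closed assms(1) by metis
  obtain \<phi> where \<phi>: "\<And>M A e. pair_closed M \<Longrightarrow> range e \<subseteq> elts M \<Longrightarrow> sat M A \<phi> e \<longleftrightarrow> P M e"
    using assms(2) unfolding definable_def by metis
  have "sat M A \<phi> (case_nat x e) \<longleftrightarrow> P M (case_nat x e)" if "x \<in> elts a" for x
  proof (rule \<phi>[OF pc])
    show "range (case_nat x e) \<subseteq> elts M"
      by (rule range_case_nat[OF assms(3) pair_closed_trans[OF pc that assms(4)]])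
  qed
  then have "{x \<in> elts a. sat M A \<phi> (case_nat x e)} = {x \<in> elts a. P M (case_nat x e)}" by auto
  then show ?thesis using s assms(3,4) by metis
qed

text \<open>A relation whose graph is a partial elementary map.\<close>

definition elem_pairs :: "'v::zfc \<Rightarrow> 'v \<Rightarrow> 'v \<Rightarrow> 'v \<Rightarrow> ('v \<Rightarrow> 'v \<Rightarrow> bool) \<Rightarrow> bool" where
  "elem_pairs M A N B X \<longleftrightarrow> (\<forall>x y. X x y \<longrightarrow> x \<in> elts M \<and> y \<in> elts N) \<and>
     (\<forall>\<phi> d e. (\<forall>i<arity \<phi>. X (d i) (e i)) \<longrightarrow> (sat M A \<phi> d \<longleftrightarrow> sat N B \<phi> e))"

lemma elem_pairs_definable:
  assumes "elem_pairs M A N B X" "pair_closed M" "pair_closed N" "definable P" "\<And>i. X (d i) (e i)"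
  shows "P M d \<longleftrightarrow> P N e"
proof -
  obtain \<phi> where \<phi>: "\<And>M A e. pair_closed M \<Longrightarrow> range e \<subseteq> elts M \<Longrightarrow> sat M A \<phi> e \<longleftrightarrow> P M e"
    using assms(4) unfolding definable_def by metis
  note e1 = assms(1)[unfolded elem_pairs_def, THEN conjunct1, rule_format]
  note e2 = assms(1)[unfolded elem_pairs_def, THEN conjunct2, rule_format]
  have "d i \<in> elts M \<and> e i \<in> elts N" for i using e1[OF assms(5)] .
  then have r: "range d \<subseteq> elts M" "range e \<subseteq> elts N" by auto
  have "sat M A \<phi> d \<longleftrightarrow> sat N B \<phi> e" by (rule e2) (rule assms(5))
  then show ?thesis unfolding \<phi>[OF assms(2) r(1)] \<phi>[OF assms(3) r(2)] .
qed

lemma elem_pairs_definable2: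
  assumes "elem_pairs M A N B X" "pair_closed M" "pair_closed N"
    "definable (\<lambda>M e. P M (e 0) (e (Suc 0)))" "X a b" "X c d"
  shows "P M a c \<longleftrightarrow> P N b d"
proof -
  let ?d = "case_nat a (\<lambda>_. c)" and ?e = "case_nat b (\<lambda>_. d)"
  have "X (?d i) (?e i)" for i
    using assms(5,6) by (cases i) simp_all
  then have "P M (?d 0) (?d (Suc 0)) \<longleftrightarrow> P N (?e 0) (?e (Suc 0))"
    by (rule elem_pairs_definable[OF assms(1-4)])
  then show ?thesis by simp
qed

text \<open>In the recursion for \<open>preserves_stmt\<close> the assignments \<open>d\<close>, \<open>e\<close> hold the values chosen so far; \<open>D\<close>, \<open>F\<close>
  are the final ones, with the \<open>n\<close> values still to come at the indices below \<open>n\<close>.\<close>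

lemma preserves_holds:
  assumes "holds (preserves_stmt s M A N B \<phi> n d e)"
    "\<And>i. i < n \<Longrightarrow> D i \<in> elts M \<and> F i \<in> elts N \<and> holds (maps_stmt s (D i) (F i))"
    "\<And>j. D (n + j) = d j \<and> F (n + j) = e j"
  shows "sat M A \<phi> D \<longleftrightarrow> sat N B \<phi> F"
  using assms
proof (induction n arbitrary: d e)
  case 0
  then have "D = d" "F = e" by auto
  then show ?case using 0 by (simp add: sat_def)
next
  case (Suc n)
  show ?case
  proof (rule Suc.IH)
    show "holds (preserves_stmt s M A N B \<phi> n (case_nat (D n) d) (case_nat (F n) e))"
      using Suc.prems(1) Suc.prems(2)[of n] by simp
    show "\<And>i. i < n \<Longrightarrow> D i \<in> elts M \<and> F i \<in> elts N \<and> holds (maps_stmt s (D i) (F i))"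
      using Suc.prems(2) by simp
    show "D (n + j) = case_nat (D n) d j \<and> F (n + j) = case_nat (F n) e j" for j
      using Suc.prems(3) by (cases j) auto
  qed
qed

lemma sat_cong: "(\<And>i. i < arity \<phi> \<Longrightarrow> d i = d' i) \<Longrightarrow> sat M A \<phi> d \<longleftrightarrow> sat M A \<phi> d'"
proof (induction \<phi> arbitrary: d d')
  case (FNeg \<phi>)
  have "sat M A \<phi> d \<longleftrightarrow> sat M A \<phi> d'" by (rule FNeg.IH, rule FNeg.prems) simp
  then show ?case by (simp add: sat_def)
next
  case (FConj \<phi> \<psi>)
  have "sat M A \<phi> d \<longleftrightarrow> sat M A \<phi> d'" by (rule FConj.IH(1), rule FConj.prems) simp
  moreover have "sat M A \<psi> d \<longleftrightarrow> sat M A \<psi> d'" by (rule FConj.IH(2), rule FConj.prems) simp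
  ultimately show ?case by (simp add: sat_def)
next
  case (FAll \<phi>)
  have "sat M A \<phi> (case_nat x d) \<longleftrightarrow> sat M A \<phi> (case_nat x d')" for x
  proof (rule FAll.IH)
    show "case_nat x d i = case_nat x d' i" if "i < arity \<phi>" for i
      using FAll.prems[of "i - 1"] that by (cases i) simp_all
  qed
  then show ?case by (simp add: sat_def)
qed (simp_all add: sat_def)

lemma holds_upair_stmt: "holds (upair_stmt u x y) \<longleftrightarrow> u = upair x y"
proof
  assume "holds (upair_stmt u x y)"
  then show "u = upair x y" unfolding upair_stmt_def by (intro elts_eqI) auto
qed (simp add: upair_stmt_def)

lemma holds_maps_stmt: "holds (maps_stmt s x y) \<longleftrightarrow> kpair x y \<in> elts s"
  unfolding maps_stmt_def pair_stmt_def by (auto simp: holds_upair_stmt kpair_def)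

lemma holds_elem_emb:
  assumes "holds (elem_emb_stmt s M A N B)"
  shows "elem_pairs M A N B (\<lambda>x y. kpair x y \<in> elts s)" "\<And>x. x \<in> elts M \<Longrightarrow> \<exists>y. kpair x y \<in> elts s"
proof -
  have pr: "holds (pair_stmt z x y) \<longleftrightarrow> z = kpair x y" for z x y
    unfolding pair_stmt_def by (auto simp: holds_upair_stmt kpair_def)
  have f: "holds (function_stmt s M N)"
    and p: "\<And>\<phi>. holds (preserves_stmt s M A N B \<phi> (arity \<phi>) (\<lambda>_. undefined) (\<lambda>_. undefined))"
    using assms unfolding elem_emb_stmt_def by simp_all
  have f1: "\<forall>z\<in>elts s. \<exists>x\<in>elts M. \<exists>y\<in>elts N. z = kpair x y"
    and f2: "\<forall>x\<in>elts M. \<exists>y\<in>elts N. kpair x y \<in> elts s"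
    using f unfolding function_stmt_def by (auto simp: pr holds_maps_stmt)
  show "\<exists>y. kpair x y \<in> elts s" if "x \<in> elts M" for x using f2 that by metis
  show "elem_pairs M A N B (\<lambda>x y. kpair x y \<in> elts s)"
    unfolding elem_pairs_def
  proof (intro conjI allI impI)
    fix x y assume "kpair x y \<in> elts s"
    then obtain x' y' where "x' \<in> elts M" "y' \<in> elts N" "kpair x y = kpair x' y'" using f1 by metis
    then show "x \<in> elts M" "y \<in> elts N" by simp_all
  next
    fix \<phi> d e assume *: "\<forall>i<arity \<phi>. kpair (d i) (e i) \<in> elts s"
    let ?r = "\<lambda>d i. if i < arity \<phi> then d i else undefined"
    have "sat M A \<phi> (?r d) \<longleftrightarrow> sat N B \<phi> (?r e)"
    proof (rule preserves_holds[OF p])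
      fix i assume i: "i < arity \<phi>"
      then have "kpair (d i) (e i) \<in> elts s" using * by simp
      moreover then obtain x y where "x \<in> elts M" "y \<in> elts N" "kpair (d i) (e i) = kpair x y" using f1 by metis
      ultimately show "?r d i \<in> elts M \<and> ?r e i \<in> elts N \<and> holds (maps_stmt s (?r d i) (?r e i))"
        using i by (simp add: holds_maps_stmt)
    qed simp
    moreover have "sat M A \<phi> (?r d) \<longleftrightarrow> sat M A \<phi> d" "sat N B \<phi> (?r e) \<longleftrightarrow> sat N B \<phi> e"
      by (rule sat_cong, simp)+
    ultimately show "sat M A \<phi> d \<longleftrightarrow> sat N B \<phi> e" by simp
  qed
qed

context forcing
begin

lemma forces_AllIn_check:
  assumes "p \<tturnstile>\<^bsub>PP\<^esub> AllIn (check PP M) F" "x \<in> elts M" "le PP q p"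
  shows "q \<tturnstile>\<^bsub>PP\<^esub> F (check PP x)"
  using assms(1)[unfolded forces_AllIn, THEN spec, THEN spec, THEN mp, THEN mp, THEN mp,
    OF is_name_check assms(3) forces_mem_check[OF assms(2)]] .

lemma preserves_forces:
  assumes "r \<in> elts (carrier PP)"
    "r \<tturnstile>\<^bsub>PP\<^esub> preserves_stmt s (check PP M) (check PP A) (check PP N) (check PP B) \<phi> n d e"
    "\<And>i. i < n \<Longrightarrow> D i \<in> elts M \<and> F i \<in> elts N \<and> r \<tturnstile>\<^bsub>PP\<^esub> maps_stmt s (check PP (D i)) (check PP (F i))"
    "\<And>i. i < n \<Longrightarrow> D' i = check PP (D i) \<and> F' i = check PP (F i)"
    "\<And>j. D' (n + j) = d j \<and> F' (n + j) = e j"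
  shows "r \<tturnstile>\<^bsub>PP\<^esub> sat_stmt (check PP M) (check PP A) \<phi> D' \<longleftrightarrow> r \<tturnstile>\<^bsub>PP\<^esub> sat_stmt (check PP N) (check PP B) \<phi> F'"
  using assms
proof (induction n arbitrary: d e)
  case 0
  then have "D' = d" "F' = e" by auto
  then show ?case using forces_Iff 0 by simp
next
  case (Suc n)
  have Dn: "D n \<in> elts M" "F n \<in> elts N" "r \<tturnstile>\<^bsub>PP\<^esub> maps_stmt s (check PP (D n)) (check PP (F n))"
    using Suc.prems(3)[of n] by simp_all
  note rr = le_refl[OF Suc.prems(1)]
  show ?case
  proof (rule Suc.IH[OF Suc.prems(1)])
    have "r \<tturnstile>\<^bsub>PP\<^esub> AllIn (check PP N) (\<lambda>y. Imp (maps_stmt s (check PP (D n)) y)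
       (preserves_stmt s (check PP M) (check PP A) (check PP N) (check PP B) \<phi> n
         (case_nat (check PP (D n)) d) (case_nat y e)))"
      using forces_AllIn_check[OF Suc.prems(2)[unfolded preserves_stmt.simps] Dn(1) rr] .
    then have "r \<tturnstile>\<^bsub>PP\<^esub> Imp (maps_stmt s (check PP (D n)) (check PP (F n)))
       (preserves_stmt s (check PP M) (check PP A) (check PP N) (check PP B) \<phi> n
         (case_nat (check PP (D n)) d) (case_nat (check PP (F n)) e))"
      by (rule forces_AllIn_check[OF _ Dn(2) rr])
    then show "r \<tturnstile>\<^bsub>PP\<^esub> preserves_stmt s (check PP M) (check PP A) (check PP N) (check PP B) \<phi> n
        (case_nat (check PP (D n)) d) (case_nat (check PP (F n)) e)"
      unfolding forces_Imp using rr Dn(3) by metis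
    show "D' (n + j) = case_nat (check PP (D n)) d j \<and> F' (n + j) = case_nat (check PP (F n)) e j" for j
      using Suc.prems(4)[of n] Suc.prems(5) by (cases j) auto
  qed (use Suc.prems in simp_all)
qed

text \<open>What a condition decides about a name for an elementary embedding is a partial elementary map in the
  ground model, and any argument can be added to its domain by strengthening the condition. So elementarity
  of the embedding in the generic extension can be exploited without leaving the ground model.\<close>

lemma forces_elem_emb:
  assumes "r \<in> elts (carrier PP)" "is_name PP s"
    "r \<tturnstile>\<^bsub>PP\<^esub> elem_emb_stmt s (check PP M) (check PP A) (check PP N) (check PP B)"
  defines "X \<equiv> \<lambda>r x y. x \<in> elts M \<and> y \<in> elts N \<and> r \<tturnstile>\<^bsub>PP\<^esub> maps_stmt s (check PP x) (check PP y)"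
  shows "elem_pairs M A N B (X r)"
    and "\<And>x q. x \<in> elts M \<Longrightarrow> le PP q r \<Longrightarrow> \<exists>y q'. le PP q' q \<and> X q' x y"
proof -
  have f: "r \<tturnstile>\<^bsub>PP\<^esub> function_stmt s (check PP M) (check PP N)"
    and p: "\<And>\<phi>. r \<tturnstile>\<^bsub>PP\<^esub> preserves_stmt s (check PP M) (check PP A) (check PP N) (check PP B) \<phi> (arity \<phi>)
      (\<lambda>_. undefined) (\<lambda>_. undefined)"
    using assms(3) unfolding elem_emb_stmt_def by simp_all
  show "elem_pairs M A N B (X r)"
    unfolding elem_pairs_def
  proof (intro conjI allI impI)
    fix \<phi> d e assume *: "\<forall>i<arity \<phi>. X r (d i) (e i)"
    let ?r = "\<lambda>d i. if i < arity \<phi> then check PP (d i) else undefined"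
    have "r \<tturnstile>\<^bsub>PP\<^esub> sat_stmt (check PP M) (check PP A) \<phi> (?r d) \<longleftrightarrow>
        r \<tturnstile>\<^bsub>PP\<^esub> sat_stmt (check PP N) (check PP B) \<phi> (?r e)"
      by (rule preserves_forces[OF assms(1) p, where D = d and F = e]) (use * in \<open>auto simp: X_def\<close>)
    moreover have "r \<tturnstile>\<^bsub>PP\<^esub> sat_stmt (check PP M) (check PP A) \<phi> (?r d) \<longleftrightarrow> sat M A \<phi> d"
      "r \<tturnstile>\<^bsub>PP\<^esub> sat_stmt (check PP N) (check PP B) \<phi> (?r e) \<longleftrightarrow> sat N B \<phi> e"
      by (rule forces_sat_check[OF assms(1)], simp)+
    ultimately show "sat M A \<phi> d \<longleftrightarrow> sat N B \<phi> e" by simp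
  qed (simp_all add: X_def)
  fix x q assume x: "x \<in> elts M" and q: "le PP q r"
  let ?F = "\<lambda>x. ExIn (check PP N) (\<lambda>y. Conj (maps_stmt s x y)
     (AllIn (check PP N) (\<lambda>y'. Imp (maps_stmt s x y') (Eq y' y))))"
  have "r \<tturnstile>\<^bsub>PP\<^esub> AllIn (check PP M) ?F" using f unfolding function_stmt_def by simp
  then have "q \<tturnstile>\<^bsub>PP\<^esub> ?F (check PP x)"
    by (rule forces_AllIn_check[OF _ x q])
  note E = this[unfolded forces_ExIn forces_stmt.simps(4), rule_format, OF le_refl[OF le_carrier(1)[OF q]]]
  obtain q1 y where y: "le PP q1 q" "is_name PP y" "forces_mem PP y (check PP N) q1"
    "q1 \<tturnstile>\<^bsub>PP\<^esub> maps_stmt s (check PP x) y"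
    using E by (elim exE conjE)
  obtain z q2 where z: "z \<in> elts N" "le PP q2 q1" "forces_eq PP y (check PP z) q2"
    using forces_mem_checkD[OF y(3) le_refl[OF le_carrier(1)[OF y(1)]]] by metis
  have "q2 \<tturnstile>\<^bsub>PP\<^esub> maps_stmt s (check PP x) y" using forces_mono[OF y(4) z(2)] .
  moreover have "q2 \<tturnstile>\<^bsub>PP\<^esub> maps_stmt s (check PP x) y \<longleftrightarrow> q2 \<tturnstile>\<^bsub>PP\<^esub> maps_stmt s (check PP x) (check PP z)"
    by (rule forces_cong[OF stmt_rel_maps le_refl[OF le_carrier(1)[OF z(2)]]])
      (use z(3) forces_eq_refl in auto)
  ultimately have "X q2 x z" using x z(1) unfolding X_def by simp
  then show "\<exists>y q'. le PP q' q \<and> X q' x y" using le_trans[OF z(2) y(1)] by metis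
qed

end

section \<open>Hereditary cardinality and cardinal successors\<close>

definition hered :: "'v::zfc \<Rightarrow> 'v \<Rightarrow> bool" where
  "hered \<theta> x \<longleftrightarrow> elts (tc x) \<lesssim> elts \<theta>"

definition csucc :: "'v::zfc \<Rightarrow> 'v" where
  "csucc \<theta> = least_Ord (\<lambda>x. \<not> elts x \<lesssim> elts \<theta>)"

lemma heredI:
  assumes "infinite (elts \<theta>)" "elts x \<lesssim> elts \<theta>" "\<And>y. y \<in> elts x \<Longrightarrow> hered \<theta> y"
  shows "hered \<theta> x"
proof -
  have "(\<Union>y\<in>elts x. elts (tc y)) \<lesssim> elts \<theta>"
    using assms(3) unfolding hered_def by (rule UN_lepoll[OF assms(1,2)])
  then have "elts x \<union> (\<Union>y\<in>elts x. elts (tc y)) \<lesssim> elts \<theta>" by (rule Un_lepoll[OF assms(1,2)])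
  then show ?thesis unfolding hered_def by (rule lepoll_trans[OF subset_imp_lepoll[OF tc_subset_UN]])
qed

lemma hered_tc: "hered \<theta> x \<Longrightarrow> y \<in> elts (tc x) \<Longrightarrow> hered \<theta> y"
  unfolding hered_def using tc_mono subset_imp_lepoll lepoll_trans by metis

lemma hered_upair:
  assumes "infinite (elts \<theta>)" "hered \<theta> x" "hered \<theta> y" shows "hered \<theta> (upair x y)"
  by (rule heredI[OF assms(1)]) (use assms in \<open>auto intro: finite_lepoll_infinite\<close>)

lemma hered_kpair:
  assumes "infinite (elts \<theta>)" "hered \<theta> x" "hered \<theta> y" shows "hered \<theta> (kpair x y)"
  unfolding kpair_def by (intro hered_upair assms)

lemma hered_Ord: "Ord x \<Longrightarrow> elts x \<lesssim> elts \<theta> \<Longrightarrow> hered \<theta> x"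
  unfolding hered_def Ord_def using tc_Transset by metis

lemma
  fixes \<theta> :: "'v::zfc"
  shows Ord_csucc: "Ord (csucc \<theta>)" and not_csucc_lepoll: "\<not> elts (csucc \<theta>) \<lesssim> elts \<theta>"
    and mem_csucc: "y \<in> elts (csucc \<theta>) \<Longrightarrow> elts y \<lesssim> elts \<theta>"
proof -
  obtain a :: 'v where a: "Ord a" "\<not> elts a \<lesssim> elts \<theta>" using Hartogs by metis
  note l = least_Ord[where P="\<lambda>x. \<not> elts x \<lesssim> elts \<theta>", OF a, folded csucc_def]
  show "Ord (csucc \<theta>)" by (rule l(1))
  show "\<not> elts (csucc \<theta>) \<lesssim> elts \<theta>" by (rule l(2))
  show "y \<in> elts (csucc \<theta>) \<Longrightarrow> elts y \<lesssim> elts \<theta>" by (rule notnotD) (rule l(3))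
qed

lemma Card_csucc: "Card (csucc \<theta>)"
  unfolding Card_def
proof (intro conjI ballI notI)
  fix y assume "y \<in> elts (csucc \<theta>)" "elts y \<approx> elts (csucc \<theta>)"
  then have "elts (csucc \<theta>) \<lesssim> elts \<theta>"
    using mem_csucc eqpoll_sym lepoll_trans1 by metis
  then show False using not_csucc_lepoll by (rule notE[rotated])
qed (rule Ord_csucc)

lemma in_csucc: "Ord \<theta> \<Longrightarrow> \<theta> \<in> elts (csucc \<theta>)"
  using Ord_linear_le[OF _ Ord_csucc] not_csucc_lepoll subset_imp_lepoll by metis

lemma hered_Hset: 
  assumes "Ord \<theta>" "hered \<theta> x" shows "x \<in> elts (Hset (csucc \<theta>))"
proof -
  have "elts \<theta> \<subseteq> elts (csucc \<theta>)"
    using Ord_subset_iff[OF assms(1) Ord_csucc] in_csucc[OF assms(1)] by simp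
  then have "elts (tc x) \<lesssim> elts (csucc \<theta>)"
    using assms(2) subset_imp_lepoll lepoll_trans unfolding hered_def by metis
  moreover have "\<not> elts (tc x) \<approx> elts (csucc \<theta>)"
    using assms(2) not_csucc_lepoll eqpoll_sym lepoll_trans1 unfolding hered_def by metis
  ultimately show ?thesis unfolding elts_Hset using lepoll_iff_leqpoll by auto
qed

lemma Hset_hered: "x \<in> elts (Hset \<theta>) \<Longrightarrow> hered \<theta> x"
  unfolding elts_Hset hered_def by (simp add: lesspoll_imp_lepoll)

lemma definable_kpair_mem: "definable (\<lambda>M e. kpair (e i) (e j) \<in> elts (e k))"
proof (rule definable_cong)
  show "definable (\<lambda>M e. \<exists>w\<in>elts M. w = kpair (e i) (e j) \<and> w \<in> elts (e k))"
    by (intro definable_intros)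
next
  fix M and e :: "nat \<Rightarrow> 'a" assume M: "pair_closed M" "range e \<subseteq> elts M"
  then have "e k \<in> elts M" by auto
  then show "kpair (e i) (e j) \<in> elts (e k) \<longleftrightarrow> (\<exists>w\<in>elts M. w = kpair (e i) (e j) \<and> w \<in> elts (e k))"
    using pair_closed_trans[OF M(1)] by auto
qed

lemma definable_kpair_kpair_mem:
  "definable (\<lambda>M e. kpair (kpair (e i) (e i')) (kpair (e j) (e j')) \<in> elts (e k))"
proof (rule definable_cong)
  show "definable (\<lambda>M e. \<exists>a\<in>elts M. \<exists>b\<in>elts M. a = kpair (e i) (e i') \<and> b = kpair (e j) (e j') \<and>
      kpair a b \<in> elts (e k))"
    by (intro definable_intros definable_kpair_mem)
next
  fix M and e :: "nat \<Rightarrow> 'a" assume M: "pair_closed M" "range e \<subseteq> elts M"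
  then have "\<And>i. e i \<in> elts M" by auto
  then have "kpair (e i) (e j) \<in> elts M" for i j using pair_closed_kpair[OF M(1)] by simp
  then show "kpair (kpair (e i) (e i')) (kpair (e j) (e j')) \<in> elts (e k) \<longleftrightarrow>
    (\<exists>a\<in>elts M. \<exists>b\<in>elts M. a = kpair (e i) (e i') \<and> b = kpair (e j) (e j') \<and> kpair a b \<in> elts (e k))"
    by simp
qed

lemmas definable_rules = definable_intros definable_kpair_mem definable_kpair_kpair_mem

subsection \<open>The cardinal predecessor\<close>

text \<open>In the sense of \<open>M\<close>, every member of \<open>t\<close> is an image of \<open>z\<close>; \<open>f\<close> is the converse of an
  injection into \<open>z\<close>.\<close>

definition surjects_below :: "'v::zfc \<Rightarrow> 'v \<Rightarrow> 'v \<Rightarrow> bool" where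
  "surjects_below M z t \<longleftrightarrow> (\<forall>y\<in>elts M. y \<in> elts t \<longrightarrow> (\<exists>f\<in>elts M. \<forall>u\<in>elts M. u \<in> elts y \<longrightarrow>
     (\<exists>v\<in>elts M. v \<in> elts z \<and> kpair v u \<in> elts f \<and>
        (\<forall>u'\<in>elts M. u' \<in> elts y \<longrightarrow> kpair v u' \<in> elts f \<longrightarrow> u' = u))))"

text \<open>The definition of \<open>\<theta>\<close> from \<open>csucc \<theta>\<close> inside \<open>M\<close>. It puts \<open>\<theta>\<close> into the range of every elementary map
  that has \<open>csucc \<theta>\<close> in its range.\<close>

definition card_pred :: "'v::zfc \<Rightarrow> 'v \<Rightarrow> 'v \<Rightarrow> bool" where
  "card_pred M x t \<longleftrightarrow> x \<in> elts t \<and> surjects_below M x t \<and>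
     (\<forall>z\<in>elts M. z \<in> elts x \<longrightarrow> \<not> surjects_below M z t)"

lemma definable_card_pred: "definable (\<lambda>M e. card_pred M (e i) (e j))"
  unfolding card_pred_def surjects_below_def by (intro definable_rules)

lemma surjects_below_lepoll:
  assumes "pair_closed M" "t \<in> elts M" "surjects_below M z t" "y \<in> elts t"
  shows "elts y \<lesssim> elts z"
proof -
  have y: "y \<in> elts M" using pair_closed_trans assms by metis
  have uM: "u \<in> elts M" if "u \<in> elts y" for u using pair_closed_trans[OF assms(1) that y] .
  obtain f where "\<And>u. u \<in> elts M \<Longrightarrow> u \<in> elts y \<Longrightarrow> (\<exists>v\<in>elts M. v \<in> elts z \<and> kpair v u \<in> elts f \<and>
        (\<forall>u'\<in>elts M. u' \<in> elts y \<longrightarrow> kpair v u' \<in> elts f \<longrightarrow> u' = u))"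
    using assms(3,4) y unfolding surjects_below_def by metis
  then have "\<forall>u\<in>elts y. \<exists>v. v \<in> elts z \<and> kpair v u \<in> elts f \<and>
        (\<forall>u'\<in>elts M. u' \<in> elts y \<longrightarrow> kpair v u' \<in> elts f \<longrightarrow> u' = u)"
    using uM by metis
  then obtain g where g: "\<And>u. u \<in> elts y \<Longrightarrow> g u \<in> elts z \<and> kpair (g u) u \<in> elts f \<and>
        (\<forall>u'\<in>elts M. u' \<in> elts y \<longrightarrow> kpair (g u) u' \<in> elts f \<longrightarrow> u' = u)" by metis
  have "inj_on g (elts y)"
  proof (rule inj_onI)
    fix u u' assume u: "u \<in> elts y" "u' \<in> elts y" "g u = g u'"
    have "kpair (g u) u' \<in> elts f" using g[OF u(2)] u(3) by simp
    then show "u = u'" using g[OF u(1)] u(2) uM by metis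
  qed
  moreover have "g ` elts y \<subseteq> elts z" using g by auto
  ultimately show ?thesis unfolding lepoll_def by auto
qed

lemma card_pred_csucc:
  assumes M: "pair_closed M" "csucc \<theta> \<in> elts M" "elts (Hset (csucc \<theta>)) \<subseteq> elts M"
    and \<theta>: "Card \<theta>" "infinite (elts \<theta>)"
  shows "card_pred M x (csucc \<theta>) \<longleftrightarrow> x = \<theta>"
proof -
  have O: "Ord \<theta>" using \<theta>(1) unfolding Card_def by simp
  have surj: "surjects_below M \<theta> (csucc \<theta>)"
    unfolding surjects_below_def
  proof (intro ballI impI)
    fix y assume y: "y \<in> elts (csucc \<theta>)"
    then obtain h where h: "inj_on h (elts y)" "h ` elts y \<subseteq> elts \<theta>"
      using mem_csucc unfolding lepoll_def by metis
    define f where "f = mkset ((\<lambda>u. kpair (h u) u) ` elts y)"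
    have f: "elts f = (\<lambda>u. kpair (h u) u) ` elts y"
      unfolding f_def by (intro elts_mkset small_image small_elts)
    have Oe: "hered \<theta> u" if "u \<in> elts (csucc \<theta>)" for u
      using hered_Ord Ord_elts[OF Ord_csucc that] mem_csucc[OF that] by metis
    have "hered \<theta> f"
    proof (rule heredI[OF \<theta>(2)])
      show "elts f \<lesssim> elts \<theta>" unfolding f using image_lepoll lepoll_trans mem_csucc[OF y] by metis
      fix z assume "z \<in> elts f"
      then obtain u where u: "z = kpair (h u) u" "u \<in> elts y" unfolding f by auto
      have "h u \<in> elts (csucc \<theta>)"
        using Ord_trans[OF Ord_csucc _ in_csucc[OF O]] h(2) u(2) by auto
      moreover have "u \<in> elts (csucc \<theta>)" using Ord_trans[OF Ord_csucc u(2) y] .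
      ultimately show "hered \<theta> z" unfolding u(1) using hered_kpair[OF \<theta>(2)] Oe by metis
    qed
    then have fM: "f \<in> elts M" using hered_Hset[OF O] M(3) by auto
    show "\<exists>f\<in>elts M. \<forall>u\<in>elts M. u \<in> elts y \<longrightarrow> (\<exists>v\<in>elts M. v \<in> elts \<theta> \<and> kpair v u \<in> elts f \<and>
        (\<forall>u'\<in>elts M. u' \<in> elts y \<longrightarrow> kpair v u' \<in> elts f \<longrightarrow> u' = u))"
    proof (rule bexI[OF _ fM], intro ballI impI)
      fix u assume u: "u \<in> elts y"
      have k: "kpair (h u) u \<in> elts f" unfolding f using u by simp
      then have "h u \<in> elts M"
        using pair_closed_kpair[OF M(1)] pair_closed_trans[OF M(1) k fM] by simp
      moreover have "u' = u" if "u' \<in> elts y" "kpair (h u) u' \<in> elts f" for u'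
        using that u h(1) unfolding f by (auto dest: inj_onD)
      moreover have "h u \<in> elts \<theta>" using h(2) u by auto
      ultimately show "\<exists>v\<in>elts M. v \<in> elts \<theta> \<and> kpair v u \<in> elts f \<and>
        (\<forall>u'\<in>elts M. u' \<in> elts y \<longrightarrow> kpair v u' \<in> elts f \<longrightarrow> u' = u)"
        using k by (intro bexI[of _ "h u"]) auto
    qed
  qed
  have small: "\<not> surjects_below M z (csucc \<theta>)" if z: "z \<in> elts \<theta>" for z
  proof
    assume "surjects_below M z (csucc \<theta>)"
    then have "elts \<theta> \<lesssim> elts z" using surjects_below_lepoll M(1,2) in_csucc[OF O] by metis
    moreover have "elts z \<subseteq> elts \<theta>" using Ord_trans[OF O _ z] by auto
    ultimately have "elts z \<approx> elts \<theta>" using lepoll_antisym subset_imp_lepoll by metis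
    then show False using \<theta>(1) z unfolding Card_def by metis
  qed
  have \<theta>M: "\<theta> \<in> elts M" using pair_closed_trans[OF M(1) in_csucc[OF O] M(2)] .
  show ?thesis
  proof
    assume x: "card_pred M x (csucc \<theta>)"
    then have "Ord x" using Ord_elts[OF Ord_csucc] unfolding card_pred_def by metis
    moreover have "x \<notin> elts \<theta>" using x small unfolding card_pred_def by metis
    moreover have "\<theta> \<notin> elts x" using x surj \<theta>M unfolding card_pred_def by metis
    ultimately show "x = \<theta>" using Ord_linear[of x \<theta>] O by simp
  qed (use surj small in_csucc[OF O] in \<open>simp add: card_pred_def\<close>)
qed

subsection \<open>Projections in transitive models\<close>

text \<open>The relativization of \<open>fst_proj\<close> to \<open>M\<close>, in the form needed for \<open>definable_rules\<close>.\<close>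

definition fst_proj_in :: "'v::zfc \<Rightarrow> 'v \<Rightarrow> 'v \<Rightarrow> 'v \<Rightarrow> 'v \<Rightarrow> bool" where
  "fst_proj_in M C R C1 R1 \<longleftrightarrow>
     (\<forall>z\<in>elts M. z \<in> elts C \<longrightarrow> (\<exists>q\<in>elts M. \<exists>w\<in>elts M. z = kpair q w)) \<and>
     (\<forall>q\<in>elts M. q \<in> elts C1 \<longleftrightarrow> (\<exists>w\<in>elts M. kpair q w \<in> elts C)) \<and>
     (\<forall>z\<in>elts M. z \<in> elts R1 \<longleftrightarrow> (\<exists>q\<in>elts M. \<exists>p\<in>elts M. \<exists>v\<in>elts M. \<exists>w\<in>elts M.
        z = kpair q p \<and> kpair (kpair q v) (kpair p w) \<in> elts R)) \<and>
     (\<forall>q\<in>elts M. \<forall>v\<in>elts M. \<forall>s\<in>elts M. \<forall>w\<in>elts M.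
        kpair q v \<in> elts C \<longrightarrow> kpair s w \<in> elts C \<longrightarrow> kpair q s \<in> elts R1 \<longrightarrow>
        (\<exists>u\<in>elts M. kpair q u \<in> elts C \<and> kpair (kpair q u) (kpair q v) \<in> elts R \<and>
           kpair (kpair q u) (kpair s w) \<in> elts R)) \<and>
     (\<forall>q\<in>elts M. \<forall>p\<in>elts M. \<forall>w\<in>elts M. kpair q p \<in> elts R1 \<longrightarrow> kpair q w \<in> elts C \<longrightarrow>
        (\<exists>v\<in>elts M. kpair p v \<in> elts C \<and> kpair (kpair q w) (kpair p v) \<in> elts R))"

lemma fst_proj_in_iff:
  assumes M: "pair_closed M" "C \<in> elts M" "R \<in> elts M" "C1 \<in> elts M" "R1 \<in> elts M"
  shows "fst_proj_in M C R C1 R1 \<longleftrightarrow> fst_proj C R C1 R1"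
proof -
  have T: "z \<in> elts M" if "z \<in> elts C \<or> z \<in> elts R \<or> z \<in> elts C1 \<or> z \<in> elts R1" for z
    using that M pair_closed_trans[OF M(1)] by metis
  have K: "x \<in> elts M" "y \<in> elts M"
    if "kpair x y \<in> elts C \<or> kpair x y \<in> elts R \<or> kpair x y \<in> elts C1 \<or> kpair x y \<in> elts R1" for x y
    using T[OF that] pair_closed_kpair[OF M(1)] by simp_all
  have K2: "x \<in> elts M" "y \<in> elts M" "x' \<in> elts M" "y' \<in> elts M"
    if "kpair (kpair x y) (kpair x' y') \<in> elts R" for x y x' y'
    using K[of "kpair x y" "kpair x' y'"] that pair_closed_kpair[OF M(1)] by simp_all
  have KC: "kpair x y \<in> elts C \<Longrightarrow> x \<in> elts M" "kpair x y \<in> elts C \<Longrightarrow> y \<in> elts M"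
    and KR1: "kpair x y \<in> elts R1 \<Longrightarrow> y \<in> elts M" for x y using K[of x y] by blast+
  define E where "E z \<longleftrightarrow> (\<exists>q p v w. z = kpair q p \<and> kpair (kpair q v) (kpair p w) \<in> elts R)" for z
  have 1: "(\<exists>q\<in>elts M. \<exists>p\<in>elts M. \<exists>v\<in>elts M. \<exists>w\<in>elts M.
      z = kpair q p \<and> kpair (kpair q v) (kpair p w) \<in> elts R) \<longleftrightarrow> E z" (is "?L \<longleftrightarrow> _") for z
    unfolding E_def
  proof
    assume "\<exists>q p v w. z = kpair q p \<and> kpair (kpair q v) (kpair p w) \<in> elts R"
    then obtain q p v w where z: "z = kpair q p" "kpair (kpair q v) (kpair p w) \<in> elts R"
      by (elim exE conjE)
    show ?L by (intro bexI conjI) (rule z K2[OF z(2)])+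
  qed blast
  have "z \<in> elts M" if Ez: "E z" for z
  proof -
    obtain q p v w where z: "z = kpair q p" "kpair (kpair q v) (kpair p w) \<in> elts R"
      using Ez unfolding E_def by (elim exE conjE)
    show ?thesis unfolding z(1) pair_closed_kpair[OF M(1)] using K2[OF z(2)] by simp
  qed
  then have 2: "(\<forall>z\<in>elts M. z \<in> elts R1 \<longleftrightarrow> E z) \<longleftrightarrow> (\<forall>z. z \<in> elts R1 \<longleftrightarrow> E z)" using T by blast
  show ?thesis unfolding fst_proj_in_def fst_proj_def 1 E_def[symmetric]
    by (intro arg_cong2[where f = "(\<and>)"] 2, use T K in metis, use T K in metis,
        (rule iffI; use KC KR1 in meson)+)
qed

definition proj_in :: "'v::zfc \<Rightarrow> 'v \<Rightarrow> 'v \<Rightarrow> bool" where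
  "proj_in M P Q \<longleftrightarrow> (\<exists>C\<in>elts M. \<exists>R\<in>elts M. \<exists>C1\<in>elts M. \<exists>R1\<in>elts M.
     P = kpair C R \<and> Q = kpair C1 R1 \<and> fst_proj_in M C R C1 R1)"

lemma definable_proj_in: "definable (\<lambda>M e. proj_in M (e i) (e j))"
  unfolding proj_in_def fst_proj_in_def by (intro definable_rules)

lemma proj_in_iff:
  assumes "pair_closed M" "P \<in> elts M" "Q \<in> elts M"
  shows "proj_in M P Q \<longleftrightarrow> P = kpair (carrier P) (order_rel P) \<and> Q = kpair (carrier Q) (order_rel Q) \<and>
     fst_proj (carrier P) (order_rel P) (carrier Q) (order_rel Q)"
proof
  assume "proj_in M P Q"
  then obtain C R C1 R1 where *: "P = kpair C R" "Q = kpair C1 R1" "fst_proj_in M C R C1 R1"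
    "C \<in> elts M" "R \<in> elts M" "C1 \<in> elts M" "R1 \<in> elts M" unfolding proj_in_def by metis
  then show "P = kpair (carrier P) (order_rel P) \<and> Q = kpair (carrier Q) (order_rel Q) \<and>
     fst_proj (carrier P) (order_rel P) (carrier Q) (order_rel Q)"
    using fst_proj_in_iff[OF assms(1) *(4-7)] by simp
next
  assume *: "P = kpair (carrier P) (order_rel P) \<and> Q = kpair (carrier Q) (order_rel Q) \<and>
     fst_proj (carrier P) (order_rel P) (carrier Q) (order_rel Q)"
  then have "carrier P \<in> elts M" "order_rel P \<in> elts M" "carrier Q \<in> elts M" "order_rel Q \<in> elts M"
    using pair_closed_kpair[OF assms(1)] assms(2,3) by metis+
  then show "proj_in M P Q" unfolding proj_in_def using * fst_proj_in_iff[OF assms(1)] by metis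
qed

section \<open>Infinity-subcompleteness\<close>

text \<open>What is required of the embedding \<open>s\<close> in the generic extension. The name \<open>G\<close> of the target filter is a
  parameter because the statement is also used in the larger poset with a name for the projected filter.\<close>

definition lifts :: "'v::zfc \<Rightarrow> 'v \<Rightarrow> 'v \<Rightarrow> 'v \<Rightarrow> 'v \<Rightarrow> 'v \<Rightarrow> 'v \<Rightarrow> 'v \<Rightarrow> 'v \<Rightarrow> 'v \<Rightarrow> 'v stmt" where
  "lifts PP N' B' N B S Y G' G s =
     Conj (elem_emb_stmt s (check PP N') (check PP B') (check PP N) (check PP B))
    (Conj (maps_stmt s (check PP S) (check PP Y))
          (AllIn (check PP G') (\<lambda>g. ExIn G (\<lambda>h. maps_stmt s g h))))"

definition subcomplete_at :: "'v::zfc \<Rightarrow> 'v \<Rightarrow> bool" where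
  "subcomplete_at PP \<theta> \<longleftrightarrow>
   (\<forall>\<tau> A N B. Ord \<tau> \<and> \<theta> \<in> elts \<tau> \<and>
          N = L_rel A \<tau> \<and> B = mkset (elts A \<inter> elts N) \<and>
          ZFC_minus N B \<and> elts (Hset \<theta>) \<subseteq> elts N \<longrightarrow>
         (\<forall>N' B' \<sigma> \<theta>' PP' G' s' S' Y.
            holds (elem_emb_stmt \<sigma> N' B' N B) \<and>
            countable (elts N') \<and> Transset N' \<and> full N' B' \<and>
            kpair (kpair \<theta>' PP') (kpair \<theta> PP) \<in> elts \<sigma> \<and>
            generic_over N' PP' G' \<and>
            s' \<in> elts N' \<and> S' = kpair s' (kpair \<theta>' PP') \<and> kpair S' Y \<in> elts \<sigma> \<longrightarrow>
           (\<exists>p\<in>elts (carrier PP).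
              p \<tturnstile>\<^bsub>PP\<^esub> Exists (lifts PP N' B' N B S' Y G' (generic_name PP)))))"

lemma infinity_SC_iff: "PP \<in> infinity_SC \<longleftrightarrow>
    forcing_notion PP \<and> (\<exists>\<theta>. Card \<theta> \<and> PP \<in> elts (Hset \<theta>) \<and> subcomplete_at PP \<theta>)"
  unfolding infinity_SC_def subcomplete_at_def lifts_def[abs_def] mem_Collect_eq ..

lemma elem_pairs_kpair:
  assumes "elem_pairs M A N B X" "pair_closed M" "pair_closed N"
    "\<And>x. x \<in> elts M \<Longrightarrow> \<exists>y. X x y" "X (kpair a b) y"
  shows "\<exists>a' b'. X a a' \<and> X b b' \<and> y = kpair a' b'"
proof -
  have d1: "definable (\<lambda>M e. \<exists>w\<in>elts M. e 0 = kpair (e (Suc 0)) w)"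
    and d2: "definable (\<lambda>M e. \<exists>w\<in>elts M. e 0 = kpair w (e (Suc 0)))" by (intro definable_rules)+
  have "kpair a b \<in> elts M" using assms(1,5) unfolding elem_pairs_def by metis
  then have ab: "a \<in> elts M" "b \<in> elts M" using pair_closed_kpair[OF assms(2)] by metis+
  obtain a' b' where X: "X a a'" "X b b'" using assms(4) ab by metis
  have "\<exists>w\<in>elts N. y = kpair a' w"
    using elem_pairs_definable2[OF assms(1-3) d1 assms(5) X(1)] ab by metis
  moreover have "\<exists>w\<in>elts N. y = kpair w b'"
    using elem_pairs_definable2[OF assms(1-3) d2 assms(5) X(2)] ab by metis
  ultimately have "y = kpair a' b'" by auto
  then show ?thesis using X by metis
qed

text \<open>The range of an elementary map contains whatever is definable from its elements: the existence of a
  solution \<open>a\<close> is reflected to the smaller structure, and uniqueness identifies the image of \<open>a\<close>.\<close>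

lemma elem_pairs_definable_preimage:
  assumes "elem_pairs M A N B X" "pair_closed M" "pair_closed N"
    "\<And>x. x \<in> elts M \<Longrightarrow> \<exists>y. X x y"
    "definable (\<lambda>M e. P M (e 0) (e (Suc 0)))" "definable (\<lambda>M e. \<exists>x\<in>elts M. P M x (e 0))"
    "X p q" "b \<in> elts N" "P N b q" "\<And>x. x \<in> elts N \<Longrightarrow> P N x q \<Longrightarrow> x = b"
  shows "\<exists>a. X a b \<and> P M a p"
proof -
  have "(\<exists>x\<in>elts M. P M x p) \<longleftrightarrow> (\<exists>x\<in>elts N. P N x q)"
    using elem_pairs_definable2[OF assms(1-3), where P = "\<lambda>M a c. \<exists>x\<in>elts M. P M x a", OF assms(6,7,7)] .
  then obtain a where a: "a \<in> elts M" "P M a p" using assms(8,9) by blast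
  then obtain y where y: "X a y" using assms(4) by metis
  then have "P N y q" using elem_pairs_definable2[OF assms(1-3,5) y assms(7)] a(2) by metis
  moreover have "y \<in> elts N" using y assms(1) unfolding elem_pairs_def by metis
  ultimately show ?thesis using assms(10) a(2) y by metis
qed

text \<open>A dense set of \<open>Q\<close> pulls back to a dense set of \<open>P\<close>, by the lifting clause of \<open>fst_proj\<close>, and the
  preimage belongs to \<open>N\<close> by separation.\<close>

lemma generic_over_projection:
  assumes G: "generic_over N P G" and N: "ZFC_minus N B" "P \<in> elts N" "Q \<in> elts N"
    and p: "P = kpair C R" "Q = kpair C1 R1" "fst_proj C R C1 R1"
  shows "generic_over N Q (mkset (carrier ` elts G))"
proof -
  have pc: "pair_closed N" using ZFC_minus_pair_closed N(1) by metis
  note pC = fst_projD(1)[OF p(3)] and pC1 = fst_projD(2)[OF p(3)]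
    and plift = fst_projD(4)[OF p(3)] and pup = fst_projD(5)[OF p(3)]
  have pR1: "kpair q p \<in> elts R1" if "kpair (kpair q v) (kpair p w) \<in> elts R" for q p v w
    using fst_projD(3)[OF p(3), THEN iffD2] that by blast
  have eG: "elts (mkset (carrier ` elts G)) = carrier ` elts G" by (intro elts_mkset small_image small_elts)
  note g = G[unfolded generic_over_def le_def p(1) carrier_kpair order_rel_kpair]
  note GC = g[THEN conjunct1] and Gne = g[THEN conjunct2, THEN conjunct1]
    and Gup = g[THEN conjunct2, THEN conjunct2, THEN conjunct1]
    and Gdir = g[THEN conjunct2, THEN conjunct2, THEN conjunct2, THEN conjunct1]
    and Gd = g[THEN conjunct2, THEN conjunct2, THEN conjunct2, THEN conjunct2]
  have Gp: "\<exists>q w. g = kpair q w" if "g \<in> elts G" for g using pC that GC by blast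
  show ?thesis
    unfolding generic_over_def le_def p(2) carrier_kpair order_rel_kpair eG
  proof (intro conjI ballI impI)
    show "carrier ` elts G \<subseteq> elts C1"
    proof (rule image_subsetI)
      fix g assume g: "g \<in> elts G"
      then obtain q w where "g = kpair q w" using Gp by metis
      then show "carrier g \<in> elts C1" using g GC pC1 by auto
    qed
    show "carrier ` elts G \<noteq> {}" using Gne by simp
  next
    fix g1 q assume "g1 \<in> carrier ` elts G" and q: "q \<in> elts C1" "kpair g1 q \<in> elts R1"
    then obtain w where g: "kpair g1 w \<in> elts G" using Gp by force
    then obtain v where "kpair q v \<in> elts C" "kpair (kpair g1 w) (kpair q v) \<in> elts R"
      using pup[OF q(2), of w] GC by blast
    then have "kpair q v \<in> elts G" using Gup g by blast
    then show "q \<in> carrier ` elts G" by (rule rev_image_eqI) simp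
  next
    fix g1 g2 assume "g1 \<in> carrier ` elts G" "g2 \<in> carrier ` elts G"
    then obtain v w where g: "kpair g1 v \<in> elts G" "kpair g2 w \<in> elts G" using Gp by force
    then obtain r where r: "r \<in> elts G" "kpair r (kpair g1 v) \<in> elts R" "kpair r (kpair g2 w) \<in> elts R"
      using Gdir by blast
    then obtain q u where q: "r = kpair q u" using Gp by metis
    show "\<exists>r\<in>carrier ` elts G. kpair r g1 \<in> elts R1 \<and> kpair r g2 \<in> elts R1"
      using r q pR1 by (intro bexI[of _ q] conjI) (auto intro: rev_image_eqI)
  next
    fix D assume D: "D \<in> elts N" and dense: "elts D \<subseteq> elts C1 \<and> (\<forall>p\<in>elts C1. \<exists>d\<in>elts D. kpair d p \<in> elts R1)"
    have CN: "C \<in> elts N" using pair_closed_kpair[OF pc] N(2) p(1) by metis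
    have df: "definable (\<lambda>M e. \<exists>q\<in>elts M. \<exists>w\<in>elts M. e 0 = kpair q w \<and> q \<in> elts (e (Suc 0)))"
      by (intro definable_rules)
    obtain E where E: "E \<in> elts N"
      "elts E = {x \<in> elts C. \<exists>q\<in>elts N. \<exists>w\<in>elts N. x = kpair q w \<and> q \<in> elts D}"
      using ZFC_minus_separation[OF N(1) df, of "\<lambda>_. D" C] D CN by auto
    have EI: "kpair q w \<in> elts E" if "kpair q w \<in> elts C" "q \<in> elts D" for q w
    proof -
      have "kpair q w \<in> elts N" using pair_closed_trans[OF pc that(1) CN] .
      then show ?thesis unfolding E(2) using that pair_closed_kpair[OF pc] by blast
    qed
    have "\<exists>d\<in>elts E. kpair d z \<in> elts R" if z: "z \<in> elts C" for z
    proof -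
      obtain q v where q: "z = kpair q v" using pC z by metis
      then have "q \<in> elts C1" using pC1 z by metis
      then obtain d where d: "d \<in> elts D" "kpair d q \<in> elts R1" using dense by blast
      then obtain w where w: "kpair d w \<in> elts C" using dense pC1 by blast
      from plift[OF w z[unfolded q] d(2)] obtain u where
        "kpair d u \<in> elts C" "kpair (kpair d u) (kpair q v) \<in> elts R" by blast
      then show ?thesis using EI d(1) q by metis
    qed
    moreover have "elts E \<subseteq> elts C" unfolding E(2) by simp
    ultimately obtain g where g: "g \<in> elts G" "g \<in> elts E" using Gd E(1) by blast
    then obtain q w where "g = kpair q w" "q \<in> elts D" unfolding E(2) by auto
    then show "carrier ` elts G \<inter> elts D \<noteq> {}" using g(1) by force
  qed
qed

locale fst_projection = projection PP QQ carrier for PP QQ :: "'v::zfc" +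
  assumes PP_kpair: "PP = kpair (carrier PP) (order_rel PP)"
    and QQ_kpair: "QQ = kpair (carrier QQ) (order_rel QQ)"
    and fst_proj: "fst_proj (carrier PP) (order_rel PP) (carrier QQ) (order_rel QQ)"
begin

text \<open>The step inside the generic extension: an embedding that maps \<open>G1\<close>, the projection of \<open>G'\<close>,
  into the projected generic filter maps \<open>G'\<close> into the generic filter, because membership in the
  latter depends on first coordinates only.\<close>

lemma forces_lift:
  assumes N: "pair_closed N" "pair_closed N'" "QQ \<in> elts N"
    and P': "P' = kpair C' R'" "elts G' \<subseteq> elts C'"
    and fst: "\<And>g. g \<in> elts G' \<Longrightarrow> \<exists>q w. g = kpair q w"
    and G1: "elts G1 = carrier ` elts G'"
    and S1: "S1 = kpair (kpair s' (kpair \<theta>' P')) z" "S1 \<in> elts N'"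
    and Y1: "Y1 = kpair (kpair y (kpair \<theta> PP)) z'" "Y1 \<in> elts N"
    and p0: "p0 \<in> elts (carrier PP)" and s: "is_name PP s"
    and emb: "p0 \<tturnstile>\<^bsub>PP\<^esub> elem_emb_stmt s (check PP N') (check PP B') (check PP N) (check PP B)"
    and maps: "p0 \<tturnstile>\<^bsub>PP\<^esub> maps_stmt s (check PP S1) (check PP Y1)"
    and G: "p0 \<tturnstile>\<^bsub>PP\<^esub> AllIn (check PP G1) (\<lambda>g. ExIn proj_name (\<lambda>h. maps_stmt s g h))"
  shows "p0 \<tturnstile>\<^bsub>PP\<^esub> maps_stmt s (check PP (kpair s' (kpair \<theta>' P'))) (check PP (kpair y (kpair \<theta> PP)))"
    and "p0 \<tturnstile>\<^bsub>PP\<^esub> AllIn (check PP G') (\<lambda>g. ExIn (generic_name PP) (\<lambda>h. maps_stmt s g h))"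
proof -
  define X where "X r x y \<longleftrightarrow> x \<in> elts N' \<and> y \<in> elts N \<and> r \<tturnstile>\<^bsub>PP\<^esub> maps_stmt s (check PP x) (check PP y)" for r x y
  have el: "elem_pairs N' B' N B (X r)" if "le PP r p0" for r
    using P.forces_elem_emb(1)[OF P.le_carrier(1)[OF that] s P.forces_mono[OF emb that]]
    unfolding X_def[abs_def] .
  have tot: "\<exists>y r. le PP r q \<and> X r x y" if "x \<in> elts N'" "le PP q p0" for x q
    using P.forces_elem_emb(2)[OF p0 s emb that] unfolding X_def .
  have Xmono: "X q x y" if "X r x y" "le PP q r" for q r x y
    using that P.forces_mono unfolding X_def by metis
  have d1: "definable (\<lambda>M e. \<exists>w\<in>elts M. e 0 = kpair (e (Suc 0)) w)"
    and d2: "definable (\<lambda>M e. \<exists>b\<in>elts M. \<exists>c\<in>elts M. \<exists>d\<in>elts M. e 0 = kpair b c \<and> c = kpair d (e (Suc 0)))"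
    and d3: "definable (\<lambda>M e. \<exists>c\<in>elts M. \<exists>r\<in>elts M. e 0 = kpair c r \<and> e (Suc 0) \<in> elts c)"
    by (intro definable_rules)+
  let ?S = "kpair s' (kpair \<theta>' P')" and ?Y = "kpair y (kpair \<theta> PP)"
  have N'k: "kpair a b \<in> elts N' \<longleftrightarrow> a \<in> elts N' \<and> b \<in> elts N'" for a b by (rule pair_closed_kpair[OF N(2)])
  have SN: "z \<in> elts N'" "?S \<in> elts N'" using S1 N'k by metis+
  have PN: "P' \<in> elts N'" "\<theta>' \<in> elts N'" "s' \<in> elts N'" "kpair \<theta>' P' \<in> elts N'" using SN(2) N'k by metis+
  have CN: "C' \<in> elts N'" "R' \<in> elts N'" using PN(1) P'(1) N'k by metis+
  have X0: "X p0 S1 Y1" unfolding X_def using S1(2) Y1(2) maps by simp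
  have first: "\<exists>w\<in>elts N. b = kpair d w" if "le PP r p0" "X r (kpair c w) b" "X r c d" "kpair c w \<in> elts N'" for r b c d w
  proof -
    have "w \<in> elts N'" using that(4) N'k by metis
    then show ?thesis using elem_pairs_definable2[OF el[OF that(1)] N(2,1) d1 that(2,3)] by blast
  qed
  have XS: "\<exists>r. le PP r q \<and> X r ?S ?Y" if q: "le PP q p0" for q
  proof -
    obtain y' r where r: "le PP r q" "X r ?S y'" using tot[OF SN(2) q] by metis
    have rp: "le PP r p0" using P.le_trans[OF r(1) q] .
    have "\<exists>w\<in>elts N. Y1 = kpair y' w"
      using first[OF rp _ r(2)] Xmono[OF X0 rp] S1 by metis
    then have "y' = ?Y" using Y1(1) by auto
    then show ?thesis using r by metis
  qed
  show "p0 \<tturnstile>\<^bsub>PP\<^esub> maps_stmt s (check PP ?S) (check PP ?Y)"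
    by (rule P.forces_dense) (use XS in \<open>unfold X_def, metis\<close>)
  have XP: "\<exists>r. le PP r q \<and> X r P' PP" if q: "le PP q p0" for q
  proof -
    obtain r where r: "le PP r q" "X r ?S ?Y" using XS[OF q] by metis
    have rp: "le PP r p0" using P.le_trans[OF r(1) q] .
    obtain P'' r' where r': "le PP r' r" "X r' P' P''" using tot[OF PN(1) rp] by metis
    have "\<exists>b\<in>elts N'. \<exists>c\<in>elts N'. \<exists>d\<in>elts N'. ?S = kpair b c \<and> c = kpair d P'" using PN by blast
    then have "\<exists>b\<in>elts N. \<exists>c\<in>elts N. \<exists>d\<in>elts N. ?Y = kpair b c \<and> c = kpair d P''"
      using elem_pairs_definable2[OF el[OF P.le_trans[OF r'(1) rp]] N(2,1) d2 Xmono[OF r(2) r'(1)] r'(2)] by metis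
    then have "P'' = PP" by auto
    then show ?thesis using r' r(1) P.le_trans by metis
  qed
  have main: "\<exists>r h. le PP r q \<and> forces_mem PP (check PP h) (generic_name PP) r \<and>
      r \<tturnstile>\<^bsub>PP\<^esub> maps_stmt s (check PP g) (check PP h)" if g: "g \<in> elts G'" and q: "le PP q p0" for g q
  proof -
    have gC: "g \<in> elts C'" using g P'(2) by auto
    then have gN: "g \<in> elts N'" using pair_closed_trans[OF N(2) _ CN(1)] by metis
    obtain g1 w where gw: "g = kpair g1 w" using fst[OF g] by metis
    have g1N: "g1 \<in> elts N'" "w \<in> elts N'" using gN gw N'k by metis+
    have "g1 \<in> elts G1" unfolding G1 using g gw by (auto intro: rev_image_eqI)
    from P.forces_AllIn_check[OF G this q]
    have "q \<tturnstile>\<^bsub>PP\<^esub> ExIn proj_name (\<lambda>h. maps_stmt s (check PP g1) h)" .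
    note E = this[unfolded P.forces_ExIn, rule_format, OF P.le_refl[OF P.le_carrier(1)[OF q]]]
    obtain q1 h where h: "le PP q1 q" "is_name PP h" "forces_mem PP h proj_name q1"
      "q1 \<tturnstile>\<^bsub>PP\<^esub> maps_stmt s (check PP g1) h" using E by (elim exE conjE)
    obtain d t0 q2 where d: "(d, t0) \<in> pairs proj_name" "le PP q2 q1" "le PP q2 t0" "forces_eq PP h d q2"
      using h(3)[unfolded P.forces_mem_iff, rule_format, OF P.le_refl[OF P.le_carrier(1)[OF h(1)]]] by (rule P.nearE)
    have t0: "t0 \<in> elts (carrier PP)" "d = check PP (carrier t0)"
      using d(1) unfolding pairs_def elts_proj_name by auto
    have q2: "le PP q2 p0" using P.le_trans P.le_trans[OF d(2) h(1)] q by metis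
    have "q2 \<tturnstile>\<^bsub>PP\<^esub> maps_stmt s (check PP g1) h \<longleftrightarrow> q2 \<tturnstile>\<^bsub>PP\<^esub> maps_stmt s (check PP g1) d"
      by (rule P.forces_cong[OF stmt_rel_maps P.le_refl[OF P.le_carrier(1)[OF q2]]])
        (use d(4) P.forces_eq_refl in auto)
    then have "q2 \<tturnstile>\<^bsub>PP\<^esub> maps_stmt s (check PP g1) (check PP (carrier t0))"
      using P.forces_mono[OF h(4) d(2)] t0(2) by metis
    moreover have "carrier t0 \<in> elts N"
    proof -
      have "carrier QQ \<in> elts N" using pair_closed_kpair[OF N(1)] N(3) QQ_kpair by metis
      then show ?thesis using pair_closed_trans[OF N(1) pr_carrier[OF t0(1)]] by metis
    qed
    ultimately have X1: "X q2 g1 (carrier t0)" unfolding X_def using g1N by simp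
    obtain q3 where q3: "le PP q3 q2" "X q3 P' PP" using XP[OF q2] by metis
    have q3p: "le PP q3 p0" using P.le_trans[OF q3(1) q2] .
    obtain h0 q4 where q4: "le PP q4 q3" "X q4 g h0" using tot[OF gN q3p] by metis
    have q4p: "le PP q4 p0" using P.le_trans[OF q4(1) q3p] .
    have "X q4 (kpair g1 w) h0" "X q4 g1 (carrier t0)" "kpair g1 w \<in> elts N'"
      using q4(2) gw Xmono[OF Xmono[OF X1 q3(1)] q4(1)] gN by simp_all
    then obtain w' where w': "h0 = kpair (carrier t0) w'" using first[OF q4p] by blast
    have "\<exists>c\<in>elts N'. \<exists>r\<in>elts N'. P' = kpair c r \<and> g \<in> elts c" using P'(1) CN gC by blast
    then have "\<exists>c\<in>elts N. \<exists>r\<in>elts N. PP = kpair c r \<and> h0 \<in> elts c"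
      using elem_pairs_definable2[OF el[OF q4p] N(2,1) d3 Xmono[OF q3(2) q4(1)] q4(2)] by metis
    then have h0: "h0 \<in> elts (carrier PP)" by auto
    have q4t: "le PP q4 t0" using P.le_trans[OF P.le_trans[OF q4(1) q3(1)] d(3)] .
    then have "le QQ (carrier q4) (carrier h0)" using pr_mono w' by simp
    then obtain q5 where q5: "le PP q5 q4" "le PP q5 h0"
      using pr_lift[OF P.le_carrier(1)[OF q4p] h0] by metis
    have "forces_mem PP (check PP h0) (generic_name PP) q5"
      unfolding P.forces_mem_iff
    proof (intro allI impI)
      fix r assume r: "le PP r q5"
      have "(check PP h0, h0) \<in> pairs (generic_name PP)" unfolding pairs_def elts_generic_name using h0 by auto
      then show "P.near (check PP h0) (generic_name PP) r"
        by (rule P.nearI[OF _ P.le_refl[OF P.le_carrier(1)[OF r]] P.le_trans[OF r q5(2)] P.forces_eq_refl])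
    qed
    moreover have "q5 \<tturnstile>\<^bsub>PP\<^esub> maps_stmt s (check PP g) (check PP h0)"
      using Xmono[OF q4(2) q5(1)] unfolding X_def by simp
    moreover have "le PP q5 q"
      using P.le_trans[OF q5(1) P.le_trans[OF q4(1) P.le_trans[OF q3(1) P.le_trans[OF d(2) h(1)]]]] .
    ultimately show ?thesis by metis
  qed
  show "p0 \<tturnstile>\<^bsub>PP\<^esub> AllIn (check PP G') (\<lambda>g. ExIn (generic_name PP) (\<lambda>h. maps_stmt s g h))"
    unfolding P.forces_AllIn P.forces_ExIn
  proof (intro allI impI)
    fix g q r assume g: "forces_mem PP g (check PP G') q" "le PP q p0" "le PP r q"
    obtain g0 r1 where g0: "g0 \<in> elts G'" "le PP r1 r" "forces_eq PP g (check PP g0) r1"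
      using P.forces_mem_checkD[OF g(1,3)] by metis
    have "le PP r1 p0" using P.le_trans[OF g0(2) P.le_trans[OF g(3,2)]] .
    then obtain r2 h where h: "le PP r2 r1" "forces_mem PP (check PP h) (generic_name PP) r2"
      "r2 \<tturnstile>\<^bsub>PP\<^esub> maps_stmt s (check PP g0) (check PP h)" using main[OF g0(1)] by metis
    have "r2 \<tturnstile>\<^bsub>PP\<^esub> maps_stmt s g (check PP h) \<longleftrightarrow> r2 \<tturnstile>\<^bsub>PP\<^esub> maps_stmt s (check PP g0) (check PP h)"
      by (rule P.forces_cong[OF stmt_rel_maps P.le_refl[OF P.le_carrier(1)[OF h(1)]]])
        (use P.forces_eq_mono[OF g0(3) h(1)] P.forces_eq_refl in auto)
    then have "r2 \<tturnstile>\<^bsub>PP\<^esub> maps_stmt s g (check PP h)" using h(3) by simp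
    moreover have "le PP r2 r" using P.le_trans[OF h(1) g0(2)] .
    ultimately show "\<exists>r' x. le PP r' r \<and> is_name PP x \<and> forces_mem PP x (generic_name PP) r' \<and>
        r' \<tturnstile>\<^bsub>PP\<^esub> maps_stmt s g x"
      using h(2) is_name_check by metis
  qed
qed

text \<open>If \<open>\<theta>\<close> verifies the subcompleteness of \<open>QQ\<close> then \<open>csucc \<theta>\<close> verifies that of \<open>PP\<close>: both \<open>\<theta>\<close> and \<open>QQ\<close>
  are definable from \<open>csucc \<theta>\<close> and \<open>PP\<close>, hence have preimages \<open>\<theta>b\<close> and \<open>Qb\<close>; the generic filter over the
  countable model projects to a filter \<open>G1\<close> that is generic for \<open>Qb\<close>; and the embedding supplied by \<open>QQ\<close>
  for \<open>G1\<close> is as required, by \<open>forces_lift\<close>. The parameter for \<open>QQ\<close> is the whole tuple \<open>S'\<close>, so that the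
  embedding moves it as \<open>\<sigma>\<close> does.\<close>

lemma infinity_SC_lift:
  assumes QSC: "QQ \<in> infinity_SC"
    and size: "\<And>\<theta>. Card \<theta> \<Longrightarrow> QQ \<in> elts (Hset \<theta>) \<Longrightarrow> infinite (elts \<theta>) \<and> PP \<in> elts (Hset (csucc \<theta>))"
  shows "PP \<in> infinity_SC"
proof -
  obtain \<theta> where \<theta>: "Card \<theta>" "QQ \<in> elts (Hset \<theta>)"
    and spec: "subcomplete_at QQ \<theta>"
    using QSC unfolding infinity_SC_iff by (elim conjE exE)
  have inf: "infinite (elts \<theta>)" and PH: "PP \<in> elts (Hset (csucc \<theta>))" using size[OF \<theta>] by simp_all
  have O: "Ord \<theta>" using \<theta>(1) unfolding Card_def by simp
  have HH: "elts (Hset \<theta>) \<subseteq> elts (Hset (csucc \<theta>))"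
    using Hset_hered hered_Hset[OF O] by auto
  show ?thesis unfolding infinity_SC_iff
  proof (rule conjI[OF P.forcing_notion], rule exI[of _ "csucc \<theta>"], rule conjI[OF Card_csucc],
      rule conjI[OF PH], unfold subcomplete_at_def, intro allI impI, (elim conjE)+)
    fix \<tau> A N B N' B' \<sigma> \<theta>' P' G' s' S' Y
    assume tau: "Ord \<tau>" "csucc \<theta> \<in> elts \<tau>" and NB: "N = L_rel A \<tau>" "B = mkset (elts A \<inter> elts N)"
      and N: "ZFC_minus N B" "elts (Hset (csucc \<theta>)) \<subseteq> elts N"
      and emb: "holds (elem_emb_stmt \<sigma> N' B' N B)" and N': "countable (elts N')" "Transset N'" "full N' B'"
      and sP: "kpair (kpair \<theta>' P') (kpair (csucc \<theta>) PP) \<in> elts \<sigma>"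
      and G': "generic_over N' P' G'" and s': "s' \<in> elts N'" and S': "S' = kpair s' (kpair \<theta>' P')"
      and SY: "kpair S' Y \<in> elts \<sigma>"
    let ?X = "\<lambda>x y. kpair x y \<in> elts \<sigma>"
    note el = holds_elem_emb(1)[OF emb] and tot = holds_elem_emb(2)[OF emb]
    have ZN': "ZFC_minus N' B'" using N'(3) unfolding full_def by simp
    have pN: "pair_closed N" and pN': "pair_closed N'" using ZFC_minus_pair_closed N(1) ZN' by metis+
    have split: "\<exists>a' b'. ?X a a' \<and> ?X b b' \<and> y = kpair a' b'" if "?X (kpair a b) y" for a b y
      using tot that by (rule elem_pairs_kpair[OF el pN' pN])
    have XM: "x \<in> elts N' \<and> y \<in> elts N" if "?X x y" for x y using el that unfolding elem_pairs_def by metis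
    obtain X1: "?X \<theta>' (csucc \<theta>)" and X2: "?X P' PP" using split[OF sP] by auto
    have QN: "QQ \<in> elts N" using \<theta>(2) HH N(2) by auto
    have \<theta>N: "\<theta> \<in> elts N" using pair_closed_trans[OF pN in_csucc[OF O]] XM[OF X1] by metis
    have cp: "card_pred N x (csucc \<theta>) \<longleftrightarrow> x = \<theta>" for x
      using card_pred_csucc[OF pN _ N(2) \<theta>(1) inf] XM[OF X1] by metis
    have "\<exists>a. ?X a \<theta> \<and> card_pred N' a \<theta>'"
    proof (rule elem_pairs_definable_preimage[OF el pN' pN _ _ _ X1 \<theta>N])
      show "\<exists>y. ?X x y" if "x \<in> elts N'" for x using tot that .
      show "definable (\<lambda>M e. card_pred M (e 0) (e (Suc 0)))" by (rule definable_card_pred)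
      show "definable (\<lambda>M e. \<exists>x\<in>elts M. card_pred M x (e 0))"
        by (intro definable_ex definable_card_pred)
    qed (simp_all add: cp)
    then obtain \<theta>b where \<theta>b: "?X \<theta>b \<theta>" by auto
    have pj: "proj_in N PP x \<longleftrightarrow> x = QQ" if "x \<in> elts N" for x
    proof -
      have PN: "PP \<in> elts N" using XM[OF X2] by simp
      show ?thesis
      proof
        assume "proj_in N PP x"
        then have "x = kpair (carrier x) (order_rel x)"
          "fst_proj (carrier PP) (order_rel PP) (carrier x) (order_rel x)"
          using proj_in_iff[OF pN PN that] by metis+
        then show "x = QQ" using fst_proj_unique[OF fst_proj] QQ_kpair by metis
      next
        assume "x = QQ"
        then show "proj_in N PP x" using proj_in_iff[OF pN PN QN] PP_kpair QQ_kpair fst_proj by metis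
      qed
    qed
    have "\<exists>a. ?X a QQ \<and> proj_in N' P' a"
    proof (rule elem_pairs_definable_preimage[OF el pN' pN _ _ _ X2 QN, where P = "\<lambda>M x p. proj_in M p x"])
      show "\<exists>y. ?X x y" if "x \<in> elts N'" for x using tot that .
      show "definable (\<lambda>M e. proj_in M (e (Suc 0)) (e 0))" by (rule definable_proj_in)
      show "definable (\<lambda>M e. \<exists>x\<in>elts M. proj_in M (e 0) x)"
        by (intro definable_ex definable_proj_in)
    qed (simp_all add: pj QN)
    then obtain Qb where Qb: "?X Qb QQ" "proj_in N' P' Qb" by auto
    have PN': "P' \<in> elts N'" "Qb \<in> elts N'" using XM[OF X2] XM[OF Qb(1)] by simp_all
    note pb = Qb(2)[unfolded proj_in_iff[OF pN' PN']]
    define G1 where "G1 = mkset (carrier ` elts G')"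
    have G1: "elts G1 = carrier ` elts G'" unfolding G1_def by (intro elts_mkset small_image small_elts)
    have gen: "generic_over N' Qb G1" unfolding G1_def
      by (rule generic_over_projection[OF G' ZN' PN' pb[THEN conjunct1]
          pb[THEN conjunct2, THEN conjunct1] pb[THEN conjunct2, THEN conjunct2]])
    define S1 where "S1 = kpair S' (kpair \<theta>b Qb)"
    have S'N: "S' \<in> elts N'" using XM[OF SY] by simp
    have S1N: "S1 \<in> elts N'" unfolding S1_def
      using pair_closed_kpair[OF pN'] S'N XM[OF \<theta>b] XM[OF Qb(1)] by simp
    obtain k where k: "?X (kpair \<theta>b Qb) k" using tot pair_closed_kpair[OF pN'] XM[OF \<theta>b] XM[OF Qb(1)] by metis
    obtain Y1 where Y1: "?X S1 Y1" using tot S1N by metis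
    have func: "y = z" if "?X x y" "?X x z" for x y z
    proof -
      have "definable (\<lambda>M e. e 0 = e (Suc 0))" by (rule definable_eq)
      from elem_pairs_definable2[OF el pN' pN, where P = "\<lambda>M a b. a = b", OF this that]
      show ?thesis by simp
    qed
    have Y1eq: "\<exists>z. Y1 = kpair Y z" using split[OF Y1[unfolded S1_def]] func[OF SY] by metis
    have keq: "k = kpair \<theta> QQ" using split[OF k] func[OF \<theta>b] func[OF Qb(1)] by metis
    have Yeq: "\<exists>y. Y = kpair y (kpair (csucc \<theta>) PP)"
      using split[OF SY[unfolded S']] func[OF sP] by metis
    have tau\<theta>: "\<theta> \<in> elts \<tau>" using Ord_trans[OF tau(1) in_csucc[OF O] tau(2)] .
    have HN: "elts (Hset \<theta>) \<subseteq> elts N" using HH N(2) by auto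
    have c1: "Ord \<tau> \<and> \<theta> \<in> elts \<tau> \<and> N = L_rel A \<tau> \<and> B = mkset (elts A \<inter> elts N) \<and>
        ZFC_minus N B \<and> elts (Hset \<theta>) \<subseteq> elts N"
      by (intro conjI tau(1) tau\<theta> NB N(1) HN)
    have c2: "holds (elem_emb_stmt \<sigma> N' B' N B) \<and> countable (elts N') \<and> Transset N' \<and> full N' B' \<and>
        kpair (kpair \<theta>b Qb) (kpair \<theta> QQ) \<in> elts \<sigma> \<and> generic_over N' Qb G1 \<and>
        S' \<in> elts N' \<and> S1 = kpair S' (kpair \<theta>b Qb) \<and> kpair S1 Y1 \<in> elts \<sigma>"
      by (intro conjI emb N' k[unfolded keq] gen S'N S1_def Y1)
    obtain q where q: "q \<in> elts (carrier QQ)" and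
      qf: "q \<tturnstile>\<^bsub>QQ\<^esub> Exists (lifts QQ N' B' N B S1 Y1 G1 (generic_name QQ))"
      using spec[unfolded subcomplete_at_def, rule_format, OF c1 c2] by (rule bexE)
    obtain p where p: "p \<in> elts (carrier PP)" "carrier p = q" using pr_surj[OF q] by metis
    have Unm: "\<And>x y. is_name PP x \<and> y = t x \<Longrightarrow> y = t x" by simp
    have "p \<tturnstile>\<^bsub>PP\<^esub> Exists (lifts PP N' B' N B S1 Y1 G1 proj_name)"
      (is "p \<tturnstile>\<^bsub>PP\<^esub> ?\<phi>")
      using qf[folded p(2)]
    proof (rule forces_t[THEN iffD2, rotated 2])
      show "stmt_rel (\<lambda>x y. is_name PP x \<and> y = t x) (\<lambda>x y. y = t x) ?\<phi> (Exists (lifts QQ N' B' N B S1 Y1 G1 (generic_name QQ)))"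
        unfolding lifts_def[abs_def]
        by (intro stmt_rel_Exists[OF Unm] stmt_rel.Conj stmt_rel_elem_emb[OF Unm] stmt_rel_maps[OF Unm]
            stmt_rel_AllIn[OF Unm] stmt_rel_ExIn[OF Unm]) (simp_all add: t_check t_proj_name)
    qed (rule p(1))
    note pf = this
    have Pb: "P' = kpair (carrier P') (order_rel P')" using pb by simp
    have GC: "elts G' \<subseteq> elts (carrier P')" using G' unfolding generic_over_def by simp
    have Gp: "\<exists>q w. g = kpair q w" if "g \<in> elts G'" for g
      using fst_projD(1) pb GC that by blast
    obtain y z where Y: "Y = kpair y (kpair (csucc \<theta>) PP)" and Y1': "Y1 = kpair (kpair y (kpair (csucc \<theta>) PP)) z"
      using Y1eq Yeq by metis
    have lift: "r \<tturnstile>\<^bsub>PP\<^esub> lifts PP N' B' N B S' Y G' (generic_name PP) s"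
      if s: "is_name PP s" and r: "le PP r q" and
        f: "r \<tturnstile>\<^bsub>PP\<^esub> lifts PP N' B' N B S1 Y1 G1 proj_name s" for q r s
    proof -
      have rc: "r \<in> elts (carrier PP)" using P.le_carrier[OF r] by simp
      have f1: "r \<tturnstile>\<^bsub>PP\<^esub> elem_emb_stmt s (check PP N') (check PP B') (check PP N) (check PP B)"
        and f2: "r \<tturnstile>\<^bsub>PP\<^esub> maps_stmt s (check PP S1) (check PP Y1)"
        and f3: "r \<tturnstile>\<^bsub>PP\<^esub> AllIn (check PP G1) (\<lambda>g. ExIn proj_name (\<lambda>h. maps_stmt s g h))"
        using f unfolding lifts_def by simp_all
      have Y1N: "Y1 \<in> elts N" using XM[OF Y1] by simp
      note L = forces_lift[OF pN pN' QN Pb GC Gp G1 S1_def[unfolded S'] S1N Y1' Y1N rc s f1 f2 f3]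
      show ?thesis unfolding lifts_def forces_stmt.simps S' Y using f1 L by blast
    qed
    have "p \<tturnstile>\<^bsub>PP\<^esub> Exists (lifts PP N' B' N B S' Y G' (generic_name PP))"
      unfolding P.forces_Exists
    proof (intro allI impI)
      fix q assume "le PP q p"
      then obtain r s where "le PP r q" "is_name PP s"
        "r \<tturnstile>\<^bsub>PP\<^esub> lifts PP N' B' N B S1 Y1 G1 proj_name s"
        using pf[unfolded P.forces_Exists, rule_format] by blast
      then show "\<exists>r s. le PP r q \<and> is_name PP s \<and>
          r \<tturnstile>\<^bsub>PP\<^esub> lifts PP N' B' N B S' Y G' (generic_name PP) s"
        using lift by (intro exI conjI)
    qed
    then show "\<exists>p\<in>elts (carrier PP).
              p \<tturnstile>\<^bsub>PP\<^esub> Exists (lifts PP N' B' N B S' Y G' (generic_name PP))"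
      using p(1) by (rule bexI)
  qed
qed

end

section \<open>From diagonal reflection to reflection\<close>

context dsrp_setup
begin

lemma fst_projection:
  assumes "forcing_notion QQ" shows "fst_projection PP QQ"
proof -
  interpret P: forcing PP by unfold_locales (rule forcing_notion_PP[OF assms])
  interpret Q: forcing QQ by unfold_locales (rule assms)
  note pC = fst_projD(1)[OF fst_proj] and pC1 = fst_projD(2)[OF fst_proj] and plift = fst_projD(4)[OF fst_proj]
  have pR1: "kpair q p \<in> elts (order_rel QQ)" if "kpair (kpair q v) (kpair p w) \<in> elts (order_rel PP)" for q p v w
    using fst_projD(3)[OF fst_proj, THEN iffD2] that by blast
  show ?thesis
  proof unfold_locales
    show "carrier p \<in> elts (carrier QQ)" if p: "p \<in> elts (carrier PP)" for p
    proof -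
      obtain q w where "p = kpair q w" using pC[OF p] by metis
      then show ?thesis using p pC1 by auto
    qed
    show "\<exists>p\<in>elts (carrier PP). carrier p = q" if q: "q \<in> elts (carrier QQ)" for q
    proof -
      obtain w where w: "kpair q w \<in> elts (carrier PP)" using q pC1 by metis
      show ?thesis by (rule bexI[OF _ w]) simp
    qed
    show "le QQ (carrier q) (carrier p)" if l: "le PP q p" for q p
    proof -
      obtain a v b w where "q = kpair a v" "p = kpair b w" using pC P.le_carrier[OF l] by metis
      then show ?thesis using l pR1 unfolding le_def by auto
    qed
    show "\<exists>r. le PP r q \<and> le PP r s \<and> carrier r = carrier q"
      if q: "q \<in> elts (carrier PP)" and s: "s \<in> elts (carrier PP)" and l: "le QQ (carrier q) (carrier s)" for q s
    proof -
      obtain a v b w where e: "q = kpair a v" "s = kpair b w" using pC q s by metis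
      have "kpair a b \<in> elts (order_rel QQ)" using l e unfolding le_def by simp
      from plift[OF q[unfolded e] s[unfolded e] this] obtain u where
        "kpair (kpair a u) (kpair a v) \<in> elts (order_rel PP)" "kpair (kpair a u) (kpair b w) \<in> elts (order_rel PP)"
        by (elim exE conjE)
      then show ?thesis unfolding le_def e by (intro exI[of _ "kpair a u"]) simp
    qed
    show "PP = kpair (carrier PP) (order_rel PP)" unfolding PP_eq by (rule mkforcing_kpair)
    show "QQ = kpair (carrier QQ) (order_rel QQ)" unfolding P_SRP_eq by (rule mkforcing_kpair)
    show "fst_proj (carrier PP) (order_rel PP) (carrier QQ) (order_rel QQ)" by (rule fst_proj)
  qed
qed

lemma elts_carrier_QQ: "elts (carrier QQ) = srp_conds S"
  unfolding P_SRP_eq by (rule elts_carrier_mkforcing[OF small_srp_conds])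

lemma carrier_in_tc: "carrier QQ \<in> elts (tc QQ)"
proof -
  have "QQ = kpair (carrier QQ) (order_rel QQ)" unfolding P_SRP_eq by (rule mkforcing_kpair)
  then have "elts QQ = {upair (carrier QQ) (carrier QQ), upair (carrier QQ) (order_rel QQ)}"
    using elts_kpair by metis
  then have "upair (carrier QQ) (carrier QQ) \<in> elts (tc QQ)" using subset_tc[of QQ] by blast
  then have "elts (upair (carrier QQ) (carrier QQ)) \<subseteq> elts (tc QQ)"
    using Transset_tc unfolding Transset_def by (rule bspec[rotated])
  then show ?thesis by simp
qed

text \<open>Every member of \<open>S\<close> is the only entry of some chain of length one.\<close>

lemma S_subset_tc_QQ: "elts S \<subseteq> elts (tc QQ)"
proof
  fix x assume x: "x \<in> elts S"
  define z :: 'v where "z = mkset {}"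
  have z: "elts z = {}" unfolding z_def by simp
  have "cont_chain S (succ z) (\<lambda>_. x)"
    unfolding cont_chain_def
  proof (intro conjI ballI allI impI)
    fix i assume "succ i \<in> elts (succ z)"
    then have "elts (succ i) = {}" using z by auto
    then show "x \<in> elts x" by simp
  next
    fix j assume "j \<in> elts (succ z)" "Limit j"
    then show "elts x = (\<Union>i\<in>elts j. elts x)" using z unfolding Limit_def by auto
  qed (rule x)
  then have v: "vseq (succ z) (\<lambda>_. x) \<in> elts (carrier QQ)"
    unfolding elts_carrier_QQ srp_conds_def using omega1_empty_mem z_def by blast
  have T: "b \<in> elts (tc QQ)" if "b \<in> elts c" "c \<in> elts (tc QQ)" for b c
    using that Transset_tc[of QQ] unfolding Transset_def by auto
  have KT: "b \<in> elts (tc QQ)" "c \<in> elts (tc QQ)" if "kpair b c \<in> elts (tc QQ)" for b c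
  proof -
    have "upair b c \<in> elts (tc QQ)" by (rule T[OF _ that]) (simp add: elts_kpair)
    then show "b \<in> elts (tc QQ)" "c \<in> elts (tc QQ)" using T[of b "upair b c"] T[of c "upair b c"] by simp_all
  qed
  have "vseq (succ z) (\<lambda>_. x) \<in> elts (tc QQ)" using T[OF v carrier_in_tc] .
  moreover have "kpair z x \<in> elts (vseq (succ z) (\<lambda>_. x))" by simp
  ultimately have "kpair z x \<in> elts (tc QQ)" using T by metis
  then show "x \<in> elts (tc QQ)" by (rule KT(2))
qed

text \<open>As \<open>S\<close> is uncountable and included in the transitive closure of \<open>QQ\<close>, \<open>omega1\<close> is at most \<open>\<theta>\<close>; so passing
  from chains to pairs of a chain and a countable length does not leave hereditary size \<open>\<theta>\<close>.\<close>

lemma QQ_size: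
  assumes "Card \<theta>" "QQ \<in> elts (Hset \<theta>)" "uncountable (elts S)"
  shows "infinite (elts \<theta>) \<and> PP \<in> elts (Hset (csucc \<theta>))"
proof -
  have O: "Ord \<theta>" using assms(1) unfolding Card_def by simp
  have hQ: "hered \<theta> QQ" using Hset_hered[OF assms(2)] .
  have S\<theta>: "elts S \<lesssim> elts \<theta>"
    using lepoll_trans[OF subset_imp_lepoll[OF S_subset_tc_QQ] hQ[unfolded hered_def]] .
  have unc: "uncountable (elts \<theta>)" using S\<theta> assms(3) countable_lepoll by metis
  then have inf: "infinite (elts \<theta>)" using countable_finite by metis
  have w1: "elts (omega1::'v) \<lesssim> elts \<theta>" using subset_imp_lepoll[OF omega1_props(4)[OF O unc]] .
  have hS: "hered \<theta> S" using heredI[OF inf S\<theta>] hered_tc[OF hQ] S_subset_tc_QQ by blast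
  have c\<theta>: "elts x \<lesssim> elts \<theta>" if "x \<in> elts (omega1::'v)" for x
    using that w1 Ord_trans[OF omega1_props(1) _ that] subset_imp_lepoll[of "elts x" "elts omega1"] lepoll_trans
    by blast
  have ho: "hered \<theta> l" if "l \<in> elts (omega1::'v)" for l
    using hered_Ord[OF Ord_elts[OF omega1_props(1) that] c\<theta>[OF that]] .
  have hv: "hered \<theta> (vseq l (\<lambda>_. S))" if l: "l \<in> elts (omega1::'v)" for l
  proof (rule heredI[OF inf])
    show "elts (vseq l (\<lambda>_. S)) \<lesssim> elts \<theta>" unfolding elts_vseq
      using image_lepoll c\<theta>[OF l] by (rule lepoll_trans)
    fix z assume "z \<in> elts (vseq l (\<lambda>_. S))"
    then obtain i where i: "z = kpair i S" "i \<in> elts l" by auto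
    have "i \<in> elts omega1" using Ord_trans[OF omega1_props(1) i(2) l] .
    then show "hered \<theta> z" unfolding i(1) using hered_kpair[OF inf] ho hS by metis
  qed
  have T: "b \<in> elts (tc QQ)" if "b \<in> elts c" "c \<in> elts (tc QQ)" for b c
    using that Transset_tc[of QQ] unfolding Transset_def by auto
  have ct: "srp_conds S \<subseteq> elts (tc QQ)" using T[OF _ carrier_in_tc] unfolding elts_carrier_QQ[symmetric] by (rule subsetI)
  then have c\<theta>': "srp_conds S \<lesssim> elts \<theta>"
    using lepoll_trans[OF subset_imp_lepoll[OF ct] hQ[unfolded hered_def]] by simp
  have hc: "hered \<theta> q" if "q \<in> srp_conds S" for q using hered_tc[OF hQ] ct that by blast
  have hd: "hered \<theta> z" if "z \<in> dsrp_conds" for z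
    using that hered_kpair[OF inf] hc hv unfolding dsrp_conds_def by blast
  have "dsrp_conds \<subseteq> (\<lambda>(q, l). kpair q (vseq l (\<lambda>_. S))) ` (srp_conds S \<times> elts omega1)"
    unfolding dsrp_conds_def by auto
  then have d\<theta>: "dsrp_conds \<lesssim> elts \<theta>"
    using subset_image_lepoll Times_lepoll[OF inf c\<theta>' w1] lepoll_trans by metis
  note e = elts_carrier_mkforcing[OF small_dsrp_conds] elts_order_mkforcing[OF small_dsrp_conds]
  have "hered \<theta> (carrier PP)"
    by (rule heredI[OF inf]) (use d\<theta> hd e(1)[of dsrp_le] in \<open>simp_all add: PP_eq\<close>)
  moreover have "hered \<theta> (order_rel PP)"
  proof (rule heredI[OF inf])
    have "elts (order_rel PP) \<subseteq> (\<lambda>(q, p). kpair q p) ` (dsrp_conds \<times> dsrp_conds)"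
      unfolding PP_eq e(2) by auto
    then show "elts (order_rel PP) \<lesssim> elts \<theta>"
      using subset_image_lepoll Times_lepoll[OF inf d\<theta> d\<theta>] lepoll_trans by metis
    show "hered \<theta> z" if "z \<in> elts (order_rel PP)" for z
      using that hd hered_kpair[OF inf] unfolding PP_eq e(2) by blast
  qed
  ultimately have "hered \<theta> (kpair (carrier PP) (order_rel PP))" by (rule hered_kpair[OF inf])
  then have "hered \<theta> PP" unfolding PP_eq mkforcing_kpair[symmetric] .
  then show ?thesis using hered_Hset[OF O] inf by simp
qed

end

theorem mainTheorem9:
  fixes \<Gamma> :: "'v::zfc set"
  assumes "\<Gamma> = SSP \<or> \<Gamma> = infinity_SC"
    and "DSRP \<Gamma>"
  shows "SRP \<Gamma>"
  unfolding SRP_def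
proof (intro allI impI; elim conjE)
  fix \<kappa> S :: 'v
  assume \<kappa>: "regular \<kappa>" "elts omega2 \<subseteq> elts \<kappa>"
    and S: "stationary_in (Hset \<kappa>) omega (elts S)" and PS: "P_SRP S \<in> \<Gamma>"
  have O\<kappa>: "Ord \<kappa>" using \<kappa>(1) unfolding regular_def Card_def by simp
  have w1\<kappa>: "omega1 \<in> elts \<kappa>" using \<kappa>(2) omega1_in_omega2 by auto
  have "elts omega1 \<subseteq> elts \<kappa>" using Ord_trans[OF O\<kappa> _ w1\<kappa>] by auto
  then have "elts omega1 \<subseteq> elts (Hset \<kappa>)" by (rule omega1_subset_Hset[OF O\<kappa>])
  then have "uncountable (elts (Hset \<kappa>))" using omega1_props(2) countable_subset by metis
  then have uS: "uncountable (elts S)" by (rule stationary_in_uncountable[OF S])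
  obtain T :: "'v \<Rightarrow> 'v" where T: "\<forall>i\<in>elts omega1. stat1 (elts (T i))"
     "\<forall>i\<in>elts omega1. \<forall>j\<in>elts omega1. i \<noteq> j \<longrightarrow> elts (T i) \<inter> elts (T j) = {}"
     "\<forall>a\<in>elts omega1. \<exists>i\<in>elts omega1. a \<in> elts (T i)"
    using stationary_partition by metis
  have Ssub: "elts S \<subseteq> elts (subsets_le (Hset \<kappa>) omega)" using S unfolding stationary_in_def by simp
  interpret dsrp_setup \<kappa> S T
    using Ssub T by unfold_locales simp_all
  have fQ: "forcing_notion QQ" using PS assms(1) unfolding SSP_def infinity_SC_def by auto
  interpret fst_projection PP QQ by (rule fst_projection[OF fQ])
  have "PP \<in> \<Gamma>"
    using assms(1)
  proof
    assume "\<Gamma> = SSP"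
    then show ?thesis using SSP_lift PS by simp
  next
    assume "\<Gamma> = infinity_SC"
    then show ?thesis using infinity_SC_lift QQ_size uS PS by blast
  qed
  then have "DSRP_at \<kappa> (upair S S) T"
    using assms(2)[unfolded DSRP_def, rule_format, of \<kappa> "upair S S" T] \<kappa>(1) w1\<kappa> S T(1,2)
    by (simp add: stationary_iff_stat1)
  then obtain \<theta> where \<theta>: "regular \<theta>" "elts (upair S S) \<subseteq> elts (Hset \<theta>)"
    and st: "stationary_in (Hset \<theta>) omega1
          {X \<in> elts (subsets_le (Hset \<theta>) omega1).
             elts omega1 \<subseteq> elts X \<and> (\<exists>Q S'. diagonal_chain \<kappa> (upair S S) T X Q S')}"
    unfolding DSRP_at_def by (elim exE conjE)
  have "infinite (elts (omega1::'v))" using omega1_props(2) countable_finite by metis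
  moreover have "S \<in> elts (Hset \<theta>)" using \<theta>(2) by simp
  ultimately obtain X Q S' where d: "diagonal_chain \<kappa> (upair S S) T X Q S'"
    using stationary_in_nonempty[OF _ _ st] by blast
  then have Q: "cont_chain (subsets_le (Hset \<kappa>) omega) omega1 Q"
    and S': "\<forall>i\<in>elts omega1. S' i \<in> elts (upair S S)"
    and QS: "\<forall>i\<in>elts omega1. \<forall>j\<in>elts omega1. i \<in> elts (T j) \<longrightarrow> Q i \<in> elts (S' j)"
    unfolding diagonal_chain_def by auto
  \<comment> \<open>Each index lies in some piece of the partition, and all stationary sets listed are equal to \<open>S\<close>.\<close>
  have "Q i \<in> elts S" if i: "i \<in> elts omega1" for i
  proof -
    obtain j where j: "j \<in> elts omega1" "i \<in> elts (T j)" using T(3) i by metis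
    then have "S' j = S" using S' by simp
    then show ?thesis using QS i j by metis
  qed
  then show "\<exists>Q. cont_chain S omega1 Q" using cont_chain_subset[OF Q] by metis
qed

end
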